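(* Consider the $q$-difference equation $(1-qt)f(qt,q)-f(t,q)=0$ with the $1\times1$ fundamental matrices $U(t,q)=(f^{(0)}(t,q))$ at $t=0$ and $V(t,q)=(g^{(1)}(t,q))$ at $t=\infty$, where $$f^{(0)}(t,q)=(qt;q)_\infty,\qquad g^{(1)}(t,q)=\frac{\theta(t;q)}{(t^{-1};q)_\infty(q;q)_\infty},$$ both of weight $\kappa=0$. Then the monodromy matrix $V(t,q)^{-1}U(t,q)$ equals $(1)$. The two cocycles $\Omega_{U,\gamma}=(U|_0\gamma)U^{-1}$ and $\Omega_{V,\gamma}=(V|_0\gamma)V^{-1}$ are equal, and modular: writing $\Omega_\gamma$ for their common value, for every $\gamma\in \mathrm{SL}_2(\mathbb Z)$ the function $\Omega_\gamma(z,\tau)$ extends to a meromorphic function of $(z,\tau)\in\mathbb C\times\mathbb C_\gamma$ with potential poles at $z\in S_\gamma+\mathbb Z+\tau\mathbb Z$ for a finite set $S_\gamma$. For $\gamma=S=\begin{pmatrix}0&-1\\1&0\end{pmatrix}$, $$\Omega_S(z,\tau)=\Phi_{\mathsf b}\Big(\frac{iz}{\mathsf b}+\frac{i\mathsf b}{2}+\frac{1}{2i\mathsf b}\Big)^{-1},\qquad \mathsf b=\sqrt\tau .$$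
   Context: Notation: $\mathbf e(x)=e^{2\pi ix}$, $\tau\in\mathbb C\setminus\mathbb R$, $q=\mathbf e(\tau)$, $t=\mathbf e(z)$. For $|q|<1$, $(x;q)_\infty=\prod_{i\ge0}(1-q^ix)$; for $|q|>1$ one sets $(x;q)_\infty=(q^{-1}x;q^{-1})_\infty^{-1}$, and $(q;q)_\infty=(q^{-1};q^{-1})_\infty^{-1}$. The theta function is $\theta(t;q)=(qt;q)_\infty(t^{-1};q)_\infty(q;q)_\infty$. $\gamma=\begin{pmatrix}a&b\\c&d\end{pmatrix}\in\mathrm{SL}_2(\mathbb Z)$ acts by $\gamma(z,\tau)=\left(\frac z{c\tau+d},\frac{a\tau+b}{c\tau+d}\right)$ and $F|_0\gamma=F\circ\gamma$ (functions of $(t,q)$ being viewed as functions of $(z,\tau)$). $\mathbb C_\gamma$ is $\mathbb C\setminus(-\infty,-d/c]$ if $c>0$, $\mathbb C\setminus[-d/c,\infty)$ if $c<0$, $\mathbb C\setminus\mathbb R$ if $c=0$. Faddeev's quantum dilogarithm: for $\mathrm{Im}(\mathsf b^2)>0$, $\Phi_{\mathsf b}(x)=\dfrac{(e^{2\pi\mathsf b(x+c_{\mathsf b})};q)_\infty}{(e^{2\pi\mathsf b^{-1}(x-c_{\mathsf b})};\tilde q)_\infty}$ with $q=e^{2\pi i\mathsf b^2}$, $\tilde q=e^{-2\pi i\mathsf b^{-2}}$, $c_{\mathsf b}=\frac i2(\mathsf b+\mathsf b^{-1})$; it extends to a meromorphic function of $x\in\mathbb C$ for all $\mathsf b^2\in\mathbb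 C'=\mathbb C\setminus(-\infty,0]$, depending analytically on $\mathsf b$. *)

theory Defs
  imports "HOL-Complex_Analysis.Complex_Analysis"
begin

section \<open>Functions of two complex variables\<close>

text \<open>Holomorphy is complex (Frechet) differentiability at every point of an open set.\<close>

definition holomorphic2_on :: "(complex \<times> complex \<Rightarrow> complex) \<Rightarrow> (complex \<times> complex) set \<Rightarrow> bool" where
  "holomorphic2_on F D \<longleftrightarrow>
     open D \<and> (\<forall>p\<in>D. \<exists>A B. (F has_derivative (\<lambda>(u, v). A * u + B * v)) (at p))"

definition holomorphic2_at :: "(complex \<times> complex \<Rightarrow> complex) \<Rightarrow> complex \<times> complex \<Rightarrow> bool" where
  "holomorphic2_at F p \<longleftrightarrow> (\<exists>W. p \<in> W \<and> holomorphic2_on F W)"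

text \<open>A meromorphic function is locally a quotient of holomorphic functions whose denominator
  vanishes on no nonempty open set; its values on the zero set of the denominator carry no
  information.\<close>

definition meromorphic2_on :: "(complex \<times> complex \<Rightarrow> complex) \<Rightarrow> (complex \<times> complex) set \<Rightarrow> bool" where
  "meromorphic2_on F D \<longleftrightarrow>
     open D \<and>
     (\<forall>p\<in>D. \<exists>W g h. p \<in> W \<and> W \<subseteq> D \<and> holomorphic2_on g W \<and> holomorphic2_on h W \<and>
        (\<forall>O'. open O' \<and> O' \<noteq> {} \<and> O' \<subseteq> W \<longrightarrow> (\<exists>x\<in>O'. h x \<noteq> 0)) \<and>
        (\<forall>x\<in>W. h x \<noteq> 0 \<longrightarrow> F x = g x / h x))"


section \<open>Infinite Pochhammer symbols and the theta function\<close>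

definition ee :: "complex \<Rightarrow> complex" where
  "ee x = exp (2 * of_real pi * \<i> * x)"

text \<open>Only used for \<open>norm q \<noteq> 1\<close> and \<open>q \<noteq> 0\<close>; where the function has a pole
  (possible only for \<open>norm q > 1\<close>) it takes the value 0.\<close>

definition qpoch :: "complex \<Rightarrow> complex \<Rightarrow> complex" where
  "qpoch x q = (if norm q < 1 then (\<Prod>i. 1 - q ^ i * x)
                else inverse (\<Prod>i. 1 - inverse q ^ i * (inverse q * x)))"

text \<open>The symbol \<open>(q;q)\<close> has its own convention for \<open>norm q > 1\<close>: it is not
  \<open>qpoch q q\<close>, which has a pole there.\<close>

definition qpoch_self :: "complex \<Rightarrow> complex" where
  "qpoch_self q = (if norm q < 1 then qpoch q q else inverse (qpoch (inverse q) (inverse q)))"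

definition theta :: "complex \<Rightarrow> complex \<Rightarrow> complex" where
  "theta t q = qpoch (q * t) q * qpoch (inverse t) q * qpoch_self q"


section \<open>The $q$-difference equation and its fundamental matrices\<close>

text \<open>All zeros and poles in \<open>t\<close> of the functions below lie on the spiral of integer powers
  of \<open>q\<close>; identities between meromorphic functions of \<open>(t, q)\<close> are stated off it.\<close>

definition generic :: "complex \<Rightarrow> complex \<Rightarrow> bool" where
  "generic t q \<longleftrightarrow> q \<noteq> 0 \<and> norm q \<noteq> 1 \<and> t \<noteq> 0 \<and> (\<forall>k::int. t \<noteq> q powi k)"

definition fundamental_matrix :: "(complex \<Rightarrow> complex \<Rightarrow> complex ^ 1 ^ 1) \<Rightarrow> bool" where
  "fundamental_matrix W \<longleftrightarrow>
     (\<forall>t q. generic t q \<longrightarrow> mat (1 - q * t) ** W (q * t) q - W t q = 0 \<and> invertible (W t q))"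

definition f0 :: "complex \<Rightarrow> complex \<Rightarrow> complex" where
  "f0 t q = qpoch (q * t) q"

definition g1 :: "complex \<Rightarrow> complex \<Rightarrow> complex" where
  "g1 t q = theta t q / (qpoch (inverse t) q * qpoch_self q)"

definition fund_U :: "complex \<Rightarrow> complex \<Rightarrow> complex ^ 1 ^ 1" where
  "fund_U t q = (\<chi> i j. f0 t q)"

definition fund_V :: "complex \<Rightarrow> complex \<Rightarrow> complex ^ 1 ^ 1" where
  "fund_V t q = (\<chi> i j. g1 t q)"


section \<open>Modular action and cocycles\<close>

definition SL2Z :: "(int ^ 2 ^ 2) set" where
  "SL2Z = {\<gamma>. det \<gamma> = 1}"

definition S_mat :: "int ^ 2 ^ 2" where
  "S_mat = vector [vector [0, -1], vector [1, 0]]"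

definition act :: "int ^ 2 ^ 2 \<Rightarrow> complex \<times> complex \<Rightarrow> complex \<times> complex" where
  "act \<gamma> = (\<lambda>(z, \<tau>).
     (z / (of_int (\<gamma>$2$1) * \<tau> + of_int (\<gamma>$2$2)),
      (of_int (\<gamma>$1$1) * \<tau> + of_int (\<gamma>$1$2)) / (of_int (\<gamma>$2$1) * \<tau> + of_int (\<gamma>$2$2))))"

definition slash0 :: "(complex \<times> complex \<Rightarrow> 'a) \<Rightarrow> int ^ 2 ^ 2 \<Rightarrow> complex \<times> complex \<Rightarrow> 'a" where
  "slash0 F \<gamma> = F \<circ> act \<gamma>"

definition lift_tq :: "(complex \<Rightarrow> complex \<Rightarrow> 'a) \<Rightarrow> complex \<times> complex \<Rightarrow> 'a" where
  "lift_tq F = (\<lambda>(z, \<tau>). F (ee z) (ee \<tau>))"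

definition cocycle ::
    "(complex \<Rightarrow> complex \<Rightarrow> complex ^ 1 ^ 1) \<Rightarrow> int ^ 2 ^ 2 \<Rightarrow> complex \<times> complex \<Rightarrow> complex ^ 1 ^ 1" where
  "cocycle W \<gamma> p = slash0 (lift_tq W) \<gamma> p ** matrix_inv (lift_tq W p)"

definition C_dom :: "int ^ 2 ^ 2 \<Rightarrow> complex set" where
  "C_dom \<gamma> =
     (let c = \<gamma>$2$1; r = - (real_of_int (\<gamma>$2$2) / real_of_int c) in
      if c > 0 then - (complex_of_real ` {..r})
      else if c < 0 then - (complex_of_real ` {r..})
      else - \<real>)"

definition lattice_translates :: "complex set \<Rightarrow> complex \<Rightarrow> complex set" where
  "lattice_translates A \<tau> = {s + of_int m + of_int n * \<tau> | s m n. s \<in> A}"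


section \<open>Faddeev's quantum dilogarithm\<close>

definition c_b :: "complex \<Rightarrow> complex" where
  "c_b b = \<i> / 2 * (b + inverse b)"

definition faddeev_num :: "complex \<Rightarrow> complex \<Rightarrow> complex" where
  "faddeev_num b x = qpoch (exp (2 * of_real pi * b * (x + c_b b))) (ee (b ^ 2))"

definition faddeev_den :: "complex \<Rightarrow> complex \<Rightarrow> complex" where
  "faddeev_den b x = qpoch (exp (2 * of_real pi * inverse b * (x - c_b b))) (ee (- inverse (b ^ 2)))"

text \<open>Meromorphic continuations, in the pair \<open>(x, b)\<close>, of the product formula from
  \<open>Im (b\<^sup>2) > 0\<close> to all \<open>b\<close> with \<open>b\<^sup>2\<close> off the closed negative real axis.\<close>

definition faddeev_continuation :: "(complex \<times> complex \<Rightarrow> complex) \<Rightarrow> bool" where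
  "faddeev_continuation \<Phi> \<longleftrightarrow>
     meromorphic2_on \<Phi> (UNIV \<times> {b. b ^ 2 \<notin> \<real>\<^sub>\<le>\<^sub>0}) \<and>
     (\<forall>b x. Im (b ^ 2) > 0 \<and> faddeev_den b x \<noteq> 0 \<longrightarrow>
        \<Phi> (x, b) = faddeev_num b x / faddeev_den b x)"

text \<open>Each component of the domain meets \<open>Im (b\<^sup>2) > 0\<close>, so continuations agree as
  meromorphic functions, but they may differ in their irrelevant values on polar sets. The value of
  the quantum dilogarithm at a point is that of any continuation holomorphic near the point (the
  description is meaningless at poles).\<close>

definition faddeev :: "complex \<Rightarrow> complex \<Rightarrow> complex" where
  "faddeev b x =
     (THE y. \<exists>\<Phi>. faddeev_continuation \<Phi> \<and> holomorphic2_at \<Phi> (x, b) \<and> y = \<Phi> (x, b))"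

end

theory Submission imports Defs begin

text \<open>Write \<open>U (z, \<tau>)\<close> for \<open>f0\<close> in additive variables. At generic points \<open>g1 = f0\<close>, so everything
  concerns \<open>U\<close>. The product formula for \<open>(U \<circ> S) / U\<close> extends across \<open>\<tau> > 0\<close> because it equals the
  exponential of \<open>\<integral> e(wx) / (x (e(x) - 1) (e(\<tau>x) - 1)) dx\<close>, \<open>w = z + \<tau>\<close>, along a vertical line in
  \<open>0 < Re x < min 1 (Re (1/\<tau>))\<close>. This integral is analytic for \<open>Re \<tau> > 0\<close>, whatever the sign of
  \<open>Im \<tau>\<close>; its exponential satisfies the same two difference equations (shifts by \<open>1\<close> and \<open>\<tau>\<close>) as the
  product and tends to 1 as \<open>Im z\<close> grows, which identifies the two. The restriction on \<open>Re z\<close> needed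
  for convergence is removed with the difference equation.

  For \<open>\<gamma>\<close> with lower row \<open>c > 0\<close>, \<open>d\<close>, splitting both products according to residues modulo \<open>c\<close> writes
  the cocycle at \<open>\<gamma>\<close> as a product of \<open>c\<close> values of the cocycle at \<open>S\<close> with modular parameter
  \<open>c \<tau> + d\<close>; the case \<open>c < 0\<close> follows by passing to the inverse matrix. The zeros and poles are always
  lattice points, so \<open>S\<^sub>\<gamma> = {0}\<close>.\<close>

section \<open>Functions of two complex variables\<close>

text \<open>Why this integral: on \<open>x = \<epsilon> + \<i> y\<close> a factor
  \<open>1 / (e(\<alpha> x) - 1)\<close> is bounded for \<open>y > 0\<close> and decays like
  \<open>exp (2 \<pi> Re \<alpha> y)\<close> for \<open>y < 0\<close>, so \<open>e(w x)\<close> is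
  absorbed for \<open>0 < Re w < 1 + Re \<tau>\<close>. Adding a period to \<open>w\<close> cancels
  one factor. The remaining one-kernel integral is a logarithm of \<open>1 - e(w/\<alpha>)\<close>:
  differentiating in \<open>w\<close> removes \<open>1/x\<close> and leaves a Fourier integral that
  the residue theorem evaluates. All this serves only neighbourhoods of \<open>\<tau> > 0\<close>;
  the other points of the slit plane are non-real, and there the products themselves are
  meromorphic. A second obstacle is division by zero: the raw cocycle is meaningful only for
  non-real \<open>\<tau>\<close> and off the lattice. The claims are therefore proved for its limit
  along the dense set of generic points, using local quotients whose numerator and denominator do
  not vanish there. The quantum dilogarithm, defined as the value of any continuation holomorphic at
  the point, is pinned down by an identity theorem that tolerates arbitrary values on polar
  sets.\<close>

lemma holomorphic2_on_imp_continuous_on: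
  "holomorphic2_on f S \<Longrightarrow> continuous_on S f"
  unfolding holomorphic2_on_def
proof (intro continuous_at_imp_continuous_on ballI)
  fix p assume "open S \<and> (\<forall>p\<in>S. \<exists>A B. (f has_derivative (\<lambda>(u, v). A * u + B * v)) (at p))" "p \<in> S"
  then obtain A B where "(f has_derivative (\<lambda>(u, v). A * u + B * v)) (at p)" by blast
  then show "isCont f p" by (rule has_derivative_continuous)
qed

lemma holomorphic2_on_subset:
  "holomorphic2_on f S \<Longrightarrow> open T \<Longrightarrow> T \<subseteq> S \<Longrightarrow> holomorphic2_on f T"
  unfolding holomorphic2_on_def by blast

text \<open>Osgood's lemma: Cauchy's inequality makes the partial derivative jointly continuous.\<close>

lemma osgood:
  fixes f :: "complex \<times> complex \<Rightarrow> complex"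
  assumes S: "open S" and cont: "continuous_on S f"
    and h1: "\<And>a b. (a, b) \<in> S \<Longrightarrow> (\<lambda>z. f (z, b)) field_differentiable at a"
    and h2: "\<And>a b. (a, b) \<in> S \<Longrightarrow> (\<lambda>w. f (a, w)) field_differentiable at b"
  shows "holomorphic2_on f S"
  unfolding holomorphic2_on_def
proof (intro conjI ballI S)
  fix p assume "p \<in> S"
  obtain a b where p: "p = (a, b)" by (cases p)
  obtain A B where AB: "open A" "open B" "a \<in> A" "b \<in> B" "A \<times> B \<subseteq> S"
    using open_prod_elim[OF S \<open>p \<in> S\<close>] p by (metis mem_Sigma_iff)
  obtain ra where ra: "ra > 0" "cball a ra \<subseteq> A" using AB(1,3) unfolding open_contains_cball by blast
  obtain rb where rb: "rb > 0" "cball b rb \<subseteq> B" using AB(2,4) unfolding open_contains_cball by blast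
  let ?X = "cball a ra" and ?Y = "ball b (rb / 2)"
  have sub: "?X \<times> cball b rb \<subseteq> S"
    using Sigma_mono[OF ra(2) rb(2)] AB(5) by (rule order_trans)
  have inS: "(x, y) \<in> S" if "x \<in> ?X" "y \<in> cball b rb" for x y
    using sub that by (auto dest: subsetD)
  have hol: "(\<lambda>w. f (x, w)) holomorphic_on ball b rb" if "x \<in> ?X" for x
    unfolding holomorphic_on_def
    by (rule ballI, rule field_differentiable_at_within, rule h2, rule inS[OF that]) auto
  have der: "((\<lambda>w. f (x, w)) has_field_derivative deriv (\<lambda>w. f (x, w)) y) (at y)"
    if "x \<in> ?X" "y \<in> ball b rb" for x y
    by (rule field_differentiable_derivI, rule h2, rule inS) (use that in auto)
  have uc: "uniformly_continuous_on (?X \<times> cball b rb) f"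
    by (intro compact_uniformly_continuous continuous_on_subset[OF cont sub] compact_Times
        compact_cball)
  define D where "D = (\<lambda>x y. deriv (\<lambda>w. f (x, w)) y)"
  have contD: "continuous (at (a, b) within ?X \<times> ?Y) (\<lambda>(x, y). D x y)"
    unfolding continuous_within_eps_delta
  proof (intro allI impI)
    fix e :: real assume "e > 0"
    \<comment> \<open>With radius \<open>rb / 2\<close>, Cauchy's inequality turns the bound
      \<open>e'\<close> into \<open>e / 4\<close>, which leaves \<open>e / 2\<close> for the
      variation of \<open>D a\<close>.\<close>
    define e' where "e' = e * rb / 8"
    have "e' > 0" using \<open>e > 0\<close> rb by (simp add: e'_def)
    then obtain d where d: "d > 0"
      "\<And>u v. u \<in> ?X \<times> cball b rb \<Longrightarrow> v \<in> ?X \<times> cball b rb \<Longrightarrow> dist v u < d \<Longrightarrow> dist (f v) (f u) < e'"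
      using uc unfolding uniformly_continuous_on_def by blast
    have "(D a) holomorphic_on ball b rb"
      unfolding D_def using hol[of a] ra by (intro holomorphic_deriv) auto
    then have "continuous (at b) (D a)"
      using rb by (metis centre_in_ball holomorphic_on_imp_continuous_on continuous_on_eq_continuous_at open_ball)
    then obtain d2 where d2: "d2 > 0" "\<And>y. dist y b < d2 \<Longrightarrow> dist (D a y) (D a b) < e / 2"
      using \<open>e > 0\<close> unfolding continuous_at_eps_delta by (meson half_gt_zero)
    show "\<exists>d>0. \<forall>x'\<in>?X \<times> ?Y. dist x' (a, b) < d \<longrightarrow>
             dist (case x' of (x, y) \<Rightarrow> D x y) (case (a, b) of (x, y) \<Rightarrow> D x y) < e"
    proof (intro exI[of _ "min d d2"] conjI ballI impI)
      show "min d d2 > 0" using d d2 by simp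
      fix q assume q: "q \<in> ?X \<times> ?Y" "dist q (a, b) < min d d2"
      obtain x y where xy: "q = (x, y)" by (cases q)
      have x: "x \<in> ?X" and y: "y \<in> ?Y" using q xy by auto
      have dx: "dist x a < d" and dy: "dist y b < d2"
        using q xy dist_fst_le[of q "(a,b)"] dist_snd_le[of q "(a,b)"] by auto
      have suby: "cball y (rb/2) \<subseteq> ball b rb"
      proof
        fix w assume "w \<in> cball y (rb/2)"
        then show "w \<in> ball b rb"
          using y dist_triangle[of b w y] by (auto simp: dist_commute)
      qed
      let ?g = "\<lambda>w. f (x, w) - f (a, w)"
      have holg: "?g holomorphic_on ball b rb"
        using hol x ra by (intro holomorphic_intros) auto
      have "norm ((deriv ^^ 1) ?g y) \<le> fact 1 * e' / (rb/2) ^ 1"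
      proof (rule Cauchy_inequality)
        show "?g holomorphic_on ball y (rb/2)"
          using holg suby by (meson ball_subset_cball holomorphic_on_subset order_trans)
        show "continuous_on (cball y (rb/2)) ?g"
          using holg suby holomorphic_on_imp_continuous_on continuous_on_subset by blast
        show "rb/2 > 0" using rb by simp
        fix w assume "norm (y - w) = rb/2"
        then have "w \<in> ball b rb" using suby by (auto simp: dist_norm)
        then have "dist (f (x, w)) (f (a, w)) < e'"
          using x ra dx by (intro d(2)) (auto simp: dist_Pair_Pair)
        then show "norm (?g w) \<le> e'" by (simp add: dist_norm)
      qed
      then have "norm (deriv ?g y) \<le> e / 4" using rb by (simp add: e'_def field_simps)
      moreover have "deriv ?g y = D x y - D a y"
        unfolding D_def using der x y ra rb
        by (intro DERIV_imp_deriv DERIV_diff) auto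
      ultimately have "dist (D x y) (D a y) \<le> e / 4" by (simp add: dist_norm)
      then have "dist (D x y) (D a b) < e"
        using d2(2)[OF dy] dist_triangle[of "D x y" "D a b" "D a y"] \<open>e > 0\<close> by linarith
      then show "dist (case q of (x, y) \<Rightarrow> D x y) (case (a, b) of (x, y) \<Rightarrow> D x y) < e"
        by (simp add: xy)
    qed
  qed
  define A' where "A' = deriv (\<lambda>z. f (z, b)) a"
  \<comment> \<open>Joint continuity at the point is required of one partial derivative only; of the
    other, existence there is enough.\<close>
  have "((\<lambda>(x, y). f (x, y)) has_derivative
      (\<lambda>(tx, ty). A' * tx + blinfun_apply (blinfun_mult_right (D a b)) ty)) (at (a, b) within ?X \<times> ?Y)"
  proof (rule has_derivative_partialsI)
    show "((\<lambda>x. f (x, b)) has_derivative (*) A') (at a within ?X)"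
      unfolding A'_def
      by (rule has_derivative_at_withinI, rule has_field_derivative_imp_has_derivative,
          rule field_differentiable_derivI, rule h1) (use \<open>p \<in> S\<close> p in simp)
    show "((\<lambda>y. f (x, y)) has_derivative blinfun_apply (blinfun_mult_right (D x y))) (at y within ?Y)"
      if "x \<in> ?X" "y \<in> ?Y" for x y
    proof -
      have "((\<lambda>w. f (x, w)) has_field_derivative D x y) (at y)"
        unfolding D_def using that rb by (intro der) auto
      then show ?thesis
        unfolding has_field_derivative_def by (simp add: has_derivative_at_withinI)
    qed
    have "continuous (at (a, b) within ?X \<times> ?Y) (\<lambda>q. blinfun_mult_right (case q of (x, y) \<Rightarrow> D x y))"
      by (rule continuous_within_compose3[OF linear_continuous_at contD])
         (rule bounded_linear_blinfun_mult_right)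
    then show "continuous (at (a, b) within ?X \<times> ?Y) (\<lambda>(x, y). blinfun_mult_right (D x y))"
      unfolding case_prod_unfold .
  qed (use rb in auto)
  moreover have "at (a, b) within ?X \<times> ?Y = at (a, b)"
  proof (rule at_within_interior)
    have "ball a ra \<times> ?Y \<subseteq> interior (?X \<times> ?Y)"
      by (rule interior_maximal) (auto intro: open_Times)
    then show "(a, b) \<in> interior (?X \<times> ?Y)" using ra rb by auto
  qed
  ultimately show "\<exists>A B. (f has_derivative (\<lambda>(u, v). A * u + B * v)) (at p)"
    unfolding p by (auto simp: blinfun_mult_right.rep_eq)
qed

lemma holomorphic2_slice1:
  assumes "holomorphic2_on f S" "(a, b) \<in> S"
  shows "(\<lambda>z. f (z, b)) field_differentiable at a"
proof -
  obtain A B where "(f has_derivative (\<lambda>(u, v). A * u + B * v)) (at (a, b))"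
    using assms unfolding holomorphic2_on_def by blast
  then have "((f \<circ> (\<lambda>z. (z, b))) has_derivative ((\<lambda>(u, v). A * u + B * v) \<circ> (\<lambda>u. (u, 0)))) (at a)"
    by (intro diff_chain_at) (auto intro!: derivative_eq_intros)
  then have "((\<lambda>z. f (z, b)) has_derivative (*) A) (at a)" by (simp add: o_def)
  then show ?thesis unfolding field_differentiable_def has_field_derivative_def by blast
qed

lemma holomorphic2_slice2:
  assumes "holomorphic2_on f S" "(a, b) \<in> S"
  shows "(\<lambda>w. f (a, w)) field_differentiable at b"
proof -
  obtain A B where "(f has_derivative (\<lambda>(u, v). A * u + B * v)) (at (a, b))"
    using assms unfolding holomorphic2_on_def by blast
  then have "((f \<circ> (\<lambda>z. (a, z))) has_derivative ((\<lambda>(u, v). A * u + B * v) \<circ> (\<lambda>u. (0, u)))) (at b)"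
    by (intro diff_chain_at) (auto intro!: derivative_eq_intros)
  then have "((\<lambda>z. f (a, z)) has_derivative (*) B) (at b)" by (simp add: o_def)
  then show ?thesis unfolding field_differentiable_def has_field_derivative_def by blast
qed

section \<open>Closure properties of holomorphy in two variables\<close>

lemma holomorphic2_on_fst: "open S \<Longrightarrow> holomorphic2_on fst S"
  by (rule osgood) (simp_all add: continuous_on_fst continuous_on_id)

lemma holomorphic2_on_snd: "open S \<Longrightarrow> holomorphic2_on snd S"
  by (rule osgood) (simp_all add: continuous_on_snd continuous_on_id)

lemma holomorphic2_on_const: "open S \<Longrightarrow> holomorphic2_on (\<lambda>p. c) S"
  by (rule osgood) simp_all

text \<open>Osgood's lemma reduces this rule and its companions below to continuity and the
  one-variable rule on each slice.\<close>

lemma holomorphic2_on_mult: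
  assumes "holomorphic2_on f S" "holomorphic2_on g S"
  shows "holomorphic2_on (\<lambda>p. f p * g p) S"
proof (rule osgood)
  show "open S" using assms(1) by (simp add: holomorphic2_on_def)
  show "continuous_on S (\<lambda>p. f p * g p)"
    by (intro continuous_on_mult holomorphic2_on_imp_continuous_on assms(1,2))
  fix a b assume ab: "(a, b) \<in> S"
  show "(\<lambda>z. f (z, b) * g (z, b)) field_differentiable at a"
    by (intro field_differentiable_mult holomorphic2_slice1[OF _ ab] assms(1,2))
  show "(\<lambda>z. f (a, z) * g (a, z)) field_differentiable at b"
    by (intro field_differentiable_mult holomorphic2_slice2[OF _ ab] assms(1,2))
qed

lemma holomorphic2_on_add:
  assumes "holomorphic2_on f S" "holomorphic2_on g S"
  shows "holomorphic2_on (\<lambda>p. f p + g p) S"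
proof (rule osgood)
  show "open S" using assms(1) by (simp add: holomorphic2_on_def)
  show "continuous_on S (\<lambda>p. f p + g p)"
    by (intro continuous_on_add holomorphic2_on_imp_continuous_on assms(1,2))
  fix a b assume ab: "(a, b) \<in> S"
  show "(\<lambda>z. f (z, b) + g (z, b)) field_differentiable at a"
    by (intro field_differentiable_add holomorphic2_slice1[OF _ ab] assms(1,2))
  show "(\<lambda>z. f (a, z) + g (a, z)) field_differentiable at b"
    by (intro field_differentiable_add holomorphic2_slice2[OF _ ab] assms(1,2))
qed

lemma holomorphic2_on_diff:
  assumes "holomorphic2_on f S" "holomorphic2_on g S"
  shows "holomorphic2_on (\<lambda>p. f p - g p) S"
proof (rule osgood)
  show "open S" using assms(1) by (simp add: holomorphic2_on_def)
  show "continuous_on S (\<lambda>p. f p - g p)"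
    by (intro continuous_on_diff holomorphic2_on_imp_continuous_on assms(1,2))
  fix a b assume ab: "(a, b) \<in> S"
  show "(\<lambda>z. f (z, b) - g (z, b)) field_differentiable at a"
    by (intro field_differentiable_diff holomorphic2_slice1[OF _ ab] assms(1,2))
  show "(\<lambda>z. f (a, z) - g (a, z)) field_differentiable at b"
    by (intro field_differentiable_diff holomorphic2_slice2[OF _ ab] assms(1,2))
qed

lemma holomorphic2_on_divide:
  assumes "holomorphic2_on f S" "holomorphic2_on g S" "\<And>p. p \<in> S \<Longrightarrow> g p \<noteq> 0"
  shows "holomorphic2_on (\<lambda>p. f p / g p) S"
proof (rule osgood)
  show "open S" using assms(1) by (simp add: holomorphic2_on_def)
  show "continuous_on S (\<lambda>p. f p / g p)"
    by (intro continuous_on_divide holomorphic2_on_imp_continuous_on assms(1,2)) (use assms(3) in auto)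
  fix a b assume ab: "(a, b) \<in> S"
  show "(\<lambda>z. f (z, b) / g (z, b)) field_differentiable at a"
    by (intro field_differentiable_divide holomorphic2_slice1[OF _ ab] assms(1,2)) (use assms(3) ab in auto)
  show "(\<lambda>z. f (a, z) / g (a, z)) field_differentiable at b"
    by (intro field_differentiable_divide holomorphic2_slice2[OF _ ab] assms(1,2)) (use assms(3) ab in auto)
qed


lemma holomorphic2_on_compose_holomorphic:
  assumes g: "g holomorphic_on T" and T: "open T" and f: "holomorphic2_on f S"
    and sub: "\<And>p. p \<in> S \<Longrightarrow> f p \<in> T"
  shows "holomorphic2_on (\<lambda>p. g (f p)) S"
proof (rule osgood)
  show "open S" using f by (simp add: holomorphic2_on_def)
  show "continuous_on S (\<lambda>p. g (f p))"
    by (rule continuous_on_compose2[OF holomorphic_on_imp_continuous_on[OF g]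
          holomorphic2_on_imp_continuous_on[OF f]]) (use sub in auto)
  have gd: "g field_differentiable at (f p)" if "p \<in> S" for p
    using g T sub[OF that] holomorphic_on_imp_differentiable_at by blast
  fix a b assume ab: "(a, b) \<in> S"
  show "(\<lambda>z. g (f (z, b))) field_differentiable at a"
    using field_differentiable_compose[OF holomorphic2_slice1[OF f ab], of g] gd[OF ab] by (simp add: o_def)
  show "(\<lambda>z. g (f (a, z))) field_differentiable at b"
    using field_differentiable_compose[OF holomorphic2_slice2[OF f ab], of g] gd[OF ab] by (simp add: o_def)
qed

text \<open>A slice of the composite moves both arguments of \<open>F\<close> at once, so the
  one-variable rules do not apply; the chain rule for total derivatives does.\<close>

lemma holomorphic2_on_compose:
  assumes F: "holomorphic2_on F T" and f: "holomorphic2_on f S" and g: "holomorphic2_on g S"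
    and sub: "\<And>p. p \<in> S \<Longrightarrow> (f p, g p) \<in> T"
  shows "holomorphic2_on (\<lambda>p. F (f p, g p)) S"
  unfolding holomorphic2_on_def
proof (intro conjI ballI)
  show "open S" using f by (simp add: holomorphic2_on_def)
  fix p assume p: "p \<in> S"
  obtain A B where A: "(f has_derivative (\<lambda>(u, v). A * u + B * v)) (at p)"
    using f p by (auto simp: holomorphic2_on_def)
  obtain C D where C: "(g has_derivative (\<lambda>(u, v). C * u + D * v)) (at p)"
    using g p by (auto simp: holomorphic2_on_def)
  obtain G H where G: "(F has_derivative (\<lambda>(u, v). G * u + H * v)) (at (f p, g p))"
    using F sub[OF p] by (auto simp: holomorphic2_on_def)
  have "((F \<circ> (\<lambda>p. (f p, g p))) has_derivative
     ((\<lambda>(u, v). G * u + H * v) \<circ> (\<lambda>x. ((\<lambda>(u, v). A * u + B * v) x, (\<lambda>(u, v). C * u + D * v) x)))) (at p)"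
    by (intro diff_chain_at has_derivative_Pair A C G)
  then have "((\<lambda>p. F (f p, g p)) has_derivative (\<lambda>(u, v). (G * A + H * C) * u + (G * B + H * D) * v)) (at p)"
    by (simp add: o_def case_prod_unfold algebra_simps)
  then show "\<exists>A B. ((\<lambda>p. F (f p, g p)) has_derivative (\<lambda>(u, v). A * u + B * v)) (at p)" by blast
qed

lemma holomorphic2_on_cong:
  assumes "holomorphic2_on f S" "\<And>p. p \<in> S \<Longrightarrow> f p = g p"
  shows "holomorphic2_on g S"
  unfolding holomorphic2_on_def
proof (intro conjI ballI)
  show S: "open S" using assms(1) by (simp add: holomorphic2_on_def)
  fix p assume p: "p \<in> S"
  then obtain A B where "(f has_derivative (\<lambda>(u, v). A * u + B * v)) (at p)"
    using assms(1) by (auto simp: holomorphic2_on_def)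
  then have "(g has_derivative (\<lambda>(u, v). A * u + B * v)) (at p)"
    by (rule has_derivative_transform_within_open[OF _ S p]) (simp add: assms(2))
  then show "\<exists>A B. (g has_derivative (\<lambda>(u, v). A * u + B * v)) (at p)" by blast
qed

lemma holomorphic2_on_exp:
  "holomorphic2_on f S \<Longrightarrow> holomorphic2_on (\<lambda>p. exp (f p)) S"
  by (rule holomorphic2_on_compose_holomorphic[of exp UNIV]) (auto intro: holomorphic_intros)


section \<open>Infinite Pochhammer symbols\<close>

lemma convergent_prod_qpoch:
  fixes q x :: complex
  assumes "norm q < 1"
  shows "convergent_prod (\<lambda>i. 1 - q ^ i * x)"
proof -
  have "summable (\<lambda>i. norm q ^ i * norm x)"
    using assms by (intro summable_mult2 summable_geometric) simp
  then have "summable (\<lambda>i. norm ((1 - q ^ i * x) - 1))"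
    by (simp add: norm_mult norm_power)
  then show ?thesis
    by (intro abs_convergent_prod_imp_convergent_prod summable_imp_abs_convergent_prod)
qed

lemma qpoch_inside: "norm q < 1 \<Longrightarrow> qpoch x q = (\<Prod>i. 1 - q ^ i * x)"
  by (simp add: qpoch_def)

lemma qpoch_outside:
  assumes "norm q > 1"
  shows "qpoch x q = inverse (qpoch (inverse q * x) (inverse q))"
proof -
  have "norm (inverse q) < 1" using assms by (simp add: norm_inverse inverse_less_1_iff)
  then show ?thesis using assms by (simp add: qpoch_def)
qed

lemma qpoch_LIMSEQ:
  assumes "norm q < 1"
  shows "(\<lambda>n. \<Prod>i<n. 1 - q ^ i * x) \<longlonglongrightarrow> qpoch x q"
  using convergent_prod_LIMSEQ[OF convergent_prod_qpoch[OF assms, of x]] assms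
  unfolding LIMSEQ_lessThan_iff_atMost by (simp add: qpoch_inside)

lemma qpoch_shift:
  assumes "norm q < 1"
  shows "qpoch x q = (1 - x) * qpoch (q * x) q"
proof (rule LIMSEQ_unique)
  show "(\<lambda>n. \<Prod>i<Suc n. 1 - q ^ i * x) \<longlonglongrightarrow> qpoch x q"
    using qpoch_LIMSEQ[OF assms] by (rule LIMSEQ_Suc)
  have "(\<lambda>n. (1 - x) * (\<Prod>i<n. 1 - q ^ i * (q * x))) \<longlonglongrightarrow> (1 - x) * qpoch (q * x) q"
    by (intro tendsto_intros qpoch_LIMSEQ assms)
  moreover have "(1 - x) * (\<Prod>i<n. 1 - q ^ i * (q * x)) = (\<Prod>i<Suc n. 1 - q ^ i * x)" for n
    by (subst prod.lessThan_Suc_shift) (simp add: mult_ac)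
  ultimately show "(\<lambda>n. \<Prod>i<Suc n. 1 - q ^ i * x) \<longlonglongrightarrow> (1 - x) * qpoch (q * x) q" by simp
qed

text \<open>Convergence of the product is meant in the strict sense, where a zero value can only
  come from a zero factor.\<close>

lemma qpoch_eq_0_iff:
  assumes "norm q < 1"
  shows "qpoch x q = 0 \<longleftrightarrow> (\<exists>i. q ^ i * x = 1)"
proof -
  have "(\<lambda>i. 1 - q ^ i * x) has_prod qpoch x q"
    using convergent_prod_has_prod[OF convergent_prod_qpoch[OF assms]] assms
    by (simp add: qpoch_inside)
  from has_prod_eq_0_iff[OF this] show ?thesis
    by auto
qed

lemma qpoch_zero: "norm q < 1 \<Longrightarrow> qpoch 0 q = 1"
  by (simp add: qpoch_inside)

text \<open>Write the exponent as \<open>m * c + i\<close>: a partial product of length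
  \<open>n * c\<close> splits into blocks of length \<open>c\<close>, and exchanging the two
  products collects the residues \<open>i\<close>. This is the source of the decomposition of
  general cocycles.\<close>

lemma qpoch_distribution:
  assumes "norm q < 1" "c > 0"
  shows "qpoch x q = (\<Prod>i<c. qpoch (q ^ i * x) (q ^ c))"
proof (rule LIMSEQ_unique)
  have qc: "norm (q ^ c) < 1" using assms by (simp add: norm_power power_less_one_iff)
  have "strict_mono (\<lambda>n::nat. n * c)" using assms(2) by (simp add: strict_mono_def)
  from LIMSEQ_subseq_LIMSEQ[OF qpoch_LIMSEQ[OF assms(1), of x] this]
  show "(\<lambda>n. \<Prod>i<n * c. 1 - q ^ i * x) \<longlonglongrightarrow> qpoch x q" by (simp add: o_def)
  have "(\<lambda>n. \<Prod>i<c. \<Prod>m<n. 1 - (q ^ c) ^ m * (q ^ i * x)) \<longlonglongrightarrow> (\<Prod>i<c. qpoch (q ^ i * x) (q ^ c))"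
    by (intro tendsto_prod qpoch_LIMSEQ qc)
  moreover have "(\<Prod>i<c. \<Prod>m<n. 1 - (q ^ c) ^ m * (q ^ i * x)) = (\<Prod>i<n * c. 1 - q ^ i * x)" for n
  proof -
    have "(\<Prod>i<n * c. 1 - q ^ i * x) = (\<Prod>m<n. \<Prod>i\<in>{m * c..<m * c + c}. 1 - q ^ i * x)"
      by (rule prod.nat_group[symmetric])
    also have "\<dots> = (\<Prod>m<n. \<Prod>i<c. 1 - (q ^ c) ^ m * (q ^ i * x))"
    proof (rule prod.cong[OF refl])
      fix m
      show "(\<Prod>i\<in>{m * c..<m * c + c}. 1 - q ^ i * x) = (\<Prod>i<c. 1 - (q ^ c) ^ m * (q ^ i * x))"
        by (rule prod.reindex_bij_witness[of _ "\<lambda>i. m * c + i" "\<lambda>i. i - m * c"])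
           (auto simp: power_mult[symmetric] power_add[symmetric] mult.assoc[symmetric] mult.commute)
    qed
    also have "\<dots> = (\<Prod>i<c. \<Prod>m<n. 1 - (q ^ c) ^ m * (q ^ i * x))" by (rule prod.swap)
    finally show ?thesis by simp
  qed
  ultimately show "(\<lambda>n. \<Prod>i<n * c. 1 - q ^ i * x) \<longlonglongrightarrow> (\<Prod>i<c. qpoch (q ^ i * x) (q ^ c))" by simp
qed

section \<open>Locally uniform convergence and joint holomorphy in \<open>x\<close> and
  \<open>q\<close>\<close>

lemma uniform_limit_qpoch:
  assumes "r < 1"
  shows "uniform_limit (cball 0 M \<times> cball 0 r) (\<lambda>n (x, q). \<Prod>i<n. 1 - q ^ i * x) (\<lambda>(x, q). qpoch x q) sequentially"
proof -
  let ?A = "cball 0 M \<times> cball 0 r :: (complex \<times> complex) set"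
  have cont: "continuous_on ?A (\<lambda>p. 1 - snd p ^ n * fst p)" for n
    by (intro continuous_intros)
  have "uniformly_convergent_on ?A (\<lambda>N p. \<Sum>n<N. norm ((1 - snd p ^ n * fst p) - 1))"
  proof (cases "r \<ge> 0")
    case True
    have "uniformly_convergent_on ?A (\<lambda>N p. \<Sum>n<N. norm (snd p ^ n * fst p))"
    proof (rule Weierstrass_m_test')
      show "summable (\<lambda>n. r ^ n * M)"
        using assms True by (intro summable_mult2 summable_geometric) simp
      show "norm (norm (snd p ^ n * fst p)) \<le> r ^ n * M" if "p \<in> ?A" for n p
        using that True by (auto simp: norm_mult norm_power intro!: mult_mono power_mono)
    qed
    then show ?thesis by simp
  \<comment> \<open>A negative \<open>r\<close> makes the set empty.\<close>
  qed (simp add: uniformly_convergent_on_def)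
  then have uc: "uniformly_convergent_on ?A (\<lambda>N p. \<Prod>n<N. 1 - snd p ^ n * fst p)"
    by (intro uniformly_convergent_on_prod' cont compact_Times compact_cball)
  then obtain l where l: "uniform_limit ?A (\<lambda>N p. \<Prod>n<N. 1 - snd p ^ n * fst p) l sequentially"
    by (auto simp: uniformly_convergent_on_def)
  have "l p = qpoch (fst p) (snd p)" if "p \<in> ?A" for p
    using tendsto_uniform_limitI[OF l that] qpoch_LIMSEQ[of "snd p" "fst p"] that assms
    by (intro LIMSEQ_unique[of "\<lambda>N. \<Prod>n<N. 1 - snd p ^ n * fst p"]) auto
  then show ?thesis
    using l uniform_limit_cong'[of ?A "\<lambda>N p. \<Prod>n<N. 1 - snd p ^ n * fst p" _ l]
    by (simp add: case_prod_unfold)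
qed

text \<open>Uniform convergence in both variables together supplies the joint continuity that
  Osgood's lemma asks for; restricted to slices it gives holomorphy in each variable.\<close>

lemma holomorphic2_qpoch: "holomorphic2_on (\<lambda>(x, q). qpoch x q) (UNIV \<times> ball 0 1)"
proof (rule osgood)
  let ?S = "UNIV \<times> ball 0 1 :: (complex \<times> complex) set"
  show "open ?S" by (intro open_Times) auto
  have loc: "\<exists>M r. r < 1 \<and> (x, q) \<in> ball 0 M \<times> ball 0 r" if "(x, q) \<in> ?S" for x q :: complex
  proof -
    have "norm q < 1" using that by simp
    then obtain r where "norm q < r" "r < 1" using dense by blast
    then show ?thesis by (intro exI[of _ "norm x + 1"] exI[of _ r]) simp
  qed
  show "continuous_on ?S (\<lambda>(x, q). qpoch x q)"
  proof (intro continuous_at_imp_continuous_on ballI)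
    fix p :: "complex \<times> complex" assume "p \<in> ?S"
    then obtain M r where Mr: "r < 1" "p \<in> ball 0 M \<times> ball 0 r" using loc[of "fst p" "snd p"] by auto
    have "continuous_on (cball 0 M \<times> cball 0 r) (\<lambda>(x, q). qpoch x q)"
      by (rule uniform_limit_theorem[OF _ uniform_limit_qpoch[OF Mr(1)]])
         (auto simp: case_prod_unfold intro!: continuous_intros always_eventually)
    then have "continuous_on (ball 0 M \<times> ball 0 r) (\<lambda>(x, q). qpoch x q)"
      by (rule continuous_on_subset) (intro Sigma_mono ball_subset_cball)
    then show "isCont (\<lambda>(x, q). qpoch x q) p"
      using Mr(2) continuous_on_eq_continuous_at[of "ball 0 M \<times> ball 0 r"]
      by (auto intro: open_Times)
  qed
  fix a b :: complex assume ab: "(a, b) \<in> ?S"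
  obtain M r where Mr: "r < 1" "a \<in> ball 0 M" "b \<in> ball 0 r" using loc[OF ab] by auto
  have "(\<lambda>z. qpoch z b) holomorphic_on ball 0 M"
  proof -
    have "uniform_limit (cball 0 M) (\<lambda>n x. \<Prod>i<n. 1 - b ^ i * x) (\<lambda>x. qpoch x b) sequentially"
      using uniform_limit_compose'[OF uniform_limit_qpoch[OF Mr(1), of M], where h = "\<lambda>x. (x, b)" and B = "cball 0 M"]
        Mr(3) by auto
    then show ?thesis
      by (rule holomorphic_uniform_limit[rotated])
         (auto intro!: always_eventually continuous_intros holomorphic_intros)
  qed
  then show "(\<lambda>z. case (z, b) of (x, q) \<Rightarrow> qpoch x q) field_differentiable at a"
    using Mr holomorphic_on_imp_differentiable_at open_ball by auto
  have "(\<lambda>q. qpoch a q) holomorphic_on ball 0 r"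
  proof -
    have "uniform_limit (cball 0 r) (\<lambda>n q. \<Prod>i<n. 1 - q ^ i * a) (\<lambda>q. qpoch a q) sequentially"
      using uniform_limit_compose'[OF uniform_limit_qpoch[OF Mr(1), of M], where h = "\<lambda>q. (a, q)" and B = "cball 0 r"]
        Mr(2) by auto
    then show ?thesis
      by (rule holomorphic_uniform_limit[rotated])
         (auto intro!: always_eventually continuous_intros holomorphic_intros)
  qed
  then show "(\<lambda>q. case (a, q) of (x, q) \<Rightarrow> qpoch x q) field_differentiable at b"
    using Mr holomorphic_on_imp_differentiable_at open_ball by auto
qed

lemma holomorphic2_on_qpoch:
  assumes "holomorphic2_on f S" "holomorphic2_on g S" "\<And>p. p \<in> S \<Longrightarrow> norm (g p) < 1"
  shows "holomorphic2_on (\<lambda>p. qpoch (f p) (g p)) S"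
  using holomorphic2_on_compose[OF holomorphic2_qpoch assms(1,2)] assms(3) by auto

lemma qpoch_tendsto_1:
  assumes "norm q < 1" "(f \<longlongrightarrow> 0) F"
  shows "((\<lambda>n. qpoch (f n) q) \<longlongrightarrow> 1) F"
proof -
  have "(\<lambda>z. qpoch z q) field_differentiable at 0"
    using holomorphic2_slice1[OF holomorphic2_qpoch, of 0 q] assms(1) by simp
  then have "isCont (\<lambda>z. qpoch z q) 0" by (rule field_differentiable_imp_continuous_at)
  from isCont_tendsto_compose[OF this assms(2)] show ?thesis by (simp add: qpoch_zero assms(1))
qed

section \<open>Extension from a dense set\<close>

text \<open>Values of \<open>F\<close> off \<open>G\<close> are ignored, because they come from
  conventions such as \<open>1 / 0 = 0\<close>. Where no limit exists, as at a pole, the value is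
  unspecified.\<close>

definition dense_ext :: "(complex \<times> complex) set \<Rightarrow> (complex \<times> complex \<Rightarrow> complex) \<Rightarrow> complex \<times> complex \<Rightarrow> complex" where
  "dense_ext G F p = Lim (at p within G) F"

lemma islimpt_dense:
  fixes p :: "complex \<times> complex"
  assumes "closure G = UNIV"
  shows "p islimpt G"
proof (rule islimptI)
  fix T :: "(complex \<times> complex) set" assume T: "p \<in> T" "open T"
  have "open (T - {p})" using T by (simp add: open_delete)
  moreover have "T - {p} \<noteq> {}"
    using T not_open_singleton[of p] by (metis Diff_eq_empty_iff subset_singletonD empty_iff)
  ultimately have "(T - {p}) \<inter> G \<noteq> {}"
    using assms open_Int_closure_eq_empty[of "T - {p}" G] by auto
  then show "\<exists>y\<in>G. y \<in> T \<and> y \<noteq> p" by blast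
qed

text \<open>The extension is always computed this way: exhibit a function continuous at
  \<open>p\<close> that agrees with \<open>F\<close> at the nearby points of \<open>G\<close>.
  Density makes the limit unique.\<close>

lemma dense_ext_eq:
  assumes "closure G = UNIV" "open W" "p \<in> W" "isCont H p"
    and "\<And>x. x \<in> W \<Longrightarrow> x \<in> G \<Longrightarrow> F x = H x"
  shows "dense_ext G F p = H p"
  unfolding dense_ext_def
proof (rule tendsto_Lim)
  show "\<not> trivial_limit (at p within G)"
    using islimpt_dense[OF assms(1)] by (simp add: trivial_limit_within)
  have "(H \<longlongrightarrow> H p) (at p within G)"
    using assms(4) by (meson at_le isCont_def subset_UNIV tendsto_mono)
  moreover have "\<forall>\<^sub>F x in at p within G. H x = F x"
    unfolding eventually_at_topological using assms(2,3,5) by metis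
  ultimately show "(F \<longlongrightarrow> H p) (at p within G)"
    by (rule Lim_transform_eventually)
qed

lemma holomorphic2_on_isCont: "holomorphic2_on f S \<Longrightarrow> p \<in> S \<Longrightarrow> isCont f p"
  using holomorphic2_on_imp_continuous_on continuous_on_eq_continuous_at holomorphic2_on_def by blast

text \<open>Both \<open>g\<close> and \<open>h\<close> may vanish on \<open>L\<close>: this is where the quotient has its zeros, its poles, and
  its removable singularities.\<close>

definition loc_quot ::
  "(complex \<times> complex) set \<Rightarrow> (complex \<times> complex) set \<Rightarrow> (complex \<times> complex \<Rightarrow> complex) \<Rightarrow> (complex \<times> complex) set \<Rightarrow> bool"
  where "loc_quot G L F D \<longleftrightarrow> open D \<and>
    (\<forall>p\<in>D. \<exists>W g h. p \<in> W \<and> W \<subseteq> D \<and> holomorphic2_on g W \<and> holomorphic2_on h W \<and>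
       (\<forall>x\<in>W \<inter> G. g x \<noteq> 0 \<and> h x \<noteq> 0 \<and> F x = g x / h x) \<and> (p \<notin> L \<longrightarrow> g p \<noteq> 0 \<and> h p \<noteq> 0))"

lemma loc_quotI:
  assumes "open D"
    and "\<And>p. p \<in> D \<Longrightarrow> \<exists>W g h. p \<in> W \<and> holomorphic2_on g W \<and> holomorphic2_on h W \<and>
       (\<forall>x\<in>W \<inter> G. g x \<noteq> 0 \<and> h x \<noteq> 0 \<and> F x = g x / h x) \<and> (p \<notin> L \<longrightarrow> g p \<noteq> 0 \<and> h p \<noteq> 0)"
  shows "loc_quot G L F D"
  unfolding loc_quot_def
proof (intro conjI ballI assms(1))
  fix p assume "p \<in> D"
  then obtain W g h where W: "p \<in> W" and g: "holomorphic2_on g W" and h: "holomorphic2_on h W"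
    and gh: "\<forall>x\<in>W \<inter> G. g x \<noteq> 0 \<and> h x \<noteq> 0 \<and> F x = g x / h x" and L: "p \<notin> L \<longrightarrow> g p \<noteq> 0 \<and> h p \<noteq> 0"
    using assms(2) by blast
  have o: "open (W \<inter> D)" using g assms(1) by (auto simp: holomorphic2_on_def)
  show "\<exists>W g h. p \<in> W \<and> W \<subseteq> D \<and> holomorphic2_on g W \<and> holomorphic2_on h W \<and>
       (\<forall>x\<in>W \<inter> G. g x \<noteq> 0 \<and> h x \<noteq> 0 \<and> F x = g x / h x) \<and> (p \<notin> L \<longrightarrow> g p \<noteq> 0 \<and> h p \<noteq> 0)"
    using W \<open>p \<in> D\<close> holomorphic2_on_subset[OF g o] holomorphic2_on_subset[OF h o] gh L
    by (intro exI[of _ "W \<inter> D"] exI[of _ g] exI[of _ h]) auto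
qed

lemma loc_quotE:
  assumes "loc_quot G L F D" "p \<in> D"
  obtains W g h where "p \<in> W" "W \<subseteq> D" "open W" "holomorphic2_on g W" "holomorphic2_on h W"
    "\<And>x. x \<in> W \<Longrightarrow> x \<in> G \<Longrightarrow> g x \<noteq> 0 \<and> h x \<noteq> 0 \<and> F x = g x / h x"
    "p \<notin> L \<Longrightarrow> g p \<noteq> 0" "p \<notin> L \<Longrightarrow> h p \<noteq> 0"
proof -
  obtain W g h where *: "p \<in> W \<and> W \<subseteq> D \<and> holomorphic2_on g W \<and> holomorphic2_on h W \<and>
       (\<forall>x\<in>W \<inter> G. g x \<noteq> 0 \<and> h x \<noteq> 0 \<and> F x = g x / h x) \<and> (p \<notin> L \<longrightarrow> g p \<noteq> 0 \<and> h p \<noteq> 0)"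
    using assms unfolding loc_quot_def by blast
  then have "open W" by (simp add: holomorphic2_on_def)
  with * show thesis by (intro that[of W g h]) auto
qed


lemma loc_quot_cong:
  assumes "loc_quot G L F D" "\<And>x. x \<in> D \<Longrightarrow> x \<in> G \<Longrightarrow> F x = F' x"
  shows "loc_quot G L F' D"
proof (rule loc_quotI)
  show "open D" using assms(1) by (simp add: loc_quot_def)
  fix p assume "p \<in> D"
  obtain W g h where *: "p \<in> W" "W \<subseteq> D" "open W" "holomorphic2_on g W" "holomorphic2_on h W"
    "\<And>x. x \<in> W \<Longrightarrow> x \<in> G \<Longrightarrow> g x \<noteq> 0 \<and> h x \<noteq> 0 \<and> F x = g x / h x"
    "p \<notin> L \<Longrightarrow> g p \<noteq> 0" "p \<notin> L \<Longrightarrow> h p \<noteq> 0"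
    by (fact loc_quotE[OF assms(1) \<open>p \<in> D\<close>])
  then show "\<exists>W g h. p \<in> W \<and> holomorphic2_on g W \<and> holomorphic2_on h W \<and>
       (\<forall>x\<in>W \<inter> G. g x \<noteq> 0 \<and> h x \<noteq> 0 \<and> F' x = g x / h x) \<and> (p \<notin> L \<longrightarrow> g p \<noteq> 0 \<and> h p \<noteq> 0)"
    using assms(2) by (intro exI[of _ W] exI[of _ g] exI[of _ h]) (auto simp: subset_iff)
qed

text \<open>Numerator and denominator enter the definition symmetrically, so exchanging them is
  enough. Asking for a nonvanishing denominator alone would not be stable under inversion.\<close>

lemma loc_quot_inverse:
  assumes "loc_quot G L F D"
  shows "loc_quot G L (\<lambda>p. inverse (F p)) D"
proof (rule loc_quotI)
  show "open D" using assms(1) by (simp add: loc_quot_def)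
  fix p assume "p \<in> D"
  obtain W g h where *: "p \<in> W" "W \<subseteq> D" "open W" "holomorphic2_on g W" "holomorphic2_on h W"
    "\<And>x. x \<in> W \<Longrightarrow> x \<in> G \<Longrightarrow> g x \<noteq> 0 \<and> h x \<noteq> 0 \<and> F x = g x / h x"
    "p \<notin> L \<Longrightarrow> g p \<noteq> 0" "p \<notin> L \<Longrightarrow> h p \<noteq> 0"
    by (fact loc_quotE[OF assms(1) \<open>p \<in> D\<close>])
  then show "\<exists>W g h. p \<in> W \<and> holomorphic2_on g W \<and> holomorphic2_on h W \<and>
       (\<forall>x\<in>W \<inter> G. g x \<noteq> 0 \<and> h x \<noteq> 0 \<and> inverse (F x) = g x / h x) \<and> (p \<notin> L \<longrightarrow> g p \<noteq> 0 \<and> h p \<noteq> 0)"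
    by (intro exI[of _ W] exI[of _ h] exI[of _ g]) auto
qed

lemma loc_quot_mult:
  assumes "loc_quot G L F D" "loc_quot G L F' D"
  shows "loc_quot G L (\<lambda>p. F p * F' p) D"
proof (rule loc_quotI)
  show "open D" using assms(1) by (simp add: loc_quot_def)
  fix p assume p: "p \<in> D"
  obtain W g h where *: "p \<in> W" "W \<subseteq> D" "open W" "holomorphic2_on g W" "holomorphic2_on h W"
    "\<And>x. x \<in> W \<Longrightarrow> x \<in> G \<Longrightarrow> g x \<noteq> 0 \<and> h x \<noteq> 0 \<and> F x = g x / h x"
    "p \<notin> L \<Longrightarrow> g p \<noteq> 0" "p \<notin> L \<Longrightarrow> h p \<noteq> 0"
    by (fact loc_quotE[OF assms(1) \<open>p \<in> D\<close>])
  obtain W' g' h' where 2: "p \<in> W'" "W' \<subseteq> D" "open W'" "holomorphic2_on g' W'" "holomorphic2_on h' W'"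
    "\<And>x. x \<in> W' \<Longrightarrow> x \<in> G \<Longrightarrow> g' x \<noteq> 0 \<and> h' x \<noteq> 0 \<and> F' x = g' x / h' x"
    "p \<notin> L \<Longrightarrow> g' p \<noteq> 0" "p \<notin> L \<Longrightarrow> h' p \<noteq> 0"
    by (fact loc_quotE[OF assms(2) p])
  have o: "open (W \<inter> W')" using * 2 by blast
  have "holomorphic2_on (\<lambda>x. g x * g' x) (W \<inter> W')" "holomorphic2_on (\<lambda>x. h x * h' x) (W \<inter> W')"
    by (intro holomorphic2_on_mult; rule holomorphic2_on_subset[OF _ o], (rule *(4,5) 2(4,5))+, blast)+
  then show "\<exists>W g h. p \<in> W \<and> holomorphic2_on g W \<and> holomorphic2_on h W \<and>
       (\<forall>x\<in>W \<inter> G. g x \<noteq> 0 \<and> h x \<noteq> 0 \<and> F x * F' x = g x / h x) \<and> (p \<notin> L \<longrightarrow> g p \<noteq> 0 \<and> h p \<noteq> 0)"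
    using * 2 by (intro exI[of _ "W \<inter> W'"] exI[of _ "\<lambda>x. g x * g' x"] exI[of _ "\<lambda>x. h x * h' x"]) auto
qed

lemma loc_quot_prod:
  assumes "open D" "\<And>i. i \<in> I \<Longrightarrow> loc_quot G L (F i) D"
  shows "loc_quot G L (\<lambda>p. \<Prod>i\<in>I. F i p) D"
proof -
  have "loc_quot G L (\<lambda>p. 1) D"
    by (rule loc_quotI[OF assms(1)])
       (use assms(1) in \<open>auto intro!: exI[of _ D] exI[of _ "\<lambda>p. 1"] holomorphic2_on_const\<close>)
  then show ?thesis
    using assms(2) by (induction I rule: infinite_finite_induct) (auto intro: loc_quot_mult)
qed

text \<open>Pullback along a holomorphic map. It must preserve genericity, so that the nonvanishing
  of numerator and denominator survives, and it must not move a point from outside the exceptional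
  set onto it.\<close>

lemma loc_quot_compose:
  assumes F: "loc_quot G L F D" and f: "holomorphic2_on f D'" and g: "holomorphic2_on g D'"
    and D: "\<And>p. p \<in> D' \<Longrightarrow> (f p, g p) \<in> D"
    and G: "\<And>p. p \<in> D' \<Longrightarrow> p \<in> G' \<Longrightarrow> (f p, g p) \<in> G"
    and L: "\<And>p. p \<in> D' \<Longrightarrow> p \<notin> L' \<Longrightarrow> (f p, g p) \<notin> L"
  shows "loc_quot G' L' (\<lambda>p. F (f p, g p)) D'"
proof (rule loc_quotI)
  show D': "open D'" using f by (simp add: holomorphic2_on_def)
  fix p assume p: "p \<in> D'"
  obtain W u v where *: "(f p, g p) \<in> W" "W \<subseteq> D" "open W" "holomorphic2_on u W" "holomorphic2_on v W"
    "\<And>x. x \<in> W \<Longrightarrow> x \<in> G \<Longrightarrow> u x \<noteq> 0 \<and> v x \<noteq> 0 \<and> F x = u x / v x"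
    "(f p, g p) \<notin> L \<Longrightarrow> u (f p, g p) \<noteq> 0" "(f p, g p) \<notin> L \<Longrightarrow> v (f p, g p) \<noteq> 0"
    by (fact loc_quotE[OF F D[OF p]])
  define W' where "W' = D' \<inter> (\<lambda>p. (f p, g p)) -` W"
  have o: "open W'" unfolding W'_def
    by (rule continuous_open_preimage)
       (intro continuous_on_Pair holomorphic2_on_imp_continuous_on f g, rule D', rule *(3))
  have fg: "holomorphic2_on f W'" "holomorphic2_on g W'"
    using holomorphic2_on_subset[OF f o] holomorphic2_on_subset[OF g o] by (auto simp: W'_def)
  have "holomorphic2_on (\<lambda>p. u (f p, g p)) W'" "holomorphic2_on (\<lambda>p. v (f p, g p)) W'"
    using holomorphic2_on_compose[OF *(4) fg] holomorphic2_on_compose[OF *(5) fg] by (auto simp: W'_def)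
  then show "\<exists>W u v. p \<in> W \<and> holomorphic2_on u W \<and> holomorphic2_on v W \<and>
       (\<forall>x\<in>W \<inter> G'. u x \<noteq> 0 \<and> v x \<noteq> 0 \<and> F (f x, g x) = u x / v x) \<and> (p \<notin> L' \<longrightarrow> u p \<noteq> 0 \<and> v p \<noteq> 0)"
    using * G L[OF p] p
    by (intro exI[of _ W'] exI[of _ "\<lambda>p. u (f p, g p)"] exI[of _ "\<lambda>p. v (f p, g p)"]) (auto simp: W'_def)
qed

section \<open>From local quotients to meromorphic functions\<close>

lemma dense_ext_quotient:
  assumes "closure G = UNIV" "holomorphic2_on g W" "holomorphic2_on h W"
    and "\<And>x. x \<in> W \<Longrightarrow> x \<in> G \<Longrightarrow> F x = g x / h x" and "x \<in> W" "h x \<noteq> 0"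
  shows "dense_ext G F x = g x / h x"
proof (rule dense_ext_eq[OF assms(1)])
  show "open W" using assms(2) by (simp add: holomorphic2_on_def)
  show "isCont (\<lambda>x. g x / h x) x"
    using assms by (intro isCont_divide holomorphic2_on_isCont[of _ W]) auto
qed (use assms in auto)

text \<open>A denominator without zeros on a dense set cannot vanish on a nonempty open set, which
  is the clause of \<open>meromorphic2_on\<close> that excludes degenerate quotients.\<close>

lemma loc_quot_meromorphic2:
  assumes G: "closure G = UNIV" and F: "loc_quot G L F D"
  shows "meromorphic2_on (dense_ext G F) D"
  unfolding meromorphic2_on_def
proof (intro conjI ballI)
  show "open D" using F by (simp add: loc_quot_def)
  fix p assume "p \<in> D"
  obtain W g h where *: "p \<in> W" "W \<subseteq> D" "open W" "holomorphic2_on g W" "holomorphic2_on h W"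
    "\<And>x. x \<in> W \<Longrightarrow> x \<in> G \<Longrightarrow> g x \<noteq> 0 \<and> h x \<noteq> 0 \<and> F x = g x / h x"
    "p \<notin> L \<Longrightarrow> g p \<noteq> 0" "p \<notin> L \<Longrightarrow> h p \<noteq> 0"
    by (fact loc_quotE[OF F \<open>p \<in> D\<close>])
  have "\<exists>x\<in>O'. h x \<noteq> 0" if "open O'" "O' \<noteq> {}" "O' \<subseteq> W" for O'
    using open_Int_closure_eq_empty[OF that(1), of G] G that * by blast
  moreover have "dense_ext G F x = g x / h x" if "x \<in> W" "h x \<noteq> 0" for x
    by (rule dense_ext_quotient[OF G *(4,5) _ that]) (use *(6) in blast)
  ultimately show "\<exists>W g h. p \<in> W \<and> W \<subseteq> D \<and> holomorphic2_on g W \<and> holomorphic2_on h W \<and>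
        (\<forall>O'. open O' \<and> O' \<noteq> {} \<and> O' \<subseteq> W \<longrightarrow> (\<exists>x\<in>O'. h x \<noteq> 0)) \<and>
        (\<forall>x\<in>W. h x \<noteq> 0 \<longrightarrow> dense_ext G F x = g x / h x)"
    using * by (intro exI[of _ W] exI[of _ g] exI[of _ h]) auto
qed

text \<open>Off \<open>L\<close> the denominator is nonzero at \<open>p\<close>, hence on the
  neighbourhood \<open>V\<close>, and throughout \<open>V\<close> the extension is the quotient
  itself.\<close>

lemma loc_quot_holomorphic2_at:
  assumes G: "closure G = UNIV" and F: "loc_quot G L F D" and p: "p \<in> D" "p \<notin> L"
  shows "holomorphic2_at (dense_ext G F) p"
proof -
  obtain W g h where *: "p \<in> W" "W \<subseteq> D" "open W" "holomorphic2_on g W" "holomorphic2_on h W"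
    "\<And>x. x \<in> W \<Longrightarrow> x \<in> G \<Longrightarrow> g x \<noteq> 0 \<and> h x \<noteq> 0 \<and> F x = g x / h x"
    "p \<notin> L \<Longrightarrow> g p \<noteq> 0" "p \<notin> L \<Longrightarrow> h p \<noteq> 0"
    by (fact loc_quotE[OF F p(1)])
  define V where "V = {x \<in> W. h x \<noteq> 0}"
  have "open (W \<inter> h -` (- {0}))"
    by (rule continuous_open_preimage[OF holomorphic2_on_imp_continuous_on]) (use * in auto)
  moreover have "W \<inter> h -` (- {0}) = V" by (auto simp: V_def)
  ultimately have V: "open V" by simp
  have "holomorphic2_on (\<lambda>x. g x / h x) V"
    by (rule holomorphic2_on_divide[OF holomorphic2_on_subset[OF *(4) V] holomorphic2_on_subset[OF *(5) V]])
       (simp_all add: V_def)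
  then have "holomorphic2_on (dense_ext G F) V"
  proof (rule holomorphic2_on_cong)
    fix x assume "x \<in> V"
    then show "g x / h x = dense_ext G F x"
      by (intro dense_ext_quotient[OF G *(4,5), symmetric]) (simp_all add: V_def *(6))
  qed
  moreover have "p \<in> V" using *(1,8) p by (simp add: V_def)
  ultimately show ?thesis unfolding holomorphic2_at_def by blast
qed

lemma dense_ext_inverse:
  assumes G: "closure G = UNIV" and F: "loc_quot G L F D" and p: "p \<in> D" "p \<notin> L"
  shows "dense_ext G (\<lambda>p. inverse (F p)) p = inverse (dense_ext G F p)"
proof -
  obtain W g h where *: "p \<in> W" "W \<subseteq> D" "open W" "holomorphic2_on g W" "holomorphic2_on h W"
    "\<And>x. x \<in> W \<Longrightarrow> x \<in> G \<Longrightarrow> g x \<noteq> 0 \<and> h x \<noteq> 0 \<and> F x = g x / h x"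
    "p \<notin> L \<Longrightarrow> g p \<noteq> 0" "p \<notin> L \<Longrightarrow> h p \<noteq> 0"
    by (fact loc_quotE[OF F p(1)])
  have "dense_ext G F p = g p / h p"
    by (rule dense_ext_quotient[OF G *(4,5) _ *(1)]) (use *(6,8) p in auto)
  moreover have "dense_ext G (\<lambda>p. inverse (F p)) p = h p / g p"
    by (rule dense_ext_quotient[OF G *(5,4) _ *(1)]) (use *(6,7) p in auto)
  ultimately show ?thesis using *(7,8) by simp
qed

lemma dense_ext_on:
  assumes G: "closure G = UNIV" and F: "loc_quot G L F D" and p: "p \<in> D" "p \<in> G"
  shows "dense_ext G F p = F p"
proof -
  obtain W g h where *: "p \<in> W" "W \<subseteq> D" "open W" "holomorphic2_on g W" "holomorphic2_on h W"
    "\<And>x. x \<in> W \<Longrightarrow> x \<in> G \<Longrightarrow> g x \<noteq> 0 \<and> h x \<noteq> 0 \<and> F x = g x / h x"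
    "p \<notin> L \<Longrightarrow> g p \<noteq> 0" "p \<notin> L \<Longrightarrow> h p \<noteq> 0"
    by (fact loc_quotE[OF F p(1)])
  have "dense_ext G F p = g p / h p"
    by (rule dense_ext_quotient[OF G *(4,5) _ *(1)]) (use *(1,6) p in auto)
  then show ?thesis using *(1,6) p by simp
qed

section \<open>Integrals over the real line with exponential decay\<close>

lemma integrable_exp_neg_abs:
  fixes \<delta> :: real
  assumes "\<delta> > 0"
  shows "integrable lborel (\<lambda>y. exp (- \<delta> * \<bar>y\<bar>))"
proof -
  let ?g = "\<lambda>y::real. indicator {0..} y *\<^sub>R exp (- \<delta> * y)"
  have "(\<lambda>y. exp (- \<delta> * y)) absolutely_integrable_on {0..}"
    by (intro nonnegative_absolutely_integrable_1 integrable_on_exp_minus_to_infinity assms) auto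
  then have "integrable lebesgue ?g" unfolding set_integrable_def .
  then have 1: "integrable lborel ?g" by (subst (asm) integrable_completion) auto
  then have 2: "integrable lborel (\<lambda>y. ?g (0 + (- 1) * y))"
    by (rule lborel_integrable_real_affine) auto
  show ?thesis
    by (rule Bochner_Integration.integrable_bound[OF Bochner_Integration.integrable_add[OF 1 2]])
       (auto simp: indicator_def)
qed

lemma integrable_exp_decay:
  fixes f :: "real \<Rightarrow> complex"
  assumes "continuous_on UNIV f" "\<And>y. norm (f y) \<le> C * exp (- \<delta> * \<bar>y\<bar>)" "\<delta> > 0"
  shows "integrable lborel f"
proof (rule Bochner_Integration.integrable_bound)
  show "integrable lborel (\<lambda>y. C * exp (- \<delta> * \<bar>y\<bar>))"
    by (intro integrable_mult_right integrable_exp_neg_abs assms)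
  show "f \<in> borel_measurable lborel"
    using borel_measurable_continuous_onI[OF assms(1)] by simp
  show "AE y in lborel. norm (f y) \<le> norm (C * exp (- \<delta> * \<bar>y\<bar>))"
    using assms(2) by (auto intro!: AE_I2 order_trans[OF _ abs_ge_self])
qed

text \<open>The truncation error is at most the tail of the majorant, which does not depend on
  \<open>p\<close>. Hence continuity and differentiability of integrals over compact intervals carry
  over to the whole line.\<close>

lemma line_integral_uniform_limit:
  fixes f :: "'a \<Rightarrow> real \<Rightarrow> complex"
  assumes cont: "\<And>p. p \<in> T \<Longrightarrow> continuous_on UNIV (f p)"
    and bound: "\<And>p y. p \<in> T \<Longrightarrow> norm (f p y) \<le> C * exp (- \<delta> * \<bar>y\<bar>)" and "\<delta> > 0"
  shows "uniform_limit T (\<lambda>n p. integral {- real n..real n} (f p)) (\<lambda>p. LBINT y. f p y) sequentially"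
proof (cases "T = {}")
  case False
  define g where "g = (\<lambda>n y. indicator (- {- real n..real n}) y * (C * exp (- \<delta> * \<bar>y\<bar>)))"
  have C: "C \<ge> 0"
  proof -
    from False obtain p where "p \<in> T" by blast
    from bound[OF this, of 0] show ?thesis using norm_ge_zero[of "f p 0"] by (simp del: norm_ge_zero)
  qed
  have int: "integrable lborel (\<lambda>y. C * exp (- \<delta> * \<bar>y\<bar>))"
    by (intro integrable_mult_right integrable_exp_neg_abs assms)
  have "(\<lambda>n. LBINT y. g n y) \<longlonglongrightarrow> (LBINT (y::real). 0)"
  proof (rule integral_dominated_convergence)
    show "integrable lborel (\<lambda>y. C * exp (- \<delta> * \<bar>y\<bar>))" by fact
    show "AE y in lborel. (\<lambda>n. g n y) \<longlonglongrightarrow> 0"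
    proof (rule AE_I2)
      fix y :: real
      obtain N where N: "\<bar>y\<bar> \<le> real N" using real_arch_simple by blast
      have "g n y = 0" if "n \<ge> N" for n
        using N that unfolding g_def by (auto simp: indicator_def)
      then show "(\<lambda>n. g n y) \<longlonglongrightarrow> 0"
        by (intro tendsto_eventually eventually_sequentiallyI)
    qed
    show "AE y in lborel. norm (g n y) \<le> C * exp (- \<delta> * \<bar>y\<bar>)" for n
      using C by (auto simp: g_def indicator_def)
  qed (auto simp: g_def)
  then have lim: "(\<lambda>n. LBINT y. g n y) \<longlonglongrightarrow> 0" by simp
  have le: "norm (integral {- real n..real n} (f p) - (LBINT y. f p y)) \<le> (LBINT y. g n y)"
    if p: "p \<in> T" for n p
  proof -
    have si: "set_integrable lborel {- real n..real n} (f p)"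
      by (intro borel_integrable_atLeastAtMost' continuous_on_subset[OF cont[OF p]]) auto
    have fi: "integrable lborel (f p)"
      by (rule integrable_exp_decay[OF cont[OF p] bound[OF p] assms(3)])
    have "integral {- real n..real n} (f p) - (LBINT y. f p y)
       = (LBINT y. indicator {- real n..real n} y *\<^sub>R f p y) - (LBINT y. f p y)"
      using set_borel_integral_eq_integral(2)[OF si] by (simp add: set_lebesgue_integral_def)
    also have "\<dots> = (LBINT y. indicator {- real n..real n} y *\<^sub>R f p y - f p y)"
      using si fi by (simp add: set_integrable_def)
    also have "norm \<dots> \<le> (LBINT y. norm (indicator {- real n..real n} y *\<^sub>R f p y - f p y))"
      by (rule integral_norm_bound)
    also have "\<dots> \<le> (LBINT y. g n y)"
    proof (rule integral_mono)
      show "integrable lborel (\<lambda>y. norm (indicator {- real n..real n} y *\<^sub>R f p y - f p y))"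
        using si fi by (simp add: set_integrable_def)
      show "integrable lborel (g n)"
        by (rule Bochner_Integration.integrable_bound[OF int]) (auto simp: g_def indicator_def C)
      show "norm (indicator {- real n..real n} y *\<^sub>R f p y - f p y) \<le> g n y" for y
        using bound[OF p, of y] by (auto simp: g_def indicator_def)
    qed
    finally show ?thesis .
  qed
  show ?thesis
    unfolding uniform_limit_iff
  proof (intro allI impI)
    fix e :: real assume "e > 0"
    with lim have "\<forall>\<^sub>F n in sequentially. (LBINT y. g n y) < e"
      by (rule order_tendstoD)
    then show "\<forall>\<^sub>F n in sequentially. \<forall>p\<in>T. dist (integral {- real n..real n} (f p)) (LBINT y. f p y) < e"
    proof eventually_elim
      case (elim n)
      then show ?case using le by (auto simp: dist_norm intro: le_less_trans)
    qed
  qed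
qed simp

lemma line_integral_continuous:
  fixes f :: "'a::topological_space \<Rightarrow> real \<Rightarrow> complex"
  assumes cont: "continuous_on (T \<times> UNIV) (\<lambda>(p, y). f p y)"
    and bound: "\<And>p y. p \<in> T \<Longrightarrow> norm (f p y) \<le> C * exp (- \<delta> * \<bar>y\<bar>)" and "\<delta> > 0"
  shows "continuous_on T (\<lambda>p. LBINT y. f p y)"
proof (rule uniform_limit_theorem)
  show "uniform_limit T (\<lambda>n p. integral {- real n..real n} (f p)) (\<lambda>p. LBINT y. f p y) sequentially"
  proof (rule line_integral_uniform_limit[OF _ bound assms(3)])
    fix p assume p: "p \<in> T"
    have "continuous_on UNIV (\<lambda>y. case (p, y) of (p, y) \<Rightarrow> f p y)"
      by (rule continuous_on_compose2[OF cont]) (use p in \<open>auto intro!: continuous_intros\<close>)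
    then show "continuous_on UNIV (f p)" by simp
  qed
  have "continuous_on T (\<lambda>p. integral (cbox (- real n) (real n)) (f p))" for n
    by (rule integral_continuous_on_param, rule continuous_on_subset[OF cont]) auto
  then show "\<forall>\<^sub>F n in sequentially. continuous_on T (\<lambda>p. integral {- real n..real n} (f p))" by simp
qed simp

text \<open>Locally uniform limits of holomorphic functions may be differentiated, so domination is
  asked of \<open>f\<close> only. The price is that the derivative is known merely as a limit of
  integrals of \<open>f'\<close> over \<open>[-n, n]\<close>; the next lemma identifies it when
  \<open>f'\<close> decays as well.\<close>

lemma line_integral_has_field_derivative:
  fixes f :: "complex \<Rightarrow> real \<Rightarrow> complex"
  assumes "open S" "w0 \<in> S"
    and cont: "continuous_on (S \<times> UNIV) (\<lambda>(w, y). f w y)"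
    and cont': "continuous_on (S \<times> UNIV) (\<lambda>(w, y). f' w y)"
    and der: "\<And>w y. w \<in> S \<Longrightarrow> ((\<lambda>w. f w y) has_field_derivative f' w y) (at w)"
    and bound: "\<And>w y. w \<in> S \<Longrightarrow> norm (f w y) \<le> C * exp (- \<delta> * \<bar>y\<bar>)" "\<delta> > 0"
  obtains g where "((\<lambda>w. LBINT y. f w y) has_field_derivative g) (at w0)"
    "(\<lambda>n. integral {- real n..real n} (f' w0)) \<longlonglongrightarrow> g"
proof -
  obtain r where r: "r > 0" "cball w0 r \<subseteq> S"
    using assms(1,2) unfolding open_contains_cball by blast
  have fc: "continuous_on UNIV (f w)" if "w \<in> S" for w
  proof -
    have "continuous_on UNIV (\<lambda>y. case (w, y) of (p, y) \<Rightarrow> f p y)"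
      by (rule continuous_on_compose2[OF cont]) (use that in \<open>auto intro!: continuous_intros\<close>)
    then show "continuous_on UNIV (f w)" by simp
  qed
  have ul: "uniform_limit (cball w0 r) (\<lambda>n w. integral {- real n..real n} (f w)) (\<lambda>w. LBINT y. f w y) sequentially"
    by (rule line_integral_uniform_limit[OF fc bound]) (use r in auto)
  have d: "((\<lambda>w. integral {- real n..real n} (f w)) has_field_derivative integral {- real n..real n} (f' w)) (at w)"
    if w: "w \<in> ball w0 r" for w n
  proof -
    have sub: "ball w0 r \<times> cbox (- real n) (real n) \<subseteq> S \<times> UNIV"
      by (rule Sigma_mono[OF order_trans[OF ball_subset_cball r(2)] subset_UNIV])
    have "((\<lambda>w. integral (cbox (- real n) (real n)) (f w)) has_field_derivative
            integral (cbox (- real n) (real n)) (f' w)) (at w within ball w0 r)"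
    proof (rule leibniz_rule_field_derivative[OF _ _ _ w convex_ball])
      fix x t assume x: "x \<in> ball w0 r"
      then have xS: "x \<in> S" using r by auto
      show "((\<lambda>x. f x t) has_field_derivative f' x t) (at x within ball w0 r)"
        using der[OF xS] by (rule has_field_derivative_at_within)
      show "f x integrable_on cbox (- real n) (real n)"
        by (intro integrable_continuous continuous_on_subset[OF fc[OF xS]]) auto
    next
      show "continuous_on (ball w0 r \<times> cbox (- real n) (real n)) (\<lambda>(x, t). f' x t)"
        by (rule continuous_on_subset[OF cont' sub])
    qed
    then show ?thesis unfolding at_within_open[OF w open_ball] cbox_interval .
  qed
  have c: "continuous_on (cball w0 r) (\<lambda>w. integral {- real n..real n} (f w))" for n
  proof -
    have sub: "cball w0 r \<times> cbox (- real n) (real n) \<subseteq> S \<times> UNIV"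
      by (rule Sigma_mono[OF r(2) subset_UNIV])
    have "continuous_on (cball w0 r) (\<lambda>w. integral (cbox (- real n) (real n)) (f w))"
    proof (rule integral_continuous_on_param)
      show "continuous_on (cball w0 r \<times> cbox (- real n) (real n)) (\<lambda>(w, y). f w y)"
        by (rule continuous_on_subset[OF cont sub])
    qed
    then show ?thesis by simp
  qed
  have "\<forall>\<^sub>F n in sequentially. continuous_on (cball w0 r) (\<lambda>w. integral {- real n..real n} (f w)) \<and>
      (\<forall>w\<in>ball w0 r. ((\<lambda>w. integral {- real n..real n} (f w)) has_field_derivative
          integral {- real n..real n} (f' w)) (at w))"
    using c d by (intro always_eventually) blast
  from has_complex_derivative_uniform_limit[OF this ul sequentially_bot r(1)]
  obtain g where "\<And>w. w \<in> ball w0 r \<Longrightarrow> ((\<lambda>w. LBINT y. f w y) has_field_derivative g w) (at w) \<and>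
      (\<lambda>n. integral {- real n..real n} (f' w)) \<longlonglongrightarrow> g w" by blast
  then show thesis using that[of "g w0"] r(1) by simp
qed

lemma line_integral_has_field_derivative':
  fixes f :: "complex \<Rightarrow> real \<Rightarrow> complex"
  assumes "open S" "w0 \<in> S"
    and "continuous_on (S \<times> UNIV) (\<lambda>(w, y). f w y)"
    and cont': "continuous_on (S \<times> UNIV) (\<lambda>(w, y). f' w y)"
    and "\<And>w y. w \<in> S \<Longrightarrow> ((\<lambda>w. f w y) has_field_derivative f' w y) (at w)"
    and "\<And>w y. w \<in> S \<Longrightarrow> norm (f w y) \<le> C * exp (- \<delta> * \<bar>y\<bar>)" "\<delta> > 0"
    and bound': "\<And>y. norm (f' w0 y) \<le> C' * exp (- \<delta>' * \<bar>y\<bar>)" "\<delta>' > 0"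
  shows "((\<lambda>w. LBINT y. f w y) has_field_derivative (LBINT y. f' w0 y)) (at w0)"
proof -
  obtain g where g: "((\<lambda>w. LBINT y. f w y) has_field_derivative g) (at w0)"
    "(\<lambda>n. integral {- real n..real n} (f' w0)) \<longlonglongrightarrow> g"
    using line_integral_has_field_derivative[OF assms(1-7)] by blast
  have "continuous_on UNIV (\<lambda>y. case (w0, y) of (p, y) \<Rightarrow> f' p y)"
    by (rule continuous_on_compose2[OF cont']) (use assms(2) in \<open>auto intro!: continuous_intros\<close>)
  then have "uniform_limit {w0} (\<lambda>n w. integral {- real n..real n} (f' w)) (\<lambda>w. LBINT y. f' w y) sequentially"
    using bound' by (intro line_integral_uniform_limit[where C = C' and \<delta> = \<delta>']) auto
  from tendsto_uniform_limitI[OF this, of w0] g(2) have "g = (LBINT y. f' w0 y)"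
    using LIMSEQ_unique by blast
  then show ?thesis using g(1) by simp
qed

section \<open>The Fourier kernels\<close>

lemma ee_add: "ee (a + b) = ee a * ee b"
  by (simp add: ee_def ring_distribs exp_add)

lemma ee_0 [simp]: "ee 0 = 1"
  by (simp add: ee_def)

lemma ee_nonzero [simp]: "ee a \<noteq> 0"
  by (simp add: ee_def)

lemma ee_minus: "ee (- a) = inverse (ee a)"
  by (simp add: ee_def exp_minus)

lemma ee_diff: "ee (a - b) = ee a / ee b"
  using ee_add[of a "- b"] by (simp add: ee_minus divide_inverse)

lemma ee_of_nat_mult: "ee (of_nat n * a) = ee a ^ n"
  by (simp add: ee_def exp_of_nat_mult[symmetric] mult_ac)

lemma ee_eq_1_iff: "ee a = 1 \<longleftrightarrow> (\<exists>n::int. a = of_int n)"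
proof -
  have "ee a = 1 \<longleftrightarrow> Im a = 0 \<and> (\<exists>n::int. 2 * pi * Re a = of_int (2 * n) * pi)"
    unfolding ee_def exp_eq_1 by simp
  also have "\<dots> \<longleftrightarrow> Im a = 0 \<and> (\<exists>n::int. Re a = of_int n)"
    by simp
  also have "\<dots> \<longleftrightarrow> (\<exists>n::int. a = of_int n)"
    by (auto simp: complex_eq_iff)
  finally show ?thesis .
qed

lemma ee_of_int [simp]: "ee (of_int n) = 1"
  using ee_eq_1_iff by blast

lemma ee_1 [simp]: "ee 1 = 1"
  using ee_of_int[of 1] by simp

lemma ee_add_of_int [simp]: "ee (a + of_int n) = ee a"
  by (simp add: ee_add)

lemma norm_ee: "norm (ee a) = exp (- 2 * pi * Im a)"
  by (simp add: ee_def norm_exp_eq_Re)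

lemma has_field_derivative_ee [derivative_intros]:
  assumes "(f has_field_derivative f') (at x within A)"
  shows "((\<lambda>x. ee (f x)) has_field_derivative (2 * of_real pi * \<i> * f' * ee (f x))) (at x within A)"
proof -
  have "((\<lambda>u. ee u) has_field_derivative 2 * of_real pi * \<i> * ee (f x)) (at (f x))"
    unfolding ee_def by (auto intro!: derivative_eq_intros)
  from DERIV_chain2[OF this assms] show ?thesis by (simp add: mult_ac)
qed

lemma continuous_on_ee [continuous_intros]: "continuous_on A f \<Longrightarrow> continuous_on A (\<lambda>x. ee (f x))"
  unfolding ee_def by (intro continuous_intros)

lemma holomorphic_on_ee [holomorphic_intros]: "f holomorphic_on A \<Longrightarrow> (\<lambda>x. ee (f x)) holomorphic_on A"
  unfolding ee_def by (intro holomorphic_intros)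

section \<open>The kernel on a vertical line\<close>

abbreviation vline :: "real \<Rightarrow> real \<Rightarrow> complex" where
  "vline \<epsilon> y \<equiv> of_real \<epsilon> + \<i> * of_real y"

definition kern :: "complex \<Rightarrow> complex \<Rightarrow> complex" where
  "kern \<alpha> x = 1 / (ee (\<alpha> * x) - 1)"

text \<open>The poles of \<open>kern \<alpha>\<close> are the points \<open>n / \<alpha>\<close>,
  with real part \<open>n * Re (1 / \<alpha>)\<close>; the line runs strictly between
  \<open>n = 0\<close> and \<open>n = 1\<close>.\<close>

lemma ee_vline_ne_1:
  assumes "Re \<alpha> > 0" "0 < \<epsilon>" "\<epsilon> < Re (1 / \<alpha>)"
  shows "ee (\<alpha> * vline \<epsilon> y) \<noteq> 1"
proof
  assume "ee (\<alpha> * vline \<epsilon> y) = 1"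
  then obtain n :: int where "\<alpha> * vline \<epsilon> y = of_int n" by (auto simp: ee_eq_1_iff)
  moreover have "\<alpha> \<noteq> 0" using assms(1) by auto
  ultimately have "vline \<epsilon> y = of_real (of_int n) * (1 / \<alpha>)" by (simp add: field_simps)
  then have "Re (vline \<epsilon> y) = Re (of_real (of_int n) * (1 / \<alpha>))" by simp
  also have "\<dots> = of_int n * Re (1 / \<alpha>)" by (simp only: complex.sel times_complex.simps Re_complex_of_real Im_complex_of_real mult_zero_left diff_zero)
  finally have eq: "\<epsilon> = of_int n * Re (1 / \<alpha>)" by simp
  with assms have "of_int n > (0::real)" by (metis less_trans zero_less_mult_pos2)
  then have "of_int n \<ge> (1::real)" by simp
  then have "Re (1 / \<alpha>) \<le> of_int n * Re (1 / \<alpha>)" using assms by (simp add: mult_le_cancel_right1)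
  with eq assms show False by linarith
qed

lemma Im_mult_vline: "Im (\<alpha> * vline \<epsilon> y) = Re \<alpha> * y + Im \<alpha> * \<epsilon>"
  by simp

text \<open>The kernel tends to \<open>-1\<close> at the top of the line and behaves like
  \<open>1 / ee (\<alpha> x)\<close> at the bottom; the two bounds record this. Uniformity over a
  compact set of periods is what later permits differentiation in the period.\<close>

lemma kern_bound:
  assumes K: "compact K" and pos: "\<And>\<alpha>. \<alpha> \<in> K \<Longrightarrow> Re \<alpha> > 0" "\<And>\<alpha>. \<alpha> \<in> K \<Longrightarrow> \<epsilon> < Re (1 / \<alpha>)"
    and \<epsilon>: "0 < \<epsilon>"
  obtains C where "C > 0" "\<And>\<alpha> y. \<alpha> \<in> K \<Longrightarrow> norm (kern \<alpha> (vline \<epsilon> y)) \<le> C"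
    "\<And>\<alpha> y. \<alpha> \<in> K \<Longrightarrow> norm (kern \<alpha> (vline \<epsilon> y)) \<le> C * exp (2 * pi * Re \<alpha> * y)"
proof (cases "K = {}")
  case False
  obtain M where M: "M > 0" "\<And>\<alpha>. \<alpha> \<in> K \<Longrightarrow> norm \<alpha> \<le> M"
    using compact_imp_bounded[OF K] by (meson bounded_pos)
  obtain \<alpha>0 where a0: "\<alpha>0 \<in> K" "\<And>\<alpha>. \<alpha> \<in> K \<Longrightarrow> Re \<alpha>0 \<le> Re \<alpha>"
    using continuous_attains_inf[OF K False continuous_on_Re[OF continuous_on_id]] by auto
  define m where "m = Re \<alpha>0"
  have m: "m > 0" "\<And>\<alpha>. \<alpha> \<in> K \<Longrightarrow> m \<le> Re \<alpha>" using a0 pos by (auto simp: m_def)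
  \<comment> \<open>Chosen so that for \<open>\<bar>y\<bar> \<ge> Y\<close> the term
    \<open>2 * pi * Re \<alpha> * \<bar>y\<bar>\<close> exceeds the possible size of
    \<open>2 * pi * Im \<alpha> * \<epsilon>\<close> by at least 1. There
    \<open>ee (\<alpha> x)\<close> has modulus at most \<open>exp (- 1)\<close> or at least
    \<open>exp 1\<close>.\<close>
  define Y where "Y = (1 + 2 * pi * \<epsilon> * M) / (2 * pi * m)"
  have Y: "Y > 0" "2 * pi * (m * Y) = 1 + 2 * pi * \<epsilon> * M"
    using m M \<epsilon> pi_gt_zero by (auto simp: Y_def field_simps intro!: divide_pos_pos add_pos_pos mult_pos_pos)
  have "compact (K \<times> {-Y..Y})" by (intro compact_Times K compact_Icc)
  moreover have "continuous_on (K \<times> {-Y..Y}) (\<lambda>p. kern (fst p) (vline \<epsilon> (snd p)))"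
    unfolding kern_def using ee_vline_ne_1[OF pos(1) \<epsilon> pos(2)]
    by (intro continuous_intros) auto
  ultimately have "bounded ((\<lambda>p. kern (fst p) (vline \<epsilon> (snd p))) ` (K \<times> {-Y..Y}))"
    using compact_continuous_image compact_imp_bounded by blast
  then obtain B where B: "B > 0" "\<And>\<alpha> y. \<alpha> \<in> K \<Longrightarrow> \<bar>y\<bar> \<le> Y \<Longrightarrow> norm (kern \<alpha> (vline \<epsilon> y)) \<le> B"
    unfolding bounded_pos by (auto simp: abs_le_iff)
  define C1 where "C1 = B + 2 + 2 * exp (2 * pi * \<epsilon> * M)"
  \<comment> \<open>The extra factor makes the exponential bound hold on
    \<open>\<bar>y\<bar> \<le> Y\<close> too, where \<open>exp (2 * pi * Re \<alpha> * y)\<close> is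
    never below \<open>exp (- 2 * pi * Y * M)\<close>.\<close>
  define C where "C = C1 * exp (2 * pi * Y * M)"
  have C1: "C1 > B" "C1 > 2" "C1 > 2 * exp (2 * pi * \<epsilon> * M)" "C1 > 0"
    using B(1) by (auto simp: C1_def add_pos_pos)
  have CC: "C \<ge> C1"
    using C1 Y M by (simp add: C_def mult_le_cancel_left1)
  have main: "norm (kern \<alpha> (vline \<epsilon> y)) \<le> C \<and> norm (kern \<alpha> (vline \<epsilon> y)) \<le> C * exp (2 * pi * Re \<alpha> * y)"
    if a: "\<alpha> \<in> K" for \<alpha> y
  proof -
    have Im: "\<bar>Im \<alpha> * \<epsilon>\<bar> \<le> \<epsilon> * M"
      using M(2)[OF a] abs_Im_le_cmod[of \<alpha>] \<epsilon> by (simp add: abs_mult mult.commute mult_left_mono)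
    have R: "0 < Re \<alpha>" "m \<le> Re \<alpha>" "Re \<alpha> \<le> M"
      using pos a m M(2)[OF a] complex_Re_le_cmod[of \<alpha>] by auto
    define E where "E = norm (ee (\<alpha> * vline \<epsilon> y))"
    have E: "E = exp (- 2 * pi * (Re \<alpha> * y + Im \<alpha> * \<epsilon>))"
      unfolding E_def norm_ee Im_mult_vline ..
    have e2: "exp (1::real) \<ge> 2" using exp_ge_add_one_self[of 1] by simp
    consider "\<bar>y\<bar> \<le> Y" | "y \<ge> Y" | "y \<le> - Y" by linarith
    then show ?thesis
    proof cases
      case 1
      have "- (Y * M) \<le> Re \<alpha> * y"
      proof -
        have "\<bar>Re \<alpha> * y\<bar> \<le> M * Y" unfolding abs_mult using R 1 by (intro mult_mono) auto
        then show ?thesis by (simp add: mult.commute)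
      qed
      then have "2 * pi * - (Y * M) \<le> 2 * pi * (Re \<alpha> * y)" by (intro mult_left_mono) auto
      then have "0 \<le> 2 * pi * Y * M + 2 * pi * Re \<alpha> * y" by (simp add: algebra_simps)
      then have "1 \<le> exp (2 * pi * Y * M) * exp (2 * pi * Re \<alpha> * y)"
        unfolding exp_add[symmetric] by simp
      then have "C1 * 1 \<le> C1 * (exp (2 * pi * Y * M) * exp (2 * pi * Re \<alpha> * y))"
        using C1(4) by (intro mult_left_mono) auto
      then have "C1 \<le> C * exp (2 * pi * Re \<alpha> * y)" by (simp add: C_def mult.assoc)
      then show ?thesis using B(2)[OF a 1] C1 CC by linarith
    next
      case 2
      have "m * Y \<le> Re \<alpha> * y" using R 2 Y m by (intro mult_mono) auto
      then have "2 * pi * (m * Y - \<epsilon> * M) \<le> 2 * pi * (Re \<alpha> * y + Im \<alpha> * \<epsilon>)"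
        using Im by (intro mult_left_mono) auto
      then have "- 2 * pi * (Re \<alpha> * y + Im \<alpha> * \<epsilon>) \<le> - 1"
        using Y(2) by (simp add: algebra_simps)
      then have "E \<le> exp (- 1)" unfolding E by simp
      also have "\<dots> \<le> 1 / 2" using e2 by (simp add: exp_minus field_simps)
      finally have "norm (ee (\<alpha> * vline \<epsilon> y) - 1) \<ge> 1 / 2"
        using norm_triangle_ineq2[of 1 "ee (\<alpha> * vline \<epsilon> y)"] by (simp add: E_def norm_minus_commute)
      then have "norm (kern \<alpha> (vline \<epsilon> y)) \<le> 1 / (1 / 2)"
        unfolding kern_def norm_divide by (intro divide_mono) auto
      then have "norm (kern \<alpha> (vline \<epsilon> y)) \<le> 2" by simp
      moreover have "2 \<le> C" using CC C1 by linarith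
      moreover have "C \<le> C * exp (2 * pi * Re \<alpha> * y)"
      proof -
        have "0 \<le> y" using 2 Y by linarith
        then show ?thesis using R CC C1 by (simp add: mult_le_cancel_left1)
      qed
      ultimately show ?thesis by linarith
    next
      case 3
      have "m * Y \<le> Re \<alpha> * (- y)" using R 3 Y m by (intro mult_mono) auto
      then have "2 * pi * (m * Y - \<epsilon> * M) \<le> 2 * pi * (Re \<alpha> * (- y) - Im \<alpha> * \<epsilon>)"
        using Im by (intro mult_left_mono) auto
      then have "1 \<le> - 2 * pi * (Re \<alpha> * y + Im \<alpha> * \<epsilon>)"
        using Y(2) by (simp add: algebra_simps)
      then have "exp 1 \<le> E" unfolding E by simp
      then have E2: "2 \<le> E" using e2 by linarith
      have "norm (ee (\<alpha> * vline \<epsilon> y) - 1) \<ge> E - 1"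
        using norm_triangle_ineq2[of "ee (\<alpha> * vline \<epsilon> y)" 1] by (simp add: E_def)
      then have "norm (ee (\<alpha> * vline \<epsilon> y) - 1) \<ge> E / 2" using E2 by linarith
      then have "norm (kern \<alpha> (vline \<epsilon> y)) \<le> 1 / (E / 2)"
        unfolding kern_def norm_divide using E2 by (intro divide_mono) auto
      then have le: "norm (kern \<alpha> (vline \<epsilon> y)) \<le> 2 / E" by simp
      moreover have "2 / E \<le> 1" using E2 by simp
      moreover have "2 / E \<le> C1 * exp (2 * pi * Re \<alpha> * y)"
      proof -
        have "2 / E = 2 * exp (2 * pi * (Im \<alpha> * \<epsilon>)) * exp (2 * pi * Re \<alpha> * y)"
        proof -
          have "E = exp (- (2 * pi * (Im \<alpha> * \<epsilon>) + 2 * pi * Re \<alpha> * y))"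
            unfolding E by (simp add: algebra_simps)
          then have "2 / E = 2 * exp (2 * pi * (Im \<alpha> * \<epsilon>) + 2 * pi * Re \<alpha> * y)"
            by (simp only: exp_minus divide_inverse inverse_inverse_eq)
          then show ?thesis by (simp only: exp_add mult.assoc)
        qed
        also have "\<dots> \<le> 2 * exp (2 * pi * \<epsilon> * M) * exp (2 * pi * Re \<alpha> * y)"
          using Im by (intro mult_right_mono mult_left_mono) (auto simp: mult.assoc)
        also have "\<dots> \<le> C1 * exp (2 * pi * Re \<alpha> * y)"
          using C1 by (intro mult_right_mono) auto
        finally show ?thesis .
      qed
      moreover have "C1 * exp (2 * pi * Re \<alpha> * y) \<le> C * exp (2 * pi * Re \<alpha> * y)"
        using CC by (intro mult_right_mono) auto
      ultimately show ?thesis using CC C1 by linarith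
    qed
  qed
  show thesis
    by (rule that[of C]) (use main CC C1 in auto)
qed (use that[of 1] in auto)

text \<open>For \<open>y \<ge> 0\<close> the decay comes from \<open>ee (w x)\<close>, as
  \<open>Re w \<ge> d\<close>; for \<open>y < 0\<close> it comes from \<open>k\<close>, as
  \<open>Re w \<le> A - d\<close>. In the applications \<open>A\<close> is the sum of the real parts
  of the periods involved.\<close>

lemma ee_kern_bound:
  assumes "norm k \<le> C" "norm k \<le> C * exp (2 * pi * A * y)" "d \<le> Re w" "Re w \<le> A - d"
  shows "norm (ee (w * vline \<epsilon> y) * k) \<le> C * exp (- 2 * pi * \<epsilon> * Im w) * exp (- (2 * pi * d) * \<bar>y\<bar>)"
proof -
  have C: "C \<ge> 0" using assms(1) norm_ge_zero order_trans by blast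
  have n: "norm (ee (w * vline \<epsilon> y)) = exp (- 2 * pi * \<epsilon> * Im w) * exp (- (2 * pi * (Re w * y)))"
    unfolding norm_ee Im_mult_vline exp_add[symmetric] by (simp add: algebra_simps)
  show ?thesis
  proof (cases "y \<ge> 0")
    case True
    have "d * y \<le> Re w * y" using True assms by (intro mult_right_mono) auto
    then have "exp (- (2 * pi * (Re w * y))) * norm k \<le> exp (- (2 * pi * d) * \<bar>y\<bar>) * C"
      using True assms(1) by (intro mult_mono) (auto simp: mult.assoc)
    then have "exp (- 2 * pi * \<epsilon> * Im w) * (exp (- (2 * pi * (Re w * y))) * norm k)
      \<le> exp (- 2 * pi * \<epsilon> * Im w) * (exp (- (2 * pi * d) * \<bar>y\<bar>) * C)"
      by (intro mult_left_mono) auto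
    then show ?thesis unfolding norm_mult n by (simp only: mult_ac)
  next
    case False
    have "(A - Re w) * y \<le> d * y" using False assms by (intro mult_right_mono_neg) auto
    then have "exp (2 * pi * ((A - Re w) * y)) * C \<le> exp (2 * pi * (d * y)) * C"
      using C by (intro mult_right_mono) auto
    moreover have "exp (- (2 * pi * (Re w * y))) * norm k \<le> exp (- (2 * pi * (Re w * y))) * (C * exp (2 * pi * A * y))"
      using assms(2) by (intro mult_left_mono) auto
    moreover have "exp (- (2 * pi * (Re w * y))) * (C * exp (2 * pi * A * y)) = exp (2 * pi * ((A - Re w) * y)) * C"
      by (simp add: exp_diff exp_minus field_simps)
    moreover have "exp (2 * pi * (d * y)) = exp (- (2 * pi * d) * \<bar>y\<bar>)"
      using False by simp
    ultimately have "exp (- (2 * pi * (Re w * y))) * norm k \<le> exp (- (2 * pi * d) * \<bar>y\<bar>) * C" by simp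
    then have "exp (- 2 * pi * \<epsilon> * Im w) * (exp (- (2 * pi * (Re w * y))) * norm k)
      \<le> exp (- 2 * pi * \<epsilon> * Im w) * (exp (- (2 * pi * d) * \<bar>y\<bar>) * C)"
      by (intro mult_left_mono) auto
    then show ?thesis unfolding norm_mult n by (simp only: mult_ac)
  qed
qed

lemma kern_bound1:
  assumes "Re \<alpha> > 0" "0 < \<epsilon>" "\<epsilon> < Re (1 / \<alpha>)"
  obtains C where "C > 0" "\<And>y. norm (kern \<alpha> (vline \<epsilon> y)) \<le> C"
    "\<And>y. norm (kern \<alpha> (vline \<epsilon> y)) \<le> C * exp (2 * pi * Re \<alpha> * y)"
proof (rule kern_bound[of "{\<alpha>}" \<epsilon>])
  show "\<And>\<beta>. \<beta> \<in> {\<alpha>} \<Longrightarrow> \<epsilon> < Re (1 / \<beta>)" using assms by simp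
qed (use assms that in auto)

text \<open>Bounds for the horizontal sides of the rectangle in the residue computation. At the
  bottom \<open>ee (w x)\<close> grows and the decay of the kernel has to be used; the factor
  \<open>ee (\<alpha> x)\<close> extracts it.\<close>

lemma kern_horizontal:
  assumes "Re \<alpha> > 0" "S \<ge> 0"
  obtains N0 where "\<And>N s. N \<ge> N0 \<Longrightarrow> s \<in> {0..S} \<Longrightarrow> norm (kern \<alpha> (vline s N)) \<le> 2"
    "\<And>N s. N \<ge> N0 \<Longrightarrow> s \<in> {0..S} \<Longrightarrow> norm (ee (\<alpha> * vline s (- N)) * kern \<alpha> (vline s (- N))) \<le> 2"
proof -
  define N0 where "N0 = (1 + \<bar>Im \<alpha>\<bar> * S) / Re \<alpha>"
  have e2: "exp (1::real) \<ge> 2" using exp_ge_add_one_self[of 1] by simp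
  have ge: "Re \<alpha> * N + t * (Im \<alpha> * s) \<ge> 1" if "N \<ge> N0" "s \<in> {0..S}" "\<bar>t\<bar> = 1" for N s t
  proof -
    have "\<bar>t * (Im \<alpha> * s)\<bar> \<le> \<bar>Im \<alpha>\<bar> * S"
      using that by (simp add: abs_mult mult_left_mono)
    moreover have "Re \<alpha> * N \<ge> 1 + \<bar>Im \<alpha>\<bar> * S"
      using that(1) assms(1) by (simp add: N0_def field_simps)
    ultimately show ?thesis by linarith
  qed
  have pi1: "u \<ge> 1 \<Longrightarrow> 2 * pi * u \<ge> 1" for u :: real
    using pi_ge_two mult_mono[of 1 "2 * pi" 1 u] by simp
  show thesis
  proof (rule that[of N0])
    fix N s assume *: "N \<ge> N0" "s \<in> {0..S}"
    have "norm (ee (\<alpha> * vline s N)) \<le> exp (- 1)"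
      unfolding norm_ee Im_mult_vline using pi1[OF ge[OF *, of 1]] by (simp add: algebra_simps)
    also have "\<dots> \<le> 1 / 2" using e2 by (simp add: exp_minus field_simps)
    finally have "norm (ee (\<alpha> * vline s N) - 1) \<ge> 1 / 2"
      using norm_triangle_ineq2[of 1 "ee (\<alpha> * vline s N)"] by (simp add: norm_minus_commute)
    then have "norm (kern \<alpha> (vline s N)) \<le> 1 / (1 / 2)"
      unfolding kern_def norm_divide by (intro divide_mono) auto
    then show "norm (kern \<alpha> (vline s N)) \<le> 2" by simp
    define E where "E = norm (ee (\<alpha> * vline s (- N)))"
    have "exp 1 \<le> E"
      unfolding E_def norm_ee Im_mult_vline using pi1[OF ge[OF *, of "-1"]] by (simp add: algebra_simps)
    then have E2: "2 \<le> E" using e2 by linarith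
    have "norm (ee (\<alpha> * vline s (- N)) - 1) \<ge> E - 1"
      using norm_triangle_ineq2[of "ee (\<alpha> * vline s (- N))" 1] by (simp add: E_def)
    then have "norm (ee (\<alpha> * vline s (- N)) - 1) \<ge> E / 2" using E2 by linarith
    then have "norm (kern \<alpha> (vline s (- N))) \<le> 1 / (E / 2)"
      unfolding kern_def norm_divide using E2 by (intro divide_mono) auto
    then have "E * norm (kern \<alpha> (vline s (- N))) \<le> E * (1 / (E / 2))"
      using E2 by (intro mult_left_mono) auto
    then show "norm (ee (\<alpha> * vline s (- N)) * kern \<alpha> (vline s (- N))) \<le> 2"
      using E2 by (simp add: norm_mult E_def)
  qed
qed

lemma exp_neg_mult_nat_LIMSEQ:
  fixes c K :: real
  assumes "c > 0"
  shows "(\<lambda>n. K * exp (- c * real n)) \<longlonglongrightarrow> 0"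
proof -
  have "(\<lambda>n. exp (- c) ^ n) \<longlonglongrightarrow> 0"
    by (rule LIMSEQ_realpow_zero) (use assms in auto)
  then have "(\<lambda>n. K * exp (- c) ^ n) \<longlonglongrightarrow> K * 0" by (intro tendsto_mult tendsto_const)
  then show ?thesis by (simp add: exp_of_nat_mult[symmetric] mult.commute)
qed

lemma Complex_vline: "Complex a b = vline a b"
  by (simp add: complex_eq_iff)

text \<open>The line at abscissa \<open>\<epsilon> + Re (1/\<alpha>)\<close> carries \<open>ee (w/\<alpha>)\<close> times the integrand on the line at
  \<open>\<epsilon>\<close>, and \<open>1/\<alpha>\<close> is the only pole in between.\<close>

lemma fourier_kern:
  assumes \<alpha>: "Re \<alpha> > 0" "0 < \<epsilon>" "\<epsilon> < Re (1 / \<alpha>)" and w: "0 < Re w" "Re w < Re \<alpha>"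
  shows "(ee (w / \<alpha>) - 1) * (\<i> * (LBINT y. ee (w * vline \<epsilon> y) * kern \<alpha> (vline \<epsilon> y))) = ee (w / \<alpha>) / \<alpha>"
proof -
  have \<alpha>0: "\<alpha> \<noteq> 0" using \<alpha> by auto
  define f where "f = (\<lambda>x. ee (w * x) * kern \<alpha> x)"
  define \<rho> \<sigma> where "\<rho> = Re (1 / \<alpha>)" and "\<sigma> = Im (1 / \<alpha>)"
  have inv: "1 / \<alpha> = vline \<rho> \<sigma>" unfolding \<rho>_def \<sigma>_def by (simp add: complex_eq_iff)
  have \<rho>: "\<rho> > \<epsilon>" "\<rho> > 0" using \<alpha> by (auto simp: \<rho>_def)
  define d where "d = min (Re w) (Re \<alpha> - Re w)"
  have d: "d > 0" "d \<le> Re w" "Re w \<le> Re \<alpha> - d" using w by (auto simp: d_def)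
  obtain C0 where C0: "C0 > 0" "\<And>y. norm (kern \<alpha> (vline \<epsilon> y)) \<le> C0"
    "\<And>y. norm (kern \<alpha> (vline \<epsilon> y)) \<le> C0 * exp (2 * pi * Re \<alpha> * y)"
    using kern_bound1[OF \<alpha>] by blast
  define C where "C = C0 * exp (- 2 * pi * \<epsilon> * Im w)"
  define \<delta> where "\<delta> = 2 * pi * d"
  have \<delta>: "\<delta> > 0" using d by (simp add: \<delta>_def)
  have fb: "norm (f (vline \<epsilon> y)) \<le> C * exp (- \<delta> * \<bar>y\<bar>)" for y
    unfolding f_def C_def \<delta>_def by (rule ee_kern_bound[OF C0(2,3) d(2,3)])
  have C: "C > 0" using C0 by (simp add: C_def)
  have fc: "continuous_on UNIV (\<lambda>y. f (vline \<epsilon> y))"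
    unfolding f_def kern_def using ee_vline_ne_1[OF \<alpha>] by (intro continuous_intros) auto
  define I where "I = (LBINT y. f (vline \<epsilon> y))"
  \<comment> \<open>\<open>1 / \<alpha>\<close> is not real in general, so the translated line is
    also reparametrised by the vertical offset \<open>\<sigma>\<close>.\<close>
  have per: "f (vline (\<epsilon> + \<rho>) y) = ee (w / \<alpha>) * f (vline \<epsilon> (y - \<sigma>))" for y
  proof -
    have x: "vline (\<epsilon> + \<rho>) y = vline \<epsilon> (y - \<sigma>) + 1 / \<alpha>"
      unfolding inv by (simp add: algebra_simps)
    have "ee (\<alpha> * (vline \<epsilon> (y - \<sigma>) + 1 / \<alpha>)) = ee (\<alpha> * vline \<epsilon> (y - \<sigma>))"
      using \<alpha>0 by (simp only: ring_distribs ee_add) simp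
    moreover have "ee (w * (vline \<epsilon> (y - \<sigma>) + 1 / \<alpha>)) = ee (w / \<alpha>) * ee (w * vline \<epsilon> (y - \<sigma>))"
      by (simp only: ring_distribs ee_add times_divide_eq_right mult_1_right mult_1_left mult.commute)
    ultimately show ?thesis unfolding f_def kern_def x by simp
  qed
  have gb: "norm (f (vline (\<epsilon> + \<rho>) y)) \<le> norm (ee (w / \<alpha>)) * C * exp (\<delta> * \<bar>\<sigma>\<bar>) * exp (- \<delta> * \<bar>y\<bar>)" for y
  proof -
    have "norm (f (vline \<epsilon> (y - \<sigma>))) \<le> C * exp (- \<delta> * \<bar>y - \<sigma>\<bar>)" by (rule fb)
    also have "\<dots> \<le> C * exp (\<delta> * \<bar>\<sigma>\<bar> + - \<delta> * \<bar>y\<bar>)"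
    proof -
      have "\<delta> * (\<bar>y\<bar> - \<bar>\<sigma>\<bar>) \<le> \<delta> * \<bar>y - \<sigma>\<bar>" using \<delta> by (intro mult_left_mono) auto
      then show ?thesis using C by (simp add: algebra_simps)
    qed
    finally have "norm (ee (w / \<alpha>)) * norm (f (vline \<epsilon> (y - \<sigma>))) \<le> norm (ee (w / \<alpha>)) * (C * exp (\<delta> * \<bar>\<sigma>\<bar> + - \<delta> * \<bar>y\<bar>))"
      by (intro mult_left_mono) auto
    then show ?thesis unfolding per norm_mult exp_add by (simp only: mult.assoc)
  qed
  have gc: "continuous_on UNIV (\<lambda>y. f (vline (\<epsilon> + \<rho>) y))"
    unfolding per by (intro continuous_intros continuous_on_compose2[OF fc]) auto
  have right: "(LBINT y. f (vline (\<epsilon> + \<rho>) y)) = ee (w / \<alpha>) * I"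
  proof -
    have "(LBINT y. f (vline \<epsilon> y)) = \<bar>1\<bar> *\<^sub>R (LBINT y. f (vline \<epsilon> (- \<sigma> + 1 * y)))"
      by (rule lborel_integral_real_affine) simp
    then have "(LBINT y. f (vline \<epsilon> (y - \<sigma>))) = I" by (simp add: I_def)
    moreover have "(LBINT y. f (vline (\<epsilon> + \<rho>) y)) = (LBINT y. ee (w / \<alpha>) * f (vline \<epsilon> (y - \<sigma>)))"
      by (simp only: per)
    ultimately show ?thesis by simp
  qed
  \<comment> \<open>A one-point parameter set turns the uniform statement into an ordinary
    limit.\<close>
  have limL: "(\<lambda>n. integral {- real n..real n} (\<lambda>y. f (vline \<epsilon> y))) \<longlonglongrightarrow> I"
    using line_integral_uniform_limit[of "{()}" "\<lambda>_ y. f (vline \<epsilon> y)", OF fc fb \<delta>]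
    unfolding I_def by (rule tendsto_uniform_limitI) simp
  have limR: "(\<lambda>n. integral {- real n..real n} (\<lambda>y. f (vline (\<epsilon> + \<rho>) y))) \<longlonglongrightarrow> ee (w / \<alpha>) * I"
    using line_integral_uniform_limit[of "{()}" "\<lambda>_ y. f (vline (\<epsilon> + \<rho>) y)", OF gc gb \<delta>]
    unfolding right by (rule tendsto_uniform_limitI) simp
  define B where "B = (\<lambda>n. contour_integral (linepath (Complex \<epsilon> (- real n)) (Complex (\<epsilon> + \<rho>) (- real n))) f)"
  define T where "T = (\<lambda>n. contour_integral (linepath (Complex (\<epsilon> + \<rho>) (real n)) (Complex \<epsilon> (real n))) f)"
  \<comment> \<open>In this strip \<open>1 / \<alpha>\<close> is the only pole of \<open>f\<close>:
    the neighbouring candidates 0 and \<open>2 / \<alpha>\<close> have their real parts on its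
    boundary.\<close>
  define S where "S = {x. 0 < Re x \<and> Re x < 2 * \<rho>}"
  have S: "open S" "convex S"
  proof -
    have "S = {x. Re x > 0} \<inter> {x. Re x < 2 * \<rho>}" by (auto simp: S_def)
    then show "open S" "convex S"
      using open_halfspace_Re_gt open_halfspace_Re_lt convex_halfspace_Re_gt convex_halfspace_Re_lt
      by (auto intro: convex_Int)
  qed
  have one: "x = 1 / \<alpha>" if "x \<in> S" "ee (\<alpha> * x) = 1" for x
  proof -
    obtain k :: int where "\<alpha> * x = of_int k" using \<open>ee (\<alpha> * x) = 1\<close> by (auto simp: ee_eq_1_iff)
    then have x: "x = of_real (of_int k) * (1 / \<alpha>)" using \<alpha>0 by (simp add: field_simps)
    then have "Re x = of_int k * \<rho>"
      unfolding \<rho>_def by (simp only: times_complex.simps Re_complex_of_real Im_complex_of_real mult_zero_left diff_zero)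
    then have "0 < of_int k * \<rho>" "of_int k * \<rho> < 2 * \<rho>" using that(1) by (auto simp: S_def)
    then have "0 < real_of_int k" "real_of_int k < 2"
      using \<rho> by (auto simp: zero_less_mult_iff)
    then have "k = 1" by linarith
    with x show ?thesis by simp
  qed
  have oneS: "1 / \<alpha> \<in> S" using \<rho> unfolding S_def by (simp add: \<rho>_def)
  have holf: "f holomorphic_on (S - {1 / \<alpha>})"
    unfolding f_def kern_def using one by (intro holomorphic_intros) auto
  have "((\<lambda>x. ee (\<alpha> * x) - 1) has_field_derivative 2 * of_real pi * \<i> * \<alpha>) (at (1 / \<alpha>))"
    using \<alpha>0 by (auto intro!: derivative_eq_intros)
  then have "residue (\<lambda>x. ee (w * x) / (ee (\<alpha> * x) - 1)) (1 / \<alpha>) = ee (w * (1 / \<alpha>)) / (2 * of_real pi * \<i> * \<alpha>)"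
    using \<alpha>0 oneS S
    by (intro residue_simple_pole_deriv[of _ S]) (auto intro!: holomorphic_intros convex_connected)
  then have res: "residue f (1 / \<alpha>) = ee (w / \<alpha>) / (2 * of_real pi * \<i> * \<alpha>)"
    unfolding f_def kern_def by simp
  \<comment> \<open>The residue theorem on the rectangle; \<open>n > \<bar>\<sigma>\<bar>\<close>
    places the pole inside.\<close>
  have eq: "B n + \<i> * integral {- real n..real n} (\<lambda>y. f (vline (\<epsilon> + \<rho>) y)) + T n
      - \<i> * integral {- real n..real n} (\<lambda>y. f (vline \<epsilon> y)) = ee (w / \<alpha>) / \<alpha>"
    if n: "real n > \<bar>\<sigma>\<bar>" for n
  proof -
    define a where "a = Complex \<epsilon> (- real n)"
    define b where "b = Complex (\<epsilon> + \<rho>) (- real n)"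
    define c where "c = Complex (\<epsilon> + \<rho>) (real n)"
    define e where "e = Complex \<epsilon> (real n)"
    have n0: "real n > 0" using n by linarith
    have box: "1 / \<alpha> \<in> box a c"
      unfolding inv a_def c_def in_box_complex_iff using \<rho> \<alpha> n by auto
    have cbox: "cbox a c \<subseteq> S"
      using \<rho> \<alpha> by (auto simp: a_def c_def in_cbox_complex_iff S_def)
    have le: "Re a \<le> Re c" "Im a \<le> Im c" using \<rho> n0 by (auto simp: a_def c_def)
    have img: "path_image (rectpath a c) \<subseteq> S - {1 / \<alpha>}"
      using path_image_rectpath_cbox_minus_box[OF le] cbox box by blast
    have "contour_integral (rectpath a c) f =
        2 * pi * \<i> * (\<Sum>p\<in>{1 / \<alpha>}. winding_number (rectpath a c) p * residue f p)"
    proof (rule Residue_theorem[OF S(1) convex_connected[OF S(2)] _ holf])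
      show "\<forall>z. z \<notin> S \<longrightarrow> winding_number (rectpath a c) z = 0"
        using winding_number_rectpath_outside[OF le] cbox by blast
    qed (use img in auto)
    also have "\<dots> = ee (w / \<alpha>) / \<alpha>"
      using \<alpha>0 by (simp add: winding_number_rectpath[OF box] res)
    finally have 1: "contour_integral (rectpath a c) f = ee (w / \<alpha>) / \<alpha>" .
    have rp: "rectpath a c = linepath a b +++ linepath b c +++ linepath c e +++ linepath e a"
      by (simp add: rectpath_def Let_def a_def b_def c_def e_def)
    have pi: "path_image (rectpath a c) = closed_segment a b \<union> closed_segment b c \<union> closed_segment c e \<union> closed_segment e a"
      unfolding rp by (simp add: path_image_join Un_assoc)
    have cont: "continuous_on (path_image (rectpath a c)) f"
      using holomorphic_on_imp_continuous_on[OF holf] img by (rule continuous_on_subset)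
    have ci: "f contour_integrable_on (linepath a b)" "f contour_integrable_on (linepath b c)"
      "f contour_integrable_on (linepath c e)" "f contour_integrable_on (linepath e a)"
      by (rule contour_integrable_continuous_linepath, rule continuous_on_subset[OF cont], unfold pi, blast)+
    have tot: "contour_integral (rectpath a c) f = contour_integral (linepath a b) f + (contour_integral (linepath b c) f
        + (contour_integral (linepath c e) f + contour_integral (linepath e a) f))"
      unfolding rp using ci by simp
    have bc: "contour_integral (linepath b c) f = \<i> * integral {- real n..real n} (\<lambda>y. f (vline (\<epsilon> + \<rho>) y))"
      unfolding Complex_vline[symmetric]
      using n0 by (intro contour_integral_linepath_same_Re) (auto simp: b_def c_def)
    have ae: "contour_integral (linepath a e) f = \<i> * integral {- real n..real n} (\<lambda>y. f (vline \<epsilon> y))"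
      unfolding Complex_vline[symmetric]
      using n0 by (intro contour_integral_linepath_same_Re) (auto simp: a_def e_def)
    have ea: "contour_integral (linepath e a) f = - contour_integral (linepath a e) f"
      using contour_integral_reversepath[of "linepath a e" f] by simp
    have bt: "B n = contour_integral (linepath a b) f" "T n = contour_integral (linepath c e) f"
      by (simp_all add: B_def T_def a_def b_def c_def e_def)
    show ?thesis
      unfolding bt bc[symmetric] ae[symmetric] 1[symmetric] tot ea by simp
  qed
  define Smax where "Smax = \<epsilon> + \<rho>"
  have Smax: "Smax \<ge> 0" "Smax > \<epsilon>" using \<alpha> \<rho> by (auto simp: Smax_def)
  obtain N0 where N0: "\<And>N s. N \<ge> N0 \<Longrightarrow> s \<in> {0..Smax} \<Longrightarrow> norm (kern \<alpha> (vline s N)) \<le> 2"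
    "\<And>N s. N \<ge> N0 \<Longrightarrow> s \<in> {0..Smax} \<Longrightarrow> norm (ee (\<alpha> * vline s (- N)) * kern \<alpha> (vline s (- N))) \<le> 2"
    using kern_horizontal[OF \<alpha>(1) Smax(1)] by blast
  have nee: "norm (ee (v * vline s N)) \<le> exp (2 * pi * \<bar>Im v\<bar> * Smax) * exp (- 2 * pi * Re v * N)"
    if "s \<in> {0..Smax}" for v s N
  proof -
    have "\<bar>Im v * s\<bar> \<le> \<bar>Im v\<bar> * Smax" using that by (simp add: abs_mult mult_left_mono)
    then have "- (Im v * s) \<le> \<bar>Im v\<bar> * Smax" by linarith
    then have "2 * pi * - (Im v * s) \<le> 2 * pi * (\<bar>Im v\<bar> * Smax)" by (intro mult_left_mono) auto
    then show ?thesis unfolding norm_ee Im_mult_vline exp_add[symmetric] by (simp add: algebra_simps)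
  qed
  have seg: "x \<in> closed_segment (Complex \<epsilon> N) (Complex Smax N) \<Longrightarrow> \<exists>s\<in>{0..Smax}. x = vline s N" for x N
    using \<alpha> Smax by (auto simp: closed_segment_same_Im closed_segment_eq_real_ivl complex_eq_iff intro!: bexI[of _ "Re x"])
  have cont_h: "f contour_integrable_on linepath (Complex \<epsilon> N) (Complex Smax N)"
    if "\<bar>N\<bar> > \<bar>\<sigma>\<bar>" for N
  proof (rule contour_integrable_continuous_linepath, rule continuous_on_subset[OF holomorphic_on_imp_continuous_on[OF holf]])
    show "closed_segment (Complex \<epsilon> N) (Complex Smax N) \<subseteq> S - {1 / \<alpha>}"
      using that \<alpha> \<rho> unfolding inv
      by (auto simp: closed_segment_same_Im closed_segment_eq_real_ivl S_def Smax_def)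
  qed
  have evN: "\<forall>\<^sub>F n in sequentially. real n \<ge> N0 \<and> real n > \<bar>\<sigma>\<bar>"
  proof -
    obtain N :: nat where "max N0 \<bar>\<sigma>\<bar> < real N" using reals_Archimedean2 by blast
    then show ?thesis by (intro eventually_sequentiallyI[of N]) auto
  qed
  have T0: "T \<longlonglongrightarrow> 0"
  proof (rule Lim_null_comparison)
    show "(\<lambda>n. (2 * exp (2 * pi * \<bar>Im w\<bar> * Smax) * norm (Complex Smax 0 - Complex \<epsilon> 0)) * exp (- (2 * pi * Re w) * real n)) \<longlonglongrightarrow> 0"
      using w by (intro exp_neg_mult_nat_LIMSEQ) auto
    have "norm (T n) \<le> (2 * exp (2 * pi * \<bar>Im w\<bar> * Smax) * norm (Complex Smax 0 - Complex \<epsilon> 0)) * exp (- (2 * pi * Re w) * real n)"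
      if n: "real n \<ge> N0" "real n > \<bar>\<sigma>\<bar>" for n
    proof -
      have "T n = - contour_integral (linepath (Complex \<epsilon> (real n)) (Complex Smax (real n))) f"
        using contour_integral_reversepath[of "linepath (Complex \<epsilon> (real n)) (Complex Smax (real n))" f]
        by (simp add: T_def Smax_def)
      then have "norm (T n) = norm (contour_integral (linepath (Complex \<epsilon> (real n)) (Complex Smax (real n))) f)" by simp
      also have "\<dots> \<le> (exp (2 * pi * \<bar>Im w\<bar> * Smax) * exp (- 2 * pi * Re w * real n) * 2) * norm (Complex Smax (real n) - Complex \<epsilon> (real n))"
      proof (rule contour_integral_bound_linepath)
        fix x assume "x \<in> closed_segment (Complex \<epsilon> (real n)) (Complex Smax (real n))"
        then obtain s where s: "s \<in> {0..Smax}" "x = vline s (real n)" using seg by blast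
        show "norm (f x) \<le> exp (2 * pi * \<bar>Im w\<bar> * Smax) * exp (- 2 * pi * Re w * real n) * 2"
          unfolding f_def s(2) norm_mult
          by (intro mult_mono nee[OF s(1)] N0(1)[OF n(1) s(1)]) auto
      qed (use n in \<open>auto intro: cont_h\<close>)
      also have "Complex Smax (real n) - Complex \<epsilon> (real n) = Complex Smax 0 - Complex \<epsilon> 0" by (simp add: complex_eq_iff)
      finally show ?thesis by (simp add: mult_ac)
    qed
    with evN show "\<forall>\<^sub>F n in sequentially. norm (T n) \<le> (2 * exp (2 * pi * \<bar>Im w\<bar> * Smax) * norm (Complex Smax 0 - Complex \<epsilon> 0)) * exp (- (2 * pi * Re w) * real n)"
      by (auto elim!: eventually_mono)
  qed
  \<comment> \<open>On the bottom side the integrand is regrouped as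
    \<open>ee ((w - \<alpha>) x)\<close> times a bounded factor; this decays because
    \<open>Re w < Re \<alpha>\<close>.\<close>
  have B0: "B \<longlonglongrightarrow> 0"
  proof (rule Lim_null_comparison)
    show "(\<lambda>n. (2 * exp (2 * pi * \<bar>Im (w - \<alpha>)\<bar> * Smax) * norm (Complex Smax 0 - Complex \<epsilon> 0)) * exp (- (2 * pi * (Re \<alpha> - Re w)) * real n)) \<longlonglongrightarrow> 0"
      using w by (intro exp_neg_mult_nat_LIMSEQ) auto
    have "norm (B n) \<le> (2 * exp (2 * pi * \<bar>Im (w - \<alpha>)\<bar> * Smax) * norm (Complex Smax 0 - Complex \<epsilon> 0)) * exp (- (2 * pi * (Re \<alpha> - Re w)) * real n)"
      if n: "real n \<ge> N0" "real n > \<bar>\<sigma>\<bar>" for n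
    proof -
      have "norm (B n) \<le> (exp (2 * pi * \<bar>Im (w - \<alpha>)\<bar> * Smax) * exp (- 2 * pi * Re (w - \<alpha>) * (- real n)) * 2) * norm (Complex Smax (- real n) - Complex \<epsilon> (- real n))"
        unfolding B_def Smax_def[symmetric]
      proof (rule contour_integral_bound_linepath)
        fix x assume "x \<in> closed_segment (Complex \<epsilon> (- real n)) (Complex Smax (- real n))"
        then obtain s where s: "s \<in> {0..Smax}" "x = vline s (- real n)" using seg by blast
        have "f x = ee ((w - \<alpha>) * x) * (ee (\<alpha> * x) * kern \<alpha> x)"
          unfolding f_def by (simp add: left_diff_distrib ee_diff)
        then have "norm (f x) = norm (ee ((w - \<alpha>) * x)) * norm (ee (\<alpha> * x) * kern \<alpha> x)"
          by (simp only: norm_mult)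
        also have "\<dots> \<le> exp (2 * pi * \<bar>Im (w - \<alpha>)\<bar> * Smax) * exp (- 2 * pi * Re (w - \<alpha>) * (- real n)) * 2"
          unfolding s(2) by (intro mult_mono nee[OF s(1)] N0(2)[OF n(1) s(1)]) auto
        finally show "norm (f x) \<le> exp (2 * pi * \<bar>Im (w - \<alpha>)\<bar> * Smax) * exp (- 2 * pi * Re (w - \<alpha>) * (- real n)) * 2" .
      qed (use n in \<open>auto intro: cont_h\<close>)
      also have "Complex Smax (- real n) - Complex \<epsilon> (- real n) = Complex Smax 0 - Complex \<epsilon> 0" by (simp add: complex_eq_iff)
      finally show ?thesis by (simp add: mult_ac left_diff_distrib right_diff_distrib)
    qed
    with evN show "\<forall>\<^sub>F n in sequentially. norm (B n) \<le> (2 * exp (2 * pi * \<bar>Im (w - \<alpha>)\<bar> * Smax) * norm (Complex Smax 0 - Complex \<epsilon> 0)) * exp (- (2 * pi * (Re \<alpha> - Re w)) * real n)"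
      by (auto elim!: eventually_mono)
  qed
  have "(\<lambda>n. B n + \<i> * integral {- real n..real n} (\<lambda>y. f (vline (\<epsilon> + \<rho>) y)) + T n
      - \<i> * integral {- real n..real n} (\<lambda>y. f (vline \<epsilon> y))) \<longlonglongrightarrow> 0 + \<i> * (ee (w / \<alpha>) * I) + 0 - \<i> * I"
    by (intro tendsto_intros limL limR B0 T0)
  moreover have "\<forall>\<^sub>F n in sequentially. B n + \<i> * integral {- real n..real n} (\<lambda>y. f (vline (\<epsilon> + \<rho>) y)) + T n
      - \<i> * integral {- real n..real n} (\<lambda>y. f (vline \<epsilon> y)) = ee (w / \<alpha>) / \<alpha>"
    using evN by eventually_elim (rule eq, blast)
  ultimately have "(\<lambda>n. ee (w / \<alpha>) / \<alpha>) \<longlonglongrightarrow> 0 + \<i> * (ee (w / \<alpha>) * I) + 0 - \<i> * I"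
    by (rule Lim_transform_eventually)
  then have "0 + \<i> * (ee (w / \<alpha>) * I) + 0 - \<i> * I = ee (w / \<alpha>) / \<alpha>"
    using LIMSEQ_unique tendsto_const by blast
  then show ?thesis unfolding I_def f_def by (simp add: algebra_simps)
qed

section \<open>The double sine function\<close>

lemma norm_line_integral_le:
  fixes f :: "real \<Rightarrow> complex"
  assumes "\<And>y. norm (f y) \<le> C * exp (- \<delta> * \<bar>y\<bar>)" "\<delta> > 0"
  shows "norm (LBINT y. f y) \<le> C * (LBINT y. exp (- \<delta> * \<bar>y\<bar>))"
proof (cases "integrable lborel f")
  case True
  have "norm (LBINT y. f y) \<le> (LBINT y. norm (f y))" by (rule integral_norm_bound)
  also have "\<dots> \<le> (LBINT y. C * exp (- \<delta> * \<bar>y\<bar>))"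
    using True assms by (intro integral_mono integrable_mult_right integrable_exp_neg_abs) auto
  finally show ?thesis by simp
next
  \<comment> \<open>A non-integrable function has integral 0 by convention, so only the sign of
    \<open>C\<close> matters.\<close>
  case False
  have "C \<ge> 0" using assms(1)[of 0] norm_ge_zero[of "f 0"] by (simp del: norm_ge_zero)
  then show ?thesis using False
    by (simp add: not_integrable_integral_eq integral_nonneg_AE)
qed

lemma vline_nonzero: "\<epsilon> > 0 \<Longrightarrow> vline \<epsilon> y \<noteq> 0"
  by (auto simp: complex_eq_iff)

lemma norm_inverse_vline: "\<epsilon> > 0 \<Longrightarrow> norm (\<i> / vline \<epsilon> y) \<le> 1 / \<epsilon>"
  using complex_Re_le_cmod[of "vline \<epsilon> y"] unfolding norm_divide by (intro frac_le) auto

lemma ee_div_kern_bound: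
  assumes "0 < \<epsilon>" "norm k \<le> C" "norm k \<le> C * exp (2 * pi * A * y)" "d \<le> Re w" "Re w \<le> A - d"
  shows "norm (\<i> * (ee (w * vline \<epsilon> y) / vline \<epsilon> y * k)) \<le> C / \<epsilon> * exp (- 2 * pi * \<epsilon> * Im w) * exp (- (2 * pi * d) * \<bar>y\<bar>)"
proof -
  have "norm (\<i> * (ee (w * vline \<epsilon> y) / vline \<epsilon> y * k)) = norm (\<i> / vline \<epsilon> y) * norm (ee (w * vline \<epsilon> y) * k)"
    by (simp add: norm_mult norm_divide)
  also have "\<dots> \<le> 1 / \<epsilon> * (C * exp (- 2 * pi * \<epsilon> * Im w) * exp (- (2 * pi * d) * \<bar>y\<bar>))"
    using assms(1) by (intro mult_mono norm_inverse_vline ee_kern_bound[OF assms(2-5)]) auto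
  finally show ?thesis by simp
qed

text \<open>Closing the contour to the right gives, formally, \<open>sine_log \<epsilon> \<alpha> w = Ln (1 - ee (w/\<alpha>))\<close>;
  \<open>double_sine_log\<close> is the logarithm of the double sine function with periods \<open>\<alpha>\<close>, \<open>\<beta>\<close>.\<close>

definition sine_log :: "real \<Rightarrow> complex \<Rightarrow> complex \<Rightarrow> complex" where
  "sine_log \<epsilon> \<alpha> w = (LBINT y. \<i> * (ee (w * vline \<epsilon> y) / vline \<epsilon> y * kern \<alpha> (vline \<epsilon> y)))"

definition double_sine_log :: "real \<Rightarrow> complex \<Rightarrow> complex \<Rightarrow> complex \<Rightarrow> complex" where
  "double_sine_log \<epsilon> \<alpha> \<beta> w =
     (LBINT y. \<i> * (ee (w * vline \<epsilon> y) / vline \<epsilon> y * (kern \<alpha> (vline \<epsilon> y) * kern \<beta> (vline \<epsilon> y))))"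

text \<open>Differentiation in \<open>w\<close> cancels the \<open>1 / x\<close>, which leaves the
  integrand of \<open>fourier_kern\<close>; the constant is
  \<open>\<i> * 2 * pi * \<i>\<close>.\<close>

lemma has_field_derivative_ee_div:
  assumes "x \<noteq> 0"
  shows "((\<lambda>w. \<i> * (ee (w * x) / x * k)) has_field_derivative - 2 * of_real pi * (ee (w * x) * k)) (at w)"
proof -
  have "((\<lambda>w. \<i> * (ee (w * x) / x * k)) has_field_derivative
      \<i> * (2 * of_real pi * \<i> * (1 * x) * ee (w * x) / x * k)) (at w)"
    by (intro DERIV_cmult DERIV_cmult_right DERIV_cdivide has_field_derivative_ee DERIV_ident)
  also have "\<i> * (2 * of_real pi * \<i> * (1 * x) * ee (w * x) / x * k)
      = (\<i> * \<i>) * (2 * of_real pi * (ee (w * x) * k)) * (x / x)"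
    by (simp only: divide_inverse mult_ac mult_1_left)
  also have "\<dots> = - 2 * of_real pi * (ee (w * x) * k)" using assms by simp
  finally show ?thesis .
qed

lemma has_field_derivative_sine_log:
  assumes \<alpha>: "Re \<alpha> > 0" "0 < \<epsilon>" "\<epsilon> < Re (1 / \<alpha>)" and w: "0 < Re w0" "Re w0 < Re \<alpha>"
  shows "(sine_log \<epsilon> \<alpha> has_field_derivative
     (LBINT y. - 2 * of_real pi * (ee (w0 * vline \<epsilon> y) * kern \<alpha> (vline \<epsilon> y)))) (at w0)"
proof -
  obtain C where C: "C > 0" "\<And>y. norm (kern \<alpha> (vline \<epsilon> y)) \<le> C"
    "\<And>y. norm (kern \<alpha> (vline \<epsilon> y)) \<le> C * exp (2 * pi * Re \<alpha> * y)"
    using kern_bound1[OF \<alpha>] by blast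
  define d where "d = min (Re w0) (Re \<alpha> - Re w0) / 2"
  have d: "d > 0" "d < Re w0" "Re w0 < Re \<alpha> - d" using w by (auto simp: d_def min_def field_simps)
  \<comment> \<open>The majorant contains \<open>exp (- 2 * pi * \<epsilon> * Im w)\<close>, so a
    neighbourhood on which it is uniform must bound \<open>Im w\<close> from below as well as keep
    \<open>Re w\<close> away from the edges of the strip.\<close>
  define S where "S = {w. d < Re w} \<inter> {w. Re w < Re \<alpha> - d} \<inter> {w. Im w > Im w0 - 1}"
  have S: "open S" "w0 \<in> S"
    unfolding S_def using d
    by (auto intro!: open_Int open_halfspace_Re_gt open_halfspace_Re_lt open_halfspace_Im_gt)
  have pi2: "2 * pi * d > 0" using d by simp
  show ?thesis
    unfolding sine_log_def[abs_def]
  proof (rule line_integral_has_field_derivative'[OF S, where C = "C / \<epsilon> * exp (- 2 * pi * \<epsilon> * (Im w0 - 1))" and \<delta> = "2 * pi * d"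
       and C' = "2 * pi * C * exp (- 2 * pi * \<epsilon> * Im w0)" and \<delta>' = "2 * pi * d", OF _ _ _ _ pi2 _ pi2])
    show "continuous_on (S \<times> UNIV) (\<lambda>(w, y). \<i> * (ee (w * vline \<epsilon> y) / vline \<epsilon> y * kern \<alpha> (vline \<epsilon> y)))"
      unfolding kern_def case_prod_unfold
      using ee_vline_ne_1[OF \<alpha>] vline_nonzero[OF \<alpha>(2)] by (intro continuous_intros) auto
    show "continuous_on (S \<times> UNIV) (\<lambda>(w, y). - 2 * of_real pi * (ee (w * vline \<epsilon> y) * kern \<alpha> (vline \<epsilon> y)))"
      unfolding kern_def case_prod_unfold
      using ee_vline_ne_1[OF \<alpha>] by (intro continuous_intros) auto
    fix w y
    show "((\<lambda>w. \<i> * (ee (w * vline \<epsilon> y) / vline \<epsilon> y * kern \<alpha> (vline \<epsilon> y))) has_field_derivative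
        - 2 * of_real pi * (ee (w * vline \<epsilon> y) * kern \<alpha> (vline \<epsilon> y))) (at w)"
      by (rule has_field_derivative_ee_div[OF vline_nonzero[OF \<alpha>(2)]])
    show "norm (- 2 * of_real pi * (ee (w0 * vline \<epsilon> y) * kern \<alpha> (vline \<epsilon> y)))
       \<le> 2 * pi * C * exp (- 2 * pi * \<epsilon> * Im w0) * exp (- (2 * pi * d) * \<bar>y\<bar>)"
    proof -
      have "2 * pi * norm (ee (w0 * vline \<epsilon> y) * kern \<alpha> (vline \<epsilon> y))
         \<le> 2 * pi * (C * exp (- 2 * pi * \<epsilon> * Im w0) * exp (- (2 * pi * d) * \<bar>y\<bar>))"
        using d by (intro mult_left_mono ee_kern_bound[OF C(2,3)]) auto
      then show ?thesis by (simp add: norm_mult mult_ac)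
    qed
    assume w: "w \<in> S"
    have "norm (\<i> * (ee (w * vline \<epsilon> y) / vline \<epsilon> y * kern \<alpha> (vline \<epsilon> y)))
       \<le> C / \<epsilon> * exp (- 2 * pi * \<epsilon> * Im w) * exp (- (2 * pi * d) * \<bar>y\<bar>)"
      using w by (intro ee_div_kern_bound[OF \<alpha>(2) C(2,3)]) (auto simp: S_def)
    also have "\<dots> \<le> C / \<epsilon> * exp (- 2 * pi * \<epsilon> * (Im w0 - 1)) * exp (- (2 * pi * d) * \<bar>y\<bar>)"
      using w C \<alpha>(2) by (intro mult_right_mono mult_left_mono) (auto simp: S_def)
    finally show "norm (\<i> * (ee (w * vline \<epsilon> y) / vline \<epsilon> y * kern \<alpha> (vline \<epsilon> y)))
       \<le> C / \<epsilon> * exp (- 2 * pi * \<epsilon> * (Im w0 - 1)) * exp (- (2 * pi * d) * \<bar>y\<bar>)" .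
  qed
qed

lemma ee_tendsto_0:
  assumes "filterlim (\<lambda>n. Im (f n)) at_top F"
  shows "((\<lambda>n. ee (f n)) \<longlongrightarrow> 0) F"
proof -
  have "filterlim (\<lambda>n. 2 * pi * Im (f n)) at_top F"
    by (rule filterlim_tendsto_pos_mult_at_top[OF tendsto_const _ assms]) simp
  then have "filterlim (\<lambda>n. - 2 * pi * Im (f n)) at_bot F"
    by (simp add: filterlim_uminus_at_top)
  then have "((\<lambda>n. exp (- 2 * pi * Im (f n))) \<longlongrightarrow> 0) F"
    by (rule filterlim_compose[OF exp_at_bot])
  then show ?thesis
    by (intro tendsto_norm_zero_cancel[of "\<lambda>n. ee (f n)"]) (simp add: norm_ee)
qed

text \<open>No branch of the logarithm is chosen:
  \<open>exp (- sine_log \<epsilon> \<alpha> w)\<close> times \<open>1 - ee (w / \<alpha>)\<close>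
  has derivative 0 by \<open>fourier_kern\<close>, so it is constant on the strip, and it tends to 1
  as \<open>Im w\<close> grows.\<close>

lemma exp_sine_log:
  assumes \<alpha>: "Re \<alpha> > 0" "0 < \<epsilon>" "\<epsilon> < Re (1 / \<alpha>)" and w: "0 < Re w" "Re w < Re \<alpha>"
  shows "exp (sine_log \<epsilon> \<alpha> w) = 1 - ee (w / \<alpha>)"
proof -
  have \<alpha>0: "\<alpha> \<noteq> 0" using \<alpha> by auto
  define S where "S = {w. 0 < Re w} \<inter> {w. Re w < Re \<alpha>}"
  have S: "convex S" unfolding S_def
    by (intro convex_Int convex_halfspace_Re_gt convex_halfspace_Re_lt)
  define G where "G = (\<lambda>w. exp (- sine_log \<epsilon> \<alpha> w) * (1 - ee (w / \<alpha>)))"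
  have "(G has_field_derivative 0) (at w within S)" if "w \<in> S" for w
  proof -
    have w': "0 < Re w" "Re w < Re \<alpha>" using that by (auto simp: S_def)
    define I where "I = (LBINT y. ee (w * vline \<epsilon> y) * kern \<alpha> (vline \<epsilon> y))"
    have I: "(ee (w / \<alpha>) - 1) * (\<i> * I) = ee (w / \<alpha>) / \<alpha>"
      unfolding I_def by (rule fourier_kern[OF \<alpha> w'])
    have "(sine_log \<epsilon> \<alpha> has_field_derivative - 2 * of_real pi * I) (at w)"
      using has_field_derivative_sine_log[OF \<alpha> w'] by (simp add: I_def)
    then have "(G has_field_derivative exp (- sine_log \<epsilon> \<alpha> w) * (- (2 * of_real pi * \<i> * (1 / \<alpha>) * ee (w / \<alpha>)))
        + exp (- sine_log \<epsilon> \<alpha> w) * (2 * of_real pi * I) * (1 - ee (w / \<alpha>))) (at w)"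
      unfolding G_def using \<alpha>0 by (auto intro!: derivative_eq_intros)
    moreover have "exp (- sine_log \<epsilon> \<alpha> w) * (- (2 * of_real pi * \<i> * (1 / \<alpha>) * ee (w / \<alpha>)))
        + exp (- sine_log \<epsilon> \<alpha> w) * (2 * of_real pi * I) * (1 - ee (w / \<alpha>))
       = - (exp (- sine_log \<epsilon> \<alpha> w) * 2 * of_real pi * \<i>) * (ee (w / \<alpha>) / \<alpha> - (ee (w / \<alpha>) - 1) * (\<i> * I))"
      by (simp add: algebra_simps)
    ultimately have "(G has_field_derivative 0) (at w)" using I by simp
    then show ?thesis by (rule has_field_derivative_at_within)
  qed
  then obtain c where c: "\<And>w. w \<in> S \<Longrightarrow> G w = c"
    using has_field_derivative_zero_constant[OF S] by metis
  obtain C where C: "C > 0" "\<And>y. norm (kern \<alpha> (vline \<epsilon> y)) \<le> C"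
    "\<And>y. norm (kern \<alpha> (vline \<epsilon> y)) \<le> C * exp (2 * pi * Re \<alpha> * y)"
    using kern_bound1[OF \<alpha>] by blast
  \<comment> \<open>The midline is at distance \<open>d\<close> from both edges of the strip, so one
    majorant serves the whole sequence.\<close>
  define d where "d = Re \<alpha> / 2"
  define u where "u = (\<lambda>n::nat. of_real d + \<i> * of_nat n)"
  have u: "u n \<in> S" "Re (u n) = d" "Im (u n) = real n" for n using \<alpha> by (auto simp: u_def S_def d_def)
  have "(\<lambda>n. sine_log \<epsilon> \<alpha> (u n)) \<longlonglongrightarrow> 0"
  proof (rule Lim_null_comparison)
    define J where "J = (LBINT y. exp (- (2 * pi * d) * \<bar>y\<bar>))"
    show "(\<lambda>n. (C / \<epsilon> * J) * exp (- (2 * pi * \<epsilon>) * real n)) \<longlonglongrightarrow> 0"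
      using \<alpha> by (intro exp_neg_mult_nat_LIMSEQ) auto
    have "norm (sine_log \<epsilon> \<alpha> (u n)) \<le> C / \<epsilon> * exp (- 2 * pi * \<epsilon> * Im (u n)) * J" for n
      unfolding sine_log_def J_def using \<alpha> u
      by (intro norm_line_integral_le ee_div_kern_bound[OF \<alpha>(2) C(2,3)]) (auto simp: d_def)
    then show "\<forall>\<^sub>F n in sequentially. norm (sine_log \<epsilon> \<alpha> (u n)) \<le> (C / \<epsilon> * J) * exp (- (2 * pi * \<epsilon>) * real n)"
      by (intro always_eventually) (simp add: u mult_ac)
  qed
  moreover have "(\<lambda>n. ee (u n / \<alpha>)) \<longlonglongrightarrow> 0"
  proof (rule ee_tendsto_0)
    have "Im (u n / \<alpha>) = Im (of_real d / \<alpha>) + Re (1 / \<alpha>) * real n" for n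
      by (simp add: u_def add_divide_distrib Im_divide Re_divide power2_eq_square)
    moreover have "filterlim (\<lambda>n. Im (of_real d / \<alpha>) + Re (1 / \<alpha>) * real n) at_top sequentially"
      using \<alpha> by (intro filterlim_tendsto_add_at_top[OF tendsto_const]
          filterlim_tendsto_pos_mult_at_top[OF tendsto_const _ filterlim_real_sequentially]) linarith
    ultimately show "filterlim (\<lambda>n. Im (u n / \<alpha>)) at_top sequentially" by simp
  qed
  ultimately have "(\<lambda>n. G (u n)) \<longlonglongrightarrow> exp (- 0) * (1 - 0)"
    unfolding G_def by (intro tendsto_intros)
  then have "c = 1" using c u(1) LIMSEQ_unique[of "\<lambda>n. G (u n)" c] by simp
  then have "G w = 1" using c[of w] w by (simp add: S_def)
  then show ?thesis by (simp add: G_def exp_minus field_simps)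
qed

lemma double_sine_log_commute: "double_sine_log \<epsilon> \<alpha> \<beta> w = double_sine_log \<epsilon> \<beta> \<alpha> w"
  by (simp add: double_sine_log_def mult.commute)

lemma kern2_bound:
  assumes "Re \<alpha> > 0" "Re \<beta> > 0" "0 < \<epsilon>" "\<epsilon> < Re (1 / \<alpha>)" "\<epsilon> < Re (1 / \<beta>)"
  obtains C where "C > 0" "\<And>y. norm (kern \<alpha> (vline \<epsilon> y) * kern \<beta> (vline \<epsilon> y)) \<le> C"
    "\<And>y. norm (kern \<alpha> (vline \<epsilon> y) * kern \<beta> (vline \<epsilon> y)) \<le> C * exp (2 * pi * (Re \<alpha> + Re \<beta>) * y)"
proof -
  obtain C where C: "C > 0" "\<And>y. norm (kern \<alpha> (vline \<epsilon> y)) \<le> C"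
    "\<And>y. norm (kern \<alpha> (vline \<epsilon> y)) \<le> C * exp (2 * pi * Re \<alpha> * y)"
    using kern_bound1[OF assms(1,3,4)] by blast
  obtain B where B: "B > 0" "\<And>y. norm (kern \<beta> (vline \<epsilon> y)) \<le> B"
    "\<And>y. norm (kern \<beta> (vline \<epsilon> y)) \<le> B * exp (2 * pi * Re \<beta> * y)"
    using kern_bound1[OF assms(2,3,5)] by blast
  show thesis
  proof (rule that[of "C * B"])
    fix y
    show "norm (kern \<alpha> (vline \<epsilon> y) * kern \<beta> (vline \<epsilon> y)) \<le> C * B"
      unfolding norm_mult using B C by (intro mult_mono) auto
    have "norm (kern \<alpha> (vline \<epsilon> y)) * norm (kern \<beta> (vline \<epsilon> y)) \<le> (C * exp (2 * pi * Re \<alpha> * y)) * (B * exp (2 * pi * Re \<beta> * y))"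
      using B C by (intro mult_mono) auto
    also have "\<dots> = C * B * exp (2 * pi * (Re \<alpha> + Re \<beta>) * y)"
      by (simp add: ring_distribs exp_add)
    finally show "norm (kern \<alpha> (vline \<epsilon> y) * kern \<beta> (vline \<epsilon> y)) \<le> C * B * exp (2 * pi * (Re \<alpha> + Re \<beta>) * y)"
      by (simp only: norm_mult)
  qed (use B C in auto)
qed

text \<open>Adding \<open>\<beta>\<close> to \<open>w\<close> multiplies the integrand by
  \<open>ee (\<beta> x)\<close>, and the difference cancels \<open>kern \<beta>\<close>. The
  condition on \<open>Re w\<close> makes both integrals converge.\<close>

lemma double_sine_log_shift:
  assumes \<alpha>: "Re \<alpha> > 0" and \<beta>: "Re \<beta> > 0" and \<epsilon>: "0 < \<epsilon>" "\<epsilon> < Re (1 / \<alpha>)" "\<epsilon> < Re (1 / \<beta>)"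
    and w: "0 < Re w" "Re w < Re \<alpha>"
  shows "double_sine_log \<epsilon> \<alpha> \<beta> (w + \<beta>) = double_sine_log \<epsilon> \<alpha> \<beta> w + sine_log \<epsilon> \<alpha> w"
proof -
  note ne = ee_vline_ne_1[OF \<alpha> \<epsilon>(1,2)] ee_vline_ne_1[OF \<beta> \<epsilon>(1,3)] vline_nonzero[OF \<epsilon>(1)]
  obtain C where C: "C > 0" "\<And>y. norm (kern \<alpha> (vline \<epsilon> y) * kern \<beta> (vline \<epsilon> y)) \<le> C"
    "\<And>y. norm (kern \<alpha> (vline \<epsilon> y) * kern \<beta> (vline \<epsilon> y)) \<le> C * exp (2 * pi * (Re \<alpha> + Re \<beta>) * y)"
    using kern2_bound[OF \<alpha> \<beta> \<epsilon>] by blast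
  define d where "d = min (Re w) (Re \<alpha> - Re w)"
  have d: "d > 0" "d \<le> Re w" "Re w \<le> Re \<alpha> - d" using w by (auto simp: d_def)
  have int: "integrable lborel (\<lambda>y. \<i> * (ee (v * vline \<epsilon> y) / vline \<epsilon> y * (kern \<alpha> (vline \<epsilon> y) * kern \<beta> (vline \<epsilon> y))))"
    if "d \<le> Re v" "Re v \<le> Re \<alpha> + Re \<beta> - d" for v
  proof (rule integrable_exp_decay)
    show "continuous_on UNIV (\<lambda>y. \<i> * (ee (v * vline \<epsilon> y) / vline \<epsilon> y * (kern \<alpha> (vline \<epsilon> y) * kern \<beta> (vline \<epsilon> y))))"
      unfolding kern_def using ne by (intro continuous_intros) auto
    show "2 * pi * d > 0" using d by simp
  qed (rule ee_div_kern_bound[OF \<epsilon>(1) C(2,3) that])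
  have "double_sine_log \<epsilon> \<alpha> \<beta> (w + \<beta>) - double_sine_log \<epsilon> \<alpha> \<beta> w =
    (LBINT y. \<i> * (ee ((w + \<beta>) * vline \<epsilon> y) / vline \<epsilon> y * (kern \<alpha> (vline \<epsilon> y) * kern \<beta> (vline \<epsilon> y)))
      - \<i> * (ee (w * vline \<epsilon> y) / vline \<epsilon> y * (kern \<alpha> (vline \<epsilon> y) * kern \<beta> (vline \<epsilon> y))))"
    unfolding double_sine_log_def using d \<beta>
    by (intro Bochner_Integration.integral_diff[symmetric] int) auto
  also have "\<dots> = sine_log \<epsilon> \<alpha> w"
    unfolding sine_log_def
  proof (rule Bochner_Integration.integral_cong[OF refl])
    fix y
    have "(ee (\<beta> * vline \<epsilon> y) - 1) * kern \<beta> (vline \<epsilon> y) = 1" using ne(2) by (simp add: kern_def)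
    moreover have "\<i> * (ee ((w + \<beta>) * vline \<epsilon> y) / vline \<epsilon> y * (kern \<alpha> (vline \<epsilon> y) * kern \<beta> (vline \<epsilon> y)))
      - \<i> * (ee (w * vline \<epsilon> y) / vline \<epsilon> y * (kern \<alpha> (vline \<epsilon> y) * kern \<beta> (vline \<epsilon> y)))
      = \<i> * (ee (w * vline \<epsilon> y) / vline \<epsilon> y * kern \<alpha> (vline \<epsilon> y)) * ((ee (\<beta> * vline \<epsilon> y) - 1) * kern \<beta> (vline \<epsilon> y))"
      by (simp only: distrib_right[of w \<beta>] ee_add) (simp add: divide_inverse algebra_simps)
    ultimately show "\<i> * (ee ((w + \<beta>) * vline \<epsilon> y) / vline \<epsilon> y * (kern \<alpha> (vline \<epsilon> y) * kern \<beta> (vline \<epsilon> y)))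
      - \<i> * (ee (w * vline \<epsilon> y) / vline \<epsilon> y * (kern \<alpha> (vline \<epsilon> y) * kern \<beta> (vline \<epsilon> y)))
      = \<i> * (ee (w * vline \<epsilon> y) / vline \<epsilon> y * kern \<alpha> (vline \<epsilon> y))" by simp
  qed
  finally show ?thesis by (simp add: algebra_simps)
qed

text \<open>The line lies to the right of 0, so \<open>ee (w x)\<close> supplies the factor
  \<open>exp (- 2 * pi * \<epsilon> * Im w)\<close>, uniformly away from the edges of the strip.
  This decay normalises the product formula.\<close>

lemma norm_double_sine_log_le:
  assumes "Re \<alpha> > 0" "Re \<beta> > 0" "0 < \<epsilon>" "\<epsilon> < Re (1 / \<alpha>)" "\<epsilon> < Re (1 / \<beta>)" "d > 0"
  obtains K where "\<And>w. d \<le> Re w \<Longrightarrow> Re w \<le> Re \<alpha> + Re \<beta> - d \<Longrightarrow> norm (double_sine_log \<epsilon> \<alpha> \<beta> w) \<le> K * exp (- 2 * pi * \<epsilon> * Im w)"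
proof -
  obtain C where C: "C > 0" "\<And>y. norm (kern \<alpha> (vline \<epsilon> y) * kern \<beta> (vline \<epsilon> y)) \<le> C"
    "\<And>y. norm (kern \<alpha> (vline \<epsilon> y) * kern \<beta> (vline \<epsilon> y)) \<le> C * exp (2 * pi * (Re \<alpha> + Re \<beta>) * y)"
    using kern2_bound[OF assms(1-5)] by blast
  define J where "J = (LBINT y. exp (- (2 * pi * d) * \<bar>y\<bar>))"
  show thesis
  proof (rule that[of "C / \<epsilon> * J"])
    fix w assume "d \<le> Re w" "Re w \<le> Re \<alpha> + Re \<beta> - d"
    then have "norm (double_sine_log \<epsilon> \<alpha> \<beta> w) \<le> C / \<epsilon> * exp (- 2 * pi * \<epsilon> * Im w) * J"
      unfolding double_sine_log_def J_def using assms
      by (intro norm_line_integral_le ee_div_kern_bound[OF assms(3) C(2,3)]) auto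
    then show "norm (double_sine_log \<epsilon> \<alpha> \<beta> w) \<le> C / \<epsilon> * J * exp (- 2 * pi * \<epsilon> * Im w)"
      by (simp add: mult_ac)
  qed
qed

text \<open>The right-hand form compares everywhere continuous functions of \<open>\<beta>\<close>,
  so it visibly defines an open set; for \<open>\<epsilon> \<ge> 0\<close> it also forces
  \<open>Re \<beta> > 0\<close>.\<close>

lemma less_Re_inverse_iff:
  assumes "Re \<beta> > 0"
  shows "\<epsilon> < Re (1 / \<beta>) \<longleftrightarrow> \<epsilon> * (cmod \<beta>)\<^sup>2 < Re \<beta>"
proof -
  have "(Re \<beta>)\<^sup>2 + (Im \<beta>)\<^sup>2 > 0" using assms by (simp add: add_pos_nonneg)
  then show ?thesis by (simp add: Re_divide cmod_power2 pos_less_divide_eq)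
qed

lemma holomorphic2_double_sine_log:
  assumes \<alpha>: "Re \<alpha> > 0" "0 < \<epsilon>" "\<epsilon> < Re (1 / \<alpha>)"
  shows "holomorphic2_on (\<lambda>(w, \<beta>). double_sine_log \<epsilon> \<alpha> \<beta> w)
    {(w, \<beta>). \<epsilon> * (cmod \<beta>)\<^sup>2 < Re \<beta> \<and> 0 < Re w \<and> Re w < Re \<alpha> + Re \<beta>}"
proof -
  let ?T = "{(w, \<beta>). \<epsilon> * (cmod \<beta>)\<^sup>2 < Re \<beta> \<and> 0 < Re w \<and> Re w < Re \<alpha> + Re \<beta>}"
  let ?B = "{\<beta>. \<epsilon> * (cmod \<beta>)\<^sup>2 < Re \<beta>}"
  define F where "F = (\<lambda>w \<beta> y. \<i> * (ee (w * vline \<epsilon> y) / vline \<epsilon> y * (kern \<alpha> (vline \<epsilon> y) * kern \<beta> (vline \<epsilon> y))))"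
  have oB: "open ?B" by (intro open_Collect_less continuous_intros)
  have pos: "Re \<beta> > 0" "\<epsilon> < Re (1 / \<beta>)" if "\<beta> \<in> ?B" for \<beta>
  proof -
    have "0 \<le> \<epsilon> * (cmod \<beta>)\<^sup>2" using \<alpha> by simp
    then show "Re \<beta> > 0" using that by auto
    then show "\<epsilon> < Re (1 / \<beta>)" using that less_Re_inverse_iff by auto
  qed
  note ne = ee_vline_ne_1[OF \<alpha>] vline_nonzero[OF \<alpha>(2)]
  have neB: "ee (\<beta> * vline \<epsilon> y) \<noteq> 1" if "\<beta> \<in> ?B" for \<beta> y
    using ee_vline_ne_1[OF pos(1)[OF that] \<alpha>(2) pos(2)[OF that]] .
  have contF: "continuous_on (X \<times> UNIV) (\<lambda>(p, y). F (fst p) (snd p) y)" if "\<And>p. p \<in> X \<Longrightarrow> snd p \<in> ?B" for X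
    unfolding F_def kern_def case_prod_unfold
    using ne neB[OF that] by (intro continuous_intros) auto
  \<comment> \<open>A majorant valid near each point gives both continuity and differentiability
    under the integral sign; it rests on the uniformity of \<open>kern_bound\<close> in the
    period.\<close>
  have loc: "\<exists>X C d. open X \<and> (w0, \<beta>0) \<in> X \<and> d > 0 \<and> (\<forall>p\<in>X. snd p \<in> ?B) \<and>
      (\<forall>p\<in>X. \<forall>y. norm (F (fst p) (snd p) y) \<le> C * exp (- (2 * pi * d) * \<bar>y\<bar>))"
    if p: "(w0, \<beta>0) \<in> ?T" for w0 \<beta>0
  proof -
    have "\<beta>0 \<in> ?B" using p by simp
    then obtain r where r: "r > 0" "cball \<beta>0 r \<subseteq> ?B" using oB unfolding open_contains_cball by blast
    have sub: "\<beta> \<in> ?B" if "\<beta> \<in> cball \<beta>0 r" for \<beta> using that r(2) by (rule subsetD[rotated])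
    obtain C where C: "C > 0" "\<And>\<beta> y. \<beta> \<in> cball \<beta>0 r \<Longrightarrow> norm (kern \<beta> (vline \<epsilon> y)) \<le> C"
      "\<And>\<beta> y. \<beta> \<in> cball \<beta>0 r \<Longrightarrow> norm (kern \<beta> (vline \<epsilon> y)) \<le> C * exp (2 * pi * Re \<beta> * y)"
      using kern_bound[OF compact_cball pos(1)[OF sub] pos(2)[OF sub] \<alpha>(2), of \<beta>0 r] by blast
    obtain A where A: "A > 0" "\<And>y. norm (kern \<alpha> (vline \<epsilon> y)) \<le> A"
      "\<And>y. norm (kern \<alpha> (vline \<epsilon> y)) \<le> A * exp (2 * pi * Re \<alpha> * y)"
      using kern_bound1[OF \<alpha>] by blast
    define d where "d = min (Re w0) (Re \<alpha> + Re \<beta>0 - Re w0) / 2"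
    have d: "d > 0" "d < Re w0" "Re w0 < Re \<alpha> + Re \<beta>0 - d" using p by (auto simp: d_def min_def field_simps)
    define X where "X = {p. d < Re (fst p)} \<inter> {p. Re (fst p) < Re \<alpha> + Re (snd p) - d} \<inter> {p. Im w0 - 1 < Im (fst p)} \<inter> (UNIV \<times> ball \<beta>0 r)"
    have "open X" unfolding X_def
      by (intro open_Int open_Times open_Collect_less continuous_intros) auto
    moreover have "(w0, \<beta>0) \<in> X" using d r by (simp add: X_def)
    moreover have "snd p \<in> ?B" if "p \<in> X" for p
      using that by (intro sub) (auto simp: X_def)
    moreover have "norm (F (fst p) (snd p) y) \<le> A * C / \<epsilon> * exp (- 2 * pi * \<epsilon> * (Im w0 - 1)) * exp (- (2 * pi * d) * \<bar>y\<bar>)"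
      if p: "p \<in> X" for p y
    proof -
      have b: "snd p \<in> cball \<beta>0 r" using p by (auto simp: X_def)
      have k1: "norm (kern \<alpha> (vline \<epsilon> y) * kern (snd p) (vline \<epsilon> y)) \<le> A * C"
        unfolding norm_mult using A C(1) C(2)[OF b] by (intro mult_mono) auto
      have "norm (kern \<alpha> (vline \<epsilon> y)) * norm (kern (snd p) (vline \<epsilon> y)) \<le> (A * exp (2 * pi * Re \<alpha> * y)) * (C * exp (2 * pi * Re (snd p) * y))"
        using A C(1) C(3)[OF b] by (intro mult_mono) auto
      also have "\<dots> = A * C * exp (2 * pi * (Re \<alpha> + Re (snd p)) * y)"
        by (simp add: ring_distribs exp_add)
      finally have k2: "norm (kern \<alpha> (vline \<epsilon> y) * kern (snd p) (vline \<epsilon> y)) \<le> A * C * exp (2 * pi * (Re \<alpha> + Re (snd p)) * y)"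
        by (simp only: norm_mult)
      have "norm (F (fst p) (snd p) y) \<le> A * C / \<epsilon> * exp (- 2 * pi * \<epsilon> * Im (fst p)) * exp (- (2 * pi * d) * \<bar>y\<bar>)"
        unfolding F_def using p by (intro ee_div_kern_bound[OF \<alpha>(2) k1 k2]) (auto simp: X_def)
      also have "\<dots> \<le> A * C / \<epsilon> * exp (- 2 * pi * \<epsilon> * (Im w0 - 1)) * exp (- (2 * pi * d) * \<bar>y\<bar>)"
        using p A C(1) \<alpha>(2) by (intro mult_right_mono mult_left_mono) (auto simp: X_def)
      finally show ?thesis .
    qed
    ultimately show ?thesis using d(1) by blast
  qed
  show ?thesis
  proof (rule osgood)
    have "?T = {p. \<epsilon> * (cmod (snd p))\<^sup>2 < Re (snd p)} \<inter> {p. 0 < Re (fst p)} \<inter> {p. Re (fst p) < Re \<alpha> + Re (snd p)}" by auto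
    moreover have "open \<dots>" by (intro open_Int open_Collect_less continuous_intros)
    ultimately show "open ?T" by simp
    show "continuous_on ?T (\<lambda>(w, \<beta>). double_sine_log \<epsilon> \<alpha> \<beta> w)"
    proof (intro continuous_at_imp_continuous_on ballI)
      fix p assume "p \<in> ?T"
      then have "(fst p, snd p) \<in> ?T" by simp
      from loc[OF this] obtain X C d where X': "open X" "(fst p, snd p) \<in> X" "d > 0" "\<forall>p\<in>X. snd p \<in> ?B"
        "\<forall>p\<in>X. \<forall>y. norm (F (fst p) (snd p) y) \<le> C * exp (- (2 * pi * d) * \<bar>y\<bar>)" by blast
      then have X: "open X" "p \<in> X" "d > 0" "\<And>p. p \<in> X \<Longrightarrow> snd p \<in> ?B"
        "\<And>p y. p \<in> X \<Longrightarrow> norm (F (fst p) (snd p) y) \<le> C * exp (- (2 * pi * d) * \<bar>y\<bar>)"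
        by (simp, simp, simp, blast, blast)
      have "continuous_on X (\<lambda>p. LBINT y. F (fst p) (snd p) y)"
        by (rule line_integral_continuous[OF contF[OF X(4)] X(5)]) (use X(3) in auto)
      then have "isCont (\<lambda>p. LBINT y. F (fst p) (snd p) y) p"
        using X(1,2) continuous_on_eq_continuous_at by blast
      then show "isCont (\<lambda>(w, \<beta>). double_sine_log \<epsilon> \<alpha> \<beta> w) p"
        by (simp add: F_def double_sine_log_def case_prod_unfold)
    qed
    fix w0 \<beta>0 assume p: "(w0, \<beta>0) \<in> ?T"
    from loc[OF p] obtain X C d where X': "open X" "(w0, \<beta>0) \<in> X" "d > 0" "\<forall>p\<in>X. snd p \<in> ?B"
        "\<forall>p\<in>X. \<forall>y. norm (F (fst p) (snd p) y) \<le> C * exp (- (2 * pi * d) * \<bar>y\<bar>)" by blast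
    then have X: "open X" "(w0, \<beta>0) \<in> X" "d > 0" "\<And>p. p \<in> X \<Longrightarrow> snd p \<in> ?B"
        "\<And>p y. p \<in> X \<Longrightarrow> norm (F (fst p) (snd p) y) \<le> C * exp (- (2 * pi * d) * \<bar>y\<bar>)"
      by (simp, simp, simp, blast, blast)
    have d: "2 * pi * d > 0" using X(3) by simp
    define S1 where "S1 = {w. (w, \<beta>0) \<in> X}"
    define S2 where "S2 = {\<beta>. (w0, \<beta>) \<in> X}"
    have S1: "open S1" "w0 \<in> S1"
    proof -
      have "open ((\<lambda>w. (w, \<beta>0)) -` X)" by (rule open_vimage[OF X(1)]) (intro continuous_intros)
      then show "open S1" by (simp add: S1_def vimage_def)
      show "w0 \<in> S1" using X(2) by (simp add: S1_def)
    qed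
    have S2: "open S2" "\<beta>0 \<in> S2"
    proof -
      have "open ((\<lambda>\<beta>. (w0, \<beta>)) -` X)" by (rule open_vimage[OF X(1)]) (intro continuous_intros)
      then show "open S2" by (simp add: S2_def vimage_def)
      show "\<beta>0 \<in> S2" using X(2) by (simp add: S2_def)
    qed
    have b0: "\<beta>0 \<in> ?B" using p by simp
    have B2: "\<beta> \<in> ?B" if "\<beta> \<in> S2" for \<beta> using X(4)[of "(w0, \<beta>)"] that by (simp add: S2_def)
    \<comment> \<open>Osgood's lemma asks for differentiability alone, here and for
      \<open>\<beta>\<close> below, so the version that leaves the derivative unidentified is the
      fitting one.\<close>
    have "\<exists>g. ((\<lambda>w. LBINT y. F w \<beta>0 y) has_field_derivative g) (at w0)"
    proof (rule line_integral_has_field_derivative[OF S1, where f = "\<lambda>w. F w \<beta>0" and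
          f' = "\<lambda>w y. - 2 * of_real pi * (ee (w * vline \<epsilon> y) * (kern \<alpha> (vline \<epsilon> y) * kern \<beta>0 (vline \<epsilon> y)))", OF _ _ _ _ d])
      show "continuous_on (S1 \<times> UNIV) (\<lambda>(w, y). F w \<beta>0 y)"
        unfolding F_def kern_def case_prod_unfold
        using ne neB[OF b0] by (intro continuous_intros) auto
      show "continuous_on (S1 \<times> UNIV) (\<lambda>(w, y). - 2 * of_real pi * (ee (w * vline \<epsilon> y) * (kern \<alpha> (vline \<epsilon> y) * kern \<beta>0 (vline \<epsilon> y))))"
        unfolding F_def kern_def case_prod_unfold
        using ne neB[OF b0] by (intro continuous_intros) auto
      show "((\<lambda>w. F w \<beta>0 y) has_field_derivative - 2 * of_real pi * (ee (w * vline \<epsilon> y) * (kern \<alpha> (vline \<epsilon> y) * kern \<beta>0 (vline \<epsilon> y)))) (at w)" for w y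
        unfolding F_def by (rule has_field_derivative_ee_div[OF ne(2)])
      show "norm (F w \<beta>0 y) \<le> C * exp (- (2 * pi * d) * \<bar>y\<bar>)" if "w \<in> S1" for w y
        using X(5)[of "(w, \<beta>0)" y] that by (simp add: S1_def)
    qed blast
    then show "(\<lambda>z. case (z, \<beta>0) of (w, \<beta>) \<Rightarrow> double_sine_log \<epsilon> \<alpha> \<beta> w) field_differentiable at w0"
      unfolding field_differentiable_def by (simp add: F_def double_sine_log_def)
    have "\<exists>g. ((\<lambda>\<beta>. LBINT y. F w0 \<beta> y) has_field_derivative g) (at \<beta>0)"
    proof (rule line_integral_has_field_derivative[OF S2, where f = "\<lambda>\<beta>. F w0 \<beta>" and
          f' = "\<lambda>\<beta> y. \<i> * (ee (w0 * vline \<epsilon> y) / vline \<epsilon> y * (kern \<alpha> (vline \<epsilon> y) *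
             (- (2 * of_real pi * \<i> * vline \<epsilon> y * ee (\<beta> * vline \<epsilon> y)) / (ee (\<beta> * vline \<epsilon> y) - 1)\<^sup>2)))", OF _ _ _ _ d])
      show "continuous_on (S2 \<times> UNIV) (\<lambda>(\<beta>, y). F w0 \<beta> y)"
        unfolding F_def kern_def case_prod_unfold
        using ne neB[OF B2] by (intro continuous_intros) auto
      show "continuous_on (S2 \<times> UNIV) (\<lambda>(\<beta>, y). \<i> * (ee (w0 * vline \<epsilon> y) / vline \<epsilon> y * (kern \<alpha> (vline \<epsilon> y) *
             (- (2 * of_real pi * \<i> * vline \<epsilon> y * ee (\<beta> * vline \<epsilon> y)) / (ee (\<beta> * vline \<epsilon> y) - 1)\<^sup>2))))"
        unfolding kern_def case_prod_unfold
        using ne neB[OF B2] by (intro continuous_intros) auto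
      fix \<beta> y assume b: "\<beta> \<in> S2"
      have "((\<lambda>\<beta>. kern \<beta> (vline \<epsilon> y)) has_field_derivative
         - (2 * of_real pi * \<i> * vline \<epsilon> y * ee (\<beta> * vline \<epsilon> y)) / (ee (\<beta> * vline \<epsilon> y) - 1)\<^sup>2) (at \<beta>)"
        unfolding kern_def using neB[OF B2[OF b], of y]
        by (auto intro!: derivative_eq_intros simp: power2_eq_square)
      then show "((\<lambda>\<beta>. F w0 \<beta> y) has_field_derivative \<i> * (ee (w0 * vline \<epsilon> y) / vline \<epsilon> y * (kern \<alpha> (vline \<epsilon> y) *
             (- (2 * of_real pi * \<i> * vline \<epsilon> y * ee (\<beta> * vline \<epsilon> y)) / (ee (\<beta> * vline \<epsilon> y) - 1)\<^sup>2)))) (at \<beta>)"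
        unfolding F_def by (intro DERIV_cmult)
      show "norm (F w0 \<beta> y) \<le> C * exp (- (2 * pi * d) * \<bar>y\<bar>)"
        using X(5)[of "(w0, \<beta>)" y] b by (simp add: S2_def)
    qed blast
    then show "(\<lambda>z. case (w0, z) of (w, \<beta>) \<Rightarrow> double_sine_log \<epsilon> \<alpha> \<beta> w) field_differentiable at \<beta>0"
      unfolding field_differentiable_def by (simp add: F_def double_sine_log_def)
  qed
qed

lemma norm_ee_less_1: "Im a > 0 \<Longrightarrow> norm (ee a) < 1"
  using mult_pos_pos[of "2 * pi" "Im a"] by (simp add: norm_ee)

lemma Im_inverse_neg:
  assumes "Im u > 0"
  shows "Im (- inverse u) > 0"
proof -
  have "(Re u)\<^sup>2 + (Im u)\<^sup>2 > 0" using assms by (simp add: add_nonneg_pos)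
  then show ?thesis using assms by simp
qed

text \<open>\<open>E = exp double_sine_log\<close> satisfies \<open>E (w + \<beta>) = E w * (1 - ee (w/\<alpha>))\<close> and the same with the periods exchanged.
  Hence \<open>D = E * qpoch (ee (w/\<alpha>)) (ee (\<beta>/\<alpha>))\<close> is \<open>\<beta>\<close>-periodic, so it extends from the strip to the
  plane, and iterating \<open>D (w + \<alpha>) = D w * (1 - ee (w/\<beta>))\<close> downwards evaluates it, because \<open>D\<close> tends
  to 1 in the direction \<open>-\<alpha>\<close>.\<close>

lemma exp_double_sine_log_product:
  assumes \<alpha>: "Re \<alpha> > 0" and \<beta>: "Re \<beta> > 0" and \<epsilon>: "0 < \<epsilon>" "\<epsilon> < Re (1 / \<alpha>)" "\<epsilon> < Re (1 / \<beta>)"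
    and im: "Im (\<beta> / \<alpha>) > 0" and w: "0 < Re w" "Re w < Re \<alpha> + Re \<beta>"
  shows "exp (double_sine_log \<epsilon> \<alpha> \<beta> w) * qpoch (ee (w / \<alpha>)) (ee (\<beta> / \<alpha>)) = qpoch (ee ((w - \<alpha>) / \<beta>)) (ee (- (\<alpha> / \<beta>)))"
proof -
  have nz: "\<alpha> \<noteq> 0" "\<beta> \<noteq> 0" using \<alpha> \<beta> by auto
  define qa where "qa = ee (\<beta> / \<alpha>)"
  define qb where "qb = ee (- (\<alpha> / \<beta>))"
  have im': "Im (- (\<alpha> / \<beta>)) > 0" using Im_inverse_neg[OF im] by simp
  have qa: "norm qa < 1" unfolding qa_def by (rule norm_ee_less_1[OF im])
  have qb: "norm qb < 1" unfolding qb_def by (rule norm_ee_less_1[OF im'])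
  define D where "D = (\<lambda>w. exp (double_sine_log \<epsilon> \<alpha> \<beta> w) * qpoch (ee (w / \<alpha>)) qa)"
  have per: "D (v + \<beta>) = D v" if "0 < Re v" "Re v < Re \<alpha>" for v
  proof -
    have "exp (double_sine_log \<epsilon> \<alpha> \<beta> (v + \<beta>)) = exp (double_sine_log \<epsilon> \<alpha> \<beta> v) * (1 - ee (v / \<alpha>))"
      unfolding double_sine_log_shift[OF \<alpha> \<beta> \<epsilon> that] exp_add exp_sine_log[OF \<alpha> \<epsilon>(1,2) that] ..
    moreover have "ee ((v + \<beta>) / \<alpha>) = qa * ee (v / \<alpha>)"
      by (simp add: add_divide_distrib ee_add qa_def)
    ultimately show ?thesis
      unfolding D_def using qpoch_shift[OF qa, of "ee (v / \<alpha>)"] by simp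
  qed
  have shift: "D (v + \<alpha>) = D v * (1 - ee (v / \<beta>))" if "0 < Re v" "Re v < Re \<beta>" for v
  proof -
    have "exp (double_sine_log \<epsilon> \<alpha> \<beta> (v + \<alpha>)) = exp (double_sine_log \<epsilon> \<alpha> \<beta> v) * (1 - ee (v / \<beta>))"
      unfolding double_sine_log_commute[of \<epsilon> \<alpha> \<beta>] double_sine_log_shift[OF \<beta> \<alpha> \<epsilon>(1,3,2) that] exp_add exp_sine_log[OF \<beta> \<epsilon>(1,3) that] ..
    moreover have "ee ((v + \<alpha>) / \<alpha>) = ee (v / \<alpha>)"
      using nz by (simp add: add_divide_distrib ee_add)
    ultimately show ?thesis unfolding D_def by simp
  qed
  define strip where "strip = {v. 0 < Re v \<and> Re v < Re \<alpha> + Re \<beta>}"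
  have ostrip: "open strip"
  proof -
    have "strip = {v. 0 < Re v} \<inter> {v. Re v < Re \<alpha> + Re \<beta>}" by (auto simp: strip_def)
    then show ?thesis by (simp add: open_Int open_halfspace_Re_gt open_halfspace_Re_lt)
  qed
  have pern: "D (v + of_nat n * \<beta>) = D v" if "v \<in> strip" "v + of_nat n * \<beta> \<in> strip" for v n
    using that(2)
  proof (induction n)
    case (Suc n)
    have "0 \<le> real n * Re \<beta>" using \<beta> by simp
    then have *: "0 < Re (v + of_nat n * \<beta>)" "Re (v + of_nat n * \<beta>) < Re \<alpha>"
      using Suc.prems that(1) by (auto simp: strip_def algebra_simps)
    then have "v + of_nat n * \<beta> \<in> strip" using \<beta> by (simp add: strip_def)
    with Suc.IH per[OF *] show ?case by (simp add: algebra_simps)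
  qed simp
  have peri: "D v = D v'" if "v \<in> strip" "v' \<in> strip" "v' = v + of_int k * \<beta>" for v v' k
  proof (cases "k \<ge> 0")
    case True
    then show ?thesis using pern[of v "nat k"] that by simp
  next
    case False
    then have "v = v' + of_nat (nat (- k)) * \<beta>" using that(3) by simp
    with pern[OF that(2), of "nat (- k)"] that(1) show ?thesis by metis
  qed
  \<comment> \<open>The band \<open>\<rho> \<le> Re v \<le> \<rho> + Re \<beta>\<close> has the
    width of one period and stays at distance \<open>\<rho>\<close> from both edges of the strip, so
    the decay estimate is uniform on it.\<close>
  define \<rho> where "\<rho> = Re \<alpha> / 2"
  have \<rho>: "\<rho> > 0" using \<alpha> by (simp add: \<rho>_def)
  define rep where "rep = (\<lambda>v. v - of_int \<lfloor>(Re v - \<rho>) / Re \<beta>\<rfloor> * \<beta>)"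
  have rep: "\<rho> \<le> Re (rep v)" "Re (rep v) \<le> \<rho> + Re \<beta>" "rep v \<in> strip" for v
  proof -
    define k where "k = \<lfloor>(Re v - \<rho>) / Re \<beta>\<rfloor>"
    have "of_int k \<le> (Re v - \<rho>) / Re \<beta>" "(Re v - \<rho>) / Re \<beta> < of_int k + 1"
      unfolding k_def by linarith+
    then have "of_int k * Re \<beta> \<le> Re v - \<rho>" "Re v - \<rho> < (of_int k + 1) * Re \<beta>"
      using \<beta> by (simp_all add: pos_le_divide_eq pos_divide_less_eq)
    moreover have "Re (rep v) = Re v - of_int k * Re \<beta>" by (simp add: rep_def k_def)
    ultimately show "\<rho> \<le> Re (rep v)" "Re (rep v) \<le> \<rho> + Re \<beta>" by (simp_all add: algebra_simps)
    then show "rep v \<in> strip" using \<rho> \<alpha> by (simp add: strip_def \<rho>_def)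
  qed
  \<comment> \<open>The floor in \<open>rep\<close> jumps, but periodicity makes every
    representative in the strip give the same value; hence \<open>D'\<close> is continuous.\<close>
  define D' where "D' = (\<lambda>v. D (rep v))"
  have D': "D' v = D (v - of_int k * \<beta>)" if "v - of_int k * \<beta> \<in> strip" for v k
    unfolding D'_def
    by (rule peri[OF rep(3) that, of _ "\<lfloor>(Re v - \<rho>) / Re \<beta>\<rfloor> - k"]) (simp add: rep_def algebra_simps)
  have "isCont D v" if "v \<in> strip" for v
  proof -
    have "(v, \<beta>) \<in> {(w, \<beta>). \<epsilon> * (cmod \<beta>)\<^sup>2 < Re \<beta> \<and> 0 < Re w \<and> Re w < Re \<alpha> + Re \<beta>}"
      using that \<epsilon>(3) less_Re_inverse_iff[OF \<beta>] by (simp add: strip_def)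
    from holomorphic2_slice1[OF holomorphic2_double_sine_log[OF \<alpha> \<epsilon>(1,2)] this]
    have 1: "isCont (double_sine_log \<epsilon> \<alpha> \<beta>) v" by (simp add: field_differentiable_imp_continuous_at)
    have "(\<lambda>z. qpoch z qa) field_differentiable at (ee (v / \<alpha>))"
      using holomorphic2_slice1[OF holomorphic2_qpoch, of "ee (v / \<alpha>)" qa] qa by simp
    then have 2: "isCont (\<lambda>z. qpoch z qa) (ee (v / \<alpha>))" by (rule field_differentiable_imp_continuous_at)
    have 3: "isCont (\<lambda>v. ee (v / \<alpha>)) v"
      unfolding ee_def using nz by (intro continuous_intros)
    show ?thesis unfolding D_def
      by (intro continuous_intros 1 isCont_o2[OF 3 2])
  qed
  have contD': "isCont D' v" for v
  proof -
    define k where "k = \<lfloor>(Re v - \<rho>) / Re \<beta>\<rfloor>"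
    have v: "v - of_int k * \<beta> \<in> strip" using rep(3)[of v] by (simp add: rep_def k_def)
    have "open ((\<lambda>v. v - of_int k * \<beta>) -` strip)"
      by (rule open_vimage[OF ostrip]) (intro continuous_intros)
    then have "\<forall>\<^sub>F u in nhds v. u \<in> (\<lambda>v. v - of_int k * \<beta>) -` strip"
      using v by (intro eventually_nhds_in_open) auto
    then have "\<forall>\<^sub>F u in nhds v. D' u = D (u - of_int k * \<beta>)"
      by eventually_elim (auto intro: D')
    then have "isCont D' v = isCont (\<lambda>u. D (u - of_int k * \<beta>)) v" by (rule isCont_cong)
    moreover have "isCont (\<lambda>u. D (u - of_int k * \<beta>)) v"
      by (rule isCont_o2[where f = "\<lambda>u. u - of_int k * \<beta>"])
         (use \<open>\<And>v. v \<in> strip \<Longrightarrow> isCont D v\<close> v in \<open>auto intro!: continuous_intros\<close>)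
    ultimately show ?thesis by simp
  qed
  \<comment> \<open>A representative \<open>u\<close> with \<open>0 < Re u < Re \<beta>\<close> puts
    both \<open>u\<close> and \<open>u + \<alpha>\<close> in the strip. It exists unless
    \<open>Re v\<close> is a multiple of \<open>Re \<beta>\<close>; those lines are reached by
    continuity.\<close>
  have step_off: "D' (v + \<alpha>) = D' v * (1 - ee (v / \<beta>))" if v: "Re v / Re \<beta> \<notin> \<int>" for v
  proof -
    define k where "k = \<lfloor>Re v / Re \<beta>\<rfloor>"
    define u where "u = v - of_int k * \<beta>"
    have "of_int k \<noteq> Re v / Re \<beta>" using v by (metis Ints_of_int)
    moreover have "of_int k \<le> Re v / Re \<beta>" "Re v / Re \<beta> < of_int k + 1" unfolding k_def by linarith+
    ultimately have "of_int k < Re v / Re \<beta>" "Re v / Re \<beta> < of_int k + 1" by auto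
    then have "of_int k * Re \<beta> < Re v" "Re v < (of_int k + 1) * Re \<beta>"
      using \<beta> by (simp_all add: pos_less_divide_eq pos_divide_less_eq)
    then have u: "0 < Re u" "Re u < Re \<beta>" by (simp_all add: u_def algebra_simps)
    have "D' v = D u" unfolding u_def using u \<alpha> by (intro D') (simp add: strip_def u_def)
    moreover have "D' (v + \<alpha>) = D (u + \<alpha>)"
    proof -
      have "u + \<alpha> = (v + \<alpha>) - of_int k * \<beta>" by (simp add: u_def)
      moreover have "u + \<alpha> \<in> strip" using u \<alpha> by (simp add: strip_def)
      ultimately show ?thesis using D' by metis
    qed
    moreover have "ee (u / \<beta>) = ee (v / \<beta>)"
      using nz ee_add_of_int[of "v / \<beta>" "- k"] by (simp add: u_def diff_divide_distrib)
    ultimately show ?thesis using shift[OF u] by simp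
  qed
  have step: "D' (v + \<alpha>) = D' v * (1 - ee (v / \<beta>))" for v
  proof (cases "Re v / Re \<beta> \<in> \<int>")
    case True
    \<comment> \<open>The offset is a fraction of \<open>Re \<beta>\<close> strictly between 0 and
      1, so no term of the sequence lies on an excluded line.\<close>
    define s where "s = (\<lambda>n::nat. v + of_real (Re \<beta> * (1 / (real n + 2))))"
    have inv: "(\<lambda>n. 1 / (real n + 2)) \<longlonglongrightarrow> 0"
      using LIMSEQ_ignore_initial_segment[OF lim_1_over_n, of 2] by (simp add: add.commute)
    have "(\<lambda>n. of_real (Re \<beta> * (1 / (real n + 2))) :: complex) \<longlonglongrightarrow> of_real (Re \<beta> * 0)"
      by (intro tendsto_intros inv)
    then have lim: "s \<longlonglongrightarrow> v" unfolding s_def by (auto intro: tendsto_eq_intros)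
    have "D' (s n + \<alpha>) = D' (s n) * (1 - ee (s n / \<beta>))" for n
    proof (rule step_off)
      obtain m :: int where m: "Re v / Re \<beta> = of_int m" using True by (auto elim: Ints_cases)
      have eq: "Re (s n) / Re \<beta> = of_int m + 1 / (real n + 2)"
        using \<beta> m by (simp add: s_def add_divide_distrib)
      show "Re (s n) / Re \<beta> \<notin> \<int>"
      proof
        assume "Re (s n) / Re \<beta> \<in> \<int>"
        then obtain j :: int where "Re (s n) / Re \<beta> = of_int j" by (auto elim: Ints_cases)
        with eq have "of_int (j - m) = 1 / (real n + 2)" by simp
        moreover have "0 < 1 / (real n + 2)" "1 / (real n + 2) < 1" by auto
        ultimately have "0 < real_of_int (j - m)" "real_of_int (j - m) < 1" by auto
        then have "0 < j - m" "j - m < 1" by linarith+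
        then show False by linarith
      qed
    qed
    moreover have "(\<lambda>n. D' (s n + \<alpha>)) \<longlonglongrightarrow> D' (v + \<alpha>)"
      by (rule isCont_tendsto_compose[OF contD']) (intro tendsto_intros lim)
    moreover have "(\<lambda>n. D' (s n) * (1 - ee (s n / \<beta>))) \<longlonglongrightarrow> D' v * (1 - ee (v / \<beta>))"
      unfolding ee_def using nz
      by (intro tendsto_intros lim isCont_tendsto_compose[OF contD']) auto
    ultimately show ?thesis using LIMSEQ_unique by simp
  qed (rule step_off)
  have iter: "D' v = D' (v - of_nat n * \<alpha>) * (\<Prod>i<n. 1 - qb ^ i * ee ((v - \<alpha>) / \<beta>))" for v n
  proof (induction n)
    case (Suc n)
    have "D' (v - of_nat n * \<alpha>) = D' (v - of_nat (Suc n) * \<alpha>) * (1 - ee ((v - of_nat (Suc n) * \<alpha>) / \<beta>))"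
      using step[of "v - of_nat (Suc n) * \<alpha>"] by (simp add: algebra_simps)
    moreover have "ee ((v - of_nat (Suc n) * \<alpha>) / \<beta>) = qb ^ n * ee ((v - \<alpha>) / \<beta>)"
    proof -
      have "(v - of_nat (Suc n) * \<alpha>) / \<beta> = of_nat n * (- (\<alpha> / \<beta>)) + (v - \<alpha>) / \<beta>"
        using nz by (simp add: field_simps)
      then show ?thesis by (simp only: ee_add ee_of_nat_mult qb_def)
    qed
    ultimately show ?case using Suc by (simp add: mult_ac)
  qed simp
  define r where "r = (\<lambda>n. rep (w - of_nat n * \<alpha>))"
  \<comment> \<open>Reduction modulo \<open>\<beta>\<close> changes \<open>r n / \<beta>\<close> by
    an integer, so its imaginary part grows linearly. As \<open>Re (r n)\<close> stays bounded,
    \<open>Im (r n)\<close> and \<open>Im (r n / \<alpha>)\<close> tend to infinity too.\<close>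
  have Im_rb: "Im (r n / \<beta>) = Im (w / \<beta>) + real n * Im (- (\<alpha> / \<beta>))" for n
  proof -
    obtain k :: int where k: "r n = w - of_nat n * \<alpha> - of_int k * \<beta>" by (auto simp: r_def rep_def)
    have "r n / \<beta> = w / \<beta> + of_real (real n) * (- (\<alpha> / \<beta>)) - of_real (of_int k)"
      unfolding k using nz by (simp add: field_simps)
    then show ?thesis by (simp only: minus_complex.simps plus_complex.simps times_complex.simps
       Re_complex_of_real Im_complex_of_real mult_zero_left diff_zero add_0_right)
  qed
  have lim_rb: "filterlim (\<lambda>n. Im (r n / \<beta>)) at_top sequentially"
    unfolding Im_rb using im'
    by (intro filterlim_tendsto_add_at_top[OF tendsto_const]
         filterlim_at_top_mult_tendsto_pos[OF tendsto_const _ filterlim_real_sequentially])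
  define B where "B = \<rho> + Re \<beta>"
  have Re_r: "\<bar>Re (r n)\<bar> \<le> B" for n using rep(1,2)[of "w - of_nat n * \<alpha>"] \<rho> by (simp add: r_def B_def)
  have lim_r: "filterlim (\<lambda>n. Im (r n)) at_top sequentially"
  proof (rule filterlim_at_top_mono)
    define c where "c = (cmod \<beta>)\<^sup>2 / Re \<beta>"
    have c: "c > 0" using \<beta> nz by (simp add: c_def)
    show "filterlim (\<lambda>n. - (\<bar>Im \<beta>\<bar> * B / Re \<beta>) + c * Im (r n / \<beta>)) at_top sequentially"
      using c by (intro filterlim_tendsto_add_at_top[OF tendsto_const]
         filterlim_tendsto_pos_mult_at_top[OF tendsto_const _ lim_rb])
    show "\<forall>\<^sub>F n in sequentially. - (\<bar>Im \<beta>\<bar> * B / Re \<beta>) + c * Im (r n / \<beta>) \<le> Im (r n)"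
    proof (intro always_eventually allI)
      fix n
      define u where "u = r n / \<beta>"
      have ru: "r n = \<beta> * u" using nz by (simp add: u_def)
      have Rr: "Re (r n) = Re \<beta> * Re u - Im \<beta> * Im u" and Ir: "Im (r n) = Re \<beta> * Im u + Im \<beta> * Re u"
        by (simp_all add: ru)
      have "Im (r n) * Re \<beta> = (cmod \<beta>)\<^sup>2 * Im u + Im \<beta> * Re (r n)"
        unfolding Rr Ir cmod_power2 by (simp add: algebra_simps power2_eq_square)
      moreover have "\<bar>Im \<beta> * Re (r n)\<bar> \<le> \<bar>Im \<beta>\<bar> * B"
        unfolding abs_mult using Re_r by (intro mult_left_mono) auto
      ultimately have "(cmod \<beta>)\<^sup>2 * Im u - \<bar>Im \<beta>\<bar> * B \<le> Im (r n) * Re \<beta>" by linarith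
      then show "- (\<bar>Im \<beta>\<bar> * B / Re \<beta>) + c * Im (r n / \<beta>) \<le> Im (r n)"
        unfolding u_def[symmetric] c_def using \<beta> by (simp add: field_simps)
    qed
  qed
  have lim_ra: "filterlim (\<lambda>n. Im (r n / \<alpha>)) at_top sequentially"
  proof (rule filterlim_at_top_mono)
    have pos: "Re (1 / \<alpha>) > 0" using \<epsilon> by linarith
    show "filterlim (\<lambda>n. - (\<bar>Im (1 / \<alpha>)\<bar> * B) + Re (1 / \<alpha>) * Im (r n)) at_top sequentially"
      using pos by (intro filterlim_tendsto_add_at_top[OF tendsto_const]
         filterlim_tendsto_pos_mult_at_top[OF tendsto_const _ lim_r])
    show "\<forall>\<^sub>F n in sequentially. - (\<bar>Im (1 / \<alpha>)\<bar> * B) + Re (1 / \<alpha>) * Im (r n) \<le> Im (r n / \<alpha>)"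
    proof (intro always_eventually allI)
      fix n
      have "r n / \<alpha> = (1 / \<alpha>) * r n" by simp
      then have "Im (r n / \<alpha>) = Re (1 / \<alpha>) * Im (r n) + Im (1 / \<alpha>) * Re (r n)"
        by (simp only: times_complex.simps)
      moreover have "\<bar>Im (1 / \<alpha>) * Re (r n)\<bar> \<le> \<bar>Im (1 / \<alpha>)\<bar> * B"
        unfolding abs_mult using Re_r by (intro mult_left_mono) auto
      ultimately show "- (\<bar>Im (1 / \<alpha>)\<bar> * B) + Re (1 / \<alpha>) * Im (r n) \<le> Im (r n / \<alpha>)" by linarith
    qed
  qed
  obtain K where K: "\<And>v. \<rho> \<le> Re v \<Longrightarrow> Re v \<le> Re \<alpha> + Re \<beta> - \<rho> \<Longrightarrow> norm (double_sine_log \<epsilon> \<alpha> \<beta> v) \<le> K * exp (- 2 * pi * \<epsilon> * Im v)"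
    using norm_double_sine_log_le[OF \<alpha> \<beta> \<epsilon> \<rho>] by blast
  have "(\<lambda>n. double_sine_log \<epsilon> \<alpha> \<beta> (r n)) \<longlonglongrightarrow> 0"
  proof (rule Lim_null_comparison)
    show "\<forall>\<^sub>F n in sequentially. norm (double_sine_log \<epsilon> \<alpha> \<beta> (r n)) \<le> K * exp (- 2 * pi * \<epsilon> * Im (r n))"
      using rep(1,2) by (intro always_eventually allI K) (simp_all add: r_def \<rho>_def)
    have "filterlim (\<lambda>n. (2 * pi * \<epsilon>) * Im (r n)) at_top sequentially"
      using \<epsilon> by (intro filterlim_tendsto_pos_mult_at_top[OF tendsto_const _ lim_r]) auto
    then have "filterlim (\<lambda>n. - 2 * pi * \<epsilon> * Im (r n)) at_bot sequentially"
      by (simp add: filterlim_uminus_at_top)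
    then have "(\<lambda>n. exp (- 2 * pi * \<epsilon> * Im (r n))) \<longlonglongrightarrow> 0"
      by (rule filterlim_compose[OF exp_at_bot])
    from tendsto_mult[OF tendsto_const this, of K]
    show "(\<lambda>n. K * exp (- 2 * pi * \<epsilon> * Im (r n))) \<longlonglongrightarrow> 0" by simp
  qed
  then have "(\<lambda>n. exp (double_sine_log \<epsilon> \<alpha> \<beta> (r n)) * qpoch (ee (r n / \<alpha>)) qa) \<longlonglongrightarrow> exp 0 * 1"
    by (intro tendsto_mult tendsto_exp qpoch_tendsto_1[OF qa] ee_tendsto_0 lim_ra)
  then have "(\<lambda>n. D' (w - of_nat n * \<alpha>)) \<longlonglongrightarrow> 1" by (simp add: D'_def D_def r_def)
  from tendsto_mult[OF this qpoch_LIMSEQ[OF qb, of "ee ((w - \<alpha>) / \<beta>)"]]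
  have "(\<lambda>n. D' w) \<longlonglongrightarrow> qpoch (ee ((w - \<alpha>) / \<beta>)) qb" by (simp add: iter[symmetric])
  then have "D' w = qpoch (ee ((w - \<alpha>) / \<beta>)) qb" by (simp add: LIMSEQ_const_iff)
  moreover have "D' w = D w" using D'[of w 0] w by (simp add: strip_def)
  ultimately show ?thesis by (simp add: D_def qa_def qb_def)
qed

section \<open>The $q$-difference equation\<close>

text \<open>For \<open>norm q < 1\<close> the zeros are the powers \<open>q powi (- i)\<close>; for
  \<open>norm q > 1\<close> the product being inverted vanishes at \<open>q powi (i + 1)\<close>.
  One spiral covers both.\<close>

lemma qpoch_nonzero:
  assumes q: "q \<noteq> 0" "norm q \<noteq> 1" and x: "\<And>k::int. x \<noteq> q powi k"
  shows "qpoch x q \<noteq> 0"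
proof (cases "norm q < 1")
  case True
  have "q ^ i * x \<noteq> 1" for i
    using x[of "- int i"] q by (simp add: power_int_minus field_simps)
  then show ?thesis using True by (simp add: qpoch_eq_0_iff)
next
  case False
  then have q1: "norm q > 1" using q by linarith
  have "norm (inverse q) < 1" using q1 by (simp add: norm_inverse inverse_less_1_iff)
  moreover have "inverse q ^ i * (inverse q * x) \<noteq> 1" for i
    using x[of "int (Suc i)"] q unfolding power_int_of_nat by (simp add: power_inverse field_simps)
  ultimately show ?thesis by (simp add: qpoch_outside[OF q1] qpoch_eq_0_iff)
qed

lemma qpoch_self_nonzero:
  assumes "q \<noteq> 0" "norm q \<noteq> 1"
  shows "qpoch_self q \<noteq> 0"
proof -
  have *: "qpoch p p \<noteq> 0" if p: "norm p < 1" for p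
  proof
    assume "qpoch p p = 0"
    then obtain i where "p ^ i * p = 1" using qpoch_eq_0_iff[OF p] by blast
    then have "norm p ^ Suc i = 1" by (metis norm_one norm_power power_Suc2)
    moreover have "norm p ^ Suc i < 1" using p by (simp add: power_less_one_iff del: power_Suc)
    ultimately show False by simp
  qed
  show ?thesis
  proof (cases "norm q < 1")
    case False
    then have "norm (inverse q) < 1" using assms by (simp add: norm_inverse inverse_less_1_iff)
    then show ?thesis using False * by (simp add: qpoch_self_def)
  qed (use * in \<open>simp add: qpoch_self_def\<close>)
qed

lemma generic_mult:
  assumes "generic t q" shows "generic (q * t) q"
  unfolding generic_def
proof (intro conjI allI notI)
  fix k :: int assume "q * t = q powi k"
  then have "t = q powi (k - 1)" using assms by (auto simp: generic_def power_int_diff field_simps)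
  then show False using assms by (auto simp: generic_def)
qed (use assms in \<open>auto simp: generic_def\<close>)

lemma generic_inverse:
  assumes "generic t q" shows "generic (inverse t) q"
  unfolding generic_def
proof (intro conjI allI notI)
  fix k :: int assume "inverse t = q powi k"
  then have "t = q powi (- k)" by (metis inverse_inverse_eq power_int_minus)
  then show False using assms by (auto simp: generic_def)
qed (use assms in \<open>auto simp: generic_def\<close>)

lemma qpoch_generic_nonzero: "generic t q \<Longrightarrow> qpoch t q \<noteq> 0"
  by (rule qpoch_nonzero) (auto simp: generic_def)

lemma f0_nonzero: "generic t q \<Longrightarrow> f0 t q \<noteq> 0"
  unfolding f0_def by (intro qpoch_generic_nonzero generic_mult)

lemma f0_outside:
  assumes "norm q > 1"
  shows "f0 t q = inverse (qpoch t (inverse q))"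
proof -
  have "q \<noteq> 0" using assms by auto
  then show ?thesis unfolding f0_def qpoch_outside[OF assms] by (simp add: mult.assoc[symmetric])
qed

lemma f0_shift:
  assumes "generic t q"
  shows "(1 - q * t) * f0 (q * t) q = f0 t q"
proof (cases "norm q < 1")
  case True
  then show ?thesis using qpoch_shift[of q "q * t"] by (simp add: f0_def)
next
  case False
  then have q1: "norm q > 1" using assms by (auto simp: generic_def)
  then have "q \<noteq> 0" by auto
  have "norm (inverse q) < 1" using q1 by (simp add: norm_inverse inverse_less_1_iff)
  from qpoch_shift[OF this, of "q * t"]
  have "qpoch (q * t) (inverse q) = (1 - q * t) * qpoch t (inverse q)"
    using \<open>q \<noteq> 0\<close> by (simp add: mult.assoc[symmetric])
  \<comment> \<open>Outside the unit disc \<open>f0\<close> is a reciprocal, so the factor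
    \<open>1 - q * t\<close> has to be cancelled; genericity of \<open>q * t\<close> excludes the
    exponent 0.\<close>
  moreover have "q * t \<noteq> 1" using assms generic_mult[OF assms] by (auto simp: generic_def) (metis power_int_0_right)
  ultimately show ?thesis by (simp add: f0_outside[OF q1])
qed

text \<open>The other two factors of \<open>theta\<close> form the denominator; off the spiral they
  are nonzero and cancel.\<close>

lemma g1_eq_f0:
  assumes "generic t q" shows "g1 t q = f0 t q"
proof -
  have "qpoch (inverse t) q \<noteq> 0" by (rule qpoch_generic_nonzero[OF generic_inverse[OF assms]])
  moreover have "qpoch_self q \<noteq> 0" using assms by (intro qpoch_self_nonzero) (auto simp: generic_def)
  ultimately show ?thesis by (simp add: g1_def theta_def f0_def)
qed

section \<open>One-by-one matrices\<close>

lemma matrix1_mult: "(\<chi> i j. a :: complex ^ 1 ^ 1) ** (\<chi> i j. b) = (\<chi> i j. a * b)"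
  by (simp add: matrix_matrix_mult_def vec_eq_iff sum_1)

lemma mat_eq_matrix1: "(mat a :: complex ^ 1 ^ 1) = (\<chi> i j. a)"
  by (simp add: mat_def vec_eq_iff forall_1)

lemma invertible_matrix1:
  assumes "a \<noteq> (0::complex)"
  shows "invertible ((\<chi> i j. a) :: complex ^ 1 ^ 1)"
  unfolding invertible_def
  by (rule exI[of _ "\<chi> i j. inverse a"]) (simp add: matrix1_mult mat_eq_matrix1 assms)

text \<open>\<open>matrix_inv\<close> is a choice among two-sided inverses, so it is identified by
  multiplying with the explicit inverse from the left.\<close>

lemma matrix_inv_matrix1:
  assumes "a \<noteq> (0::complex)"
  shows "matrix_inv ((\<chi> i j. a) :: complex ^ 1 ^ 1) = (\<chi> i j. inverse a)"
proof -
  let ?A = "(\<chi> i j. a) :: complex ^ 1 ^ 1" and ?B = "(\<chi> i j. inverse a) :: complex ^ 1 ^ 1"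
  have BA: "?B ** ?A = mat 1" by (simp add: matrix1_mult mat_eq_matrix1 assms)
  have "?A ** matrix_inv ?A = mat 1"
    using someI_ex[OF invertible_matrix1[OF assms, unfolded invertible_def]]
    unfolding matrix_inv_def by blast
  then have "?B ** (?A ** matrix_inv ?A) = ?B" by (simp add: matrix_mul_rid)
  then show ?thesis by (simp add: matrix_mul_assoc BA matrix_mul_lid)
qed

lemma fund_V_eq_fund_U: "generic t q \<Longrightarrow> fund_V t q = fund_U t q"
  by (simp add: fund_V_def fund_U_def g1_eq_f0)

lemma fundamental_matrix_fund_U: "fundamental_matrix fund_U"
  unfolding fundamental_matrix_def
proof (intro allI impI conjI)
  fix t q assume g: "generic t q"
  show "invertible (fund_U t q)"
    unfolding fund_U_def by (rule invertible_matrix1[OF f0_nonzero[OF g]])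
  show "mat (1 - q * t) ** fund_U (q * t) q - fund_U t q = 0"
    unfolding fund_U_def mat_eq_matrix1 matrix1_mult f0_shift[OF g] by simp
qed

lemma fundamental_matrix_fund_V: "fundamental_matrix fund_V"
  using fundamental_matrix_fund_U unfolding fundamental_matrix_def
  by (simp add: fund_V_eq_fund_U generic_mult)

lemma monodromy_trivial: "generic t q \<Longrightarrow> matrix_inv (fund_V t q) ** fund_U t q = mat 1"
  by (simp add: fund_V_eq_fund_U fund_U_def matrix_inv_matrix1 f0_nonzero matrix1_mult mat_eq_matrix1)


section \<open>Generic points\<close>

definition Gen :: "(complex \<times> complex) set" where
  "Gen = {(z, \<tau>). \<tau> \<notin> \<real> \<and> z \<notin> lattice_translates {0} \<tau>}"

text \<open>Unlike \<open>Gen\<close>, this set puts no restriction on \<open>\<tau>\<close>: it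
  must also locate possible poles of the extension over real \<open>\<tau>\<close>, where
  \<open>Gen\<close> has no points.\<close>

definition Lat :: "(complex \<times> complex) set" where
  "Lat = {(z, \<tau>). z \<in> lattice_translates {0} \<tau>}"

lemma mem_lattice: "z \<in> lattice_translates {0} \<tau> \<longleftrightarrow> (\<exists>m n::int. z = of_int m + of_int n * \<tau>)"
  by (simp add: lattice_translates_def)

lemma mem_Gen: "(z, \<tau>) \<in> Gen \<longleftrightarrow> \<tau> \<notin> \<real> \<and> (z, \<tau>) \<notin> Lat"
  by (simp add: Gen_def Lat_def)

lemma mem_Lat: "(z, \<tau>) \<in> Lat \<longleftrightarrow> (\<exists>m n::int. z = of_int m + of_int n * \<tau>)"
  by (simp add: Lat_def mem_lattice)

lemma ee_powi: "ee a powi k = ee (of_int k * a)"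
  by (simp add: ee_def exp_power_int mult_ac)

lemma generic_ee:
  assumes "(z, \<tau>) \<in> Gen"
  shows "generic (ee z) (ee \<tau>)"
  unfolding generic_def
proof (intro conjI allI notI)
  have "Im \<tau> \<noteq> 0" using assms by (auto simp: mem_Gen complex_is_Real_iff)
  moreover assume "norm (ee \<tau>) = 1"
  ultimately show False by (simp add: norm_ee)
next
  fix k :: int assume "ee z = ee \<tau> powi k"
  then have "ee (z - of_int k * \<tau>) = 1" by (simp add: ee_powi ee_diff)
  then obtain m :: int where "z - of_int k * \<tau> = of_int m" by (auto simp: ee_eq_1_iff)
  then have "z = of_int m + of_int k * \<tau>" by (simp add: algebra_simps)
  then show False using assms by (auto simp: mem_Gen mem_Lat)
qed auto

definition Uf :: "complex \<times> complex \<Rightarrow> complex" where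
  "Uf = lift_tq f0"

lemma Uf_nonzero: "p \<in> Gen \<Longrightarrow> Uf p \<noteq> 0"
  by (cases p) (simp add: Uf_def lift_tq_def f0_nonzero generic_ee)

text \<open>Above the real axis \<open>Uf\<close> is a holomorphic product, below it
  (\<open>Uf_lower\<close>) the reciprocal of one. The two have different bases, so neither formula
  continues the other across the axis.\<close>

lemma Uf_upper: "Im \<tau> > 0 \<Longrightarrow> Uf (z, \<tau>) = qpoch (ee (z + \<tau>)) (ee \<tau>)"
  by (simp add: Uf_def lift_tq_def f0_def ee_add mult.commute)

lemma Uf_lower:
  assumes "Im \<tau> < 0"
  shows "Uf (z, \<tau>) = inverse (qpoch (ee z) (ee (- \<tau>)))"
proof -
  have "norm (ee (- \<tau>)) < 1" using assms by (intro norm_ee_less_1) simp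
  then have "norm (ee \<tau>) > 1" by (simp add: ee_minus norm_inverse inverse_less_1_iff)
  then show ?thesis by (simp add: Uf_def lift_tq_def f0_outside ee_minus)
qed

lemma Uf_add_of_int: "Uf (z + of_int m, \<tau>) = Uf (z, \<tau>)"
  by (simp add: Uf_def lift_tq_def)

lemma Uf_shift: "(z, \<tau>) \<in> Gen \<Longrightarrow> Uf (z - \<tau>, \<tau>) = (1 - ee z) * Uf (z, \<tau>)"
proof -
  assume g: "(z, \<tau>) \<in> Gen"
  have "(z - \<tau>, \<tau>) \<in> Gen"
    unfolding mem_Gen mem_Lat
  proof (intro conjI notI)
    assume "\<exists>m n::int. z - \<tau> = of_int m + of_int n * \<tau>"
    then obtain m n :: int where "z - \<tau> = of_int m + of_int n * \<tau>" by blast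
    then have "z = of_int m + of_int (n + 1) * \<tau>" by (simp add: algebra_simps)
    then show False using g unfolding mem_Gen mem_Lat by blast
  qed (use g in \<open>simp add: mem_Gen\<close>)
  from f0_shift[OF generic_ee[OF this]] show ?thesis
    by (simp add: Uf_def lift_tq_def ee_add[symmetric])
qed

lemma open_not_real: "open (UNIV \<times> - \<real> :: (complex \<times> complex) set)"
  by (intro open_Times open_Compl closed_complex_Reals) simp

lemma holomorphic2_on_ee: "holomorphic2_on f S \<Longrightarrow> holomorphic2_on (\<lambda>p. ee (f p)) S"
  by (rule holomorphic2_on_compose_holomorphic[of ee UNIV]) (auto intro: holomorphic_intros)

lemma holomorphic2_on_minus: "holomorphic2_on f S \<Longrightarrow> holomorphic2_on (\<lambda>p. - f p) S"
  using holomorphic2_on_diff[OF holomorphic2_on_const, of S f 0] by (simp add: holomorphic2_on_def)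

lemma open_upper: "open (UNIV \<times> {\<tau>. Im \<tau> > 0} :: (complex \<times> complex) set)"
  by (intro open_Times open_halfspace_Im_gt) simp

lemma open_lower: "open (UNIV \<times> {\<tau>. Im \<tau> < 0} :: (complex \<times> complex) set)"
  by (intro open_Times open_halfspace_Im_lt) simp

lemma qpoch_ee_nonzero:
  assumes "Im \<tau> > 0" "(z, \<tau>) \<notin> Lat"
  shows "qpoch (ee z) (ee \<tau>) \<noteq> 0"
  using generic_ee[of z \<tau>] assms by (intro qpoch_generic_nonzero) (auto simp: mem_Gen complex_is_Real_iff)

lemma Gen_not_Lat: "x \<in> Gen \<Longrightarrow> x \<notin> Lat"
  by (cases x) (simp add: mem_Gen)

lemma loc_quot_global:
  assumes g: "holomorphic2_on g W" and h: "holomorphic2_on h W"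
    and nz: "\<And>x. x \<in> W \<Longrightarrow> x \<notin> Lat \<Longrightarrow> g x \<noteq> 0 \<and> h x \<noteq> 0"
    and eq: "\<And>x. x \<in> W \<Longrightarrow> x \<in> Gen \<Longrightarrow> F x = g x / h x"
  shows "loc_quot Gen Lat F W"
proof (rule loc_quotI)
  show "open W" using g by (simp add: holomorphic2_on_def)
  fix p assume p: "p \<in> W"
  have *: "\<forall>x\<in>W \<inter> Gen. g x \<noteq> 0 \<and> h x \<noteq> 0 \<and> F x = g x / h x"
    using nz eq Gen_not_Lat by auto
  show "\<exists>W g h. p \<in> W \<and> holomorphic2_on g W \<and> holomorphic2_on h W \<and>
       (\<forall>x\<in>W \<inter> Gen. g x \<noteq> 0 \<and> h x \<noteq> 0 \<and> F x = g x / h x) \<and> (p \<notin> Lat \<longrightarrow> g p \<noteq> 0 \<and> h p \<noteq> 0)"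
    by (rule exI[of _ W], rule exI[of _ g], rule exI[of _ h]) (use p g h * nz in simp)
qed

lemma loc_quot_locally:
  assumes "open D" "\<And>p. p \<in> D \<Longrightarrow> \<exists>W. p \<in> W \<and> loc_quot G L F W"
  shows "loc_quot G L F D"
proof (rule loc_quotI[OF assms(1)])
  fix p assume "p \<in> D"
  then obtain W where "p \<in> W" "loc_quot G L F W" using assms(2) by blast
  then show "\<exists>W g h. p \<in> W \<and> holomorphic2_on g W \<and> holomorphic2_on h W \<and>
       (\<forall>x\<in>W \<inter> G. g x \<noteq> 0 \<and> h x \<noteq> 0 \<and> F x = g x / h x) \<and> (p \<notin> L \<longrightarrow> g p \<noteq> 0 \<and> h p \<noteq> 0)"
    unfolding loc_quot_def by blast
qed

text \<open>The witnesses are product over 1 above the axis and 1 over product below it; the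
  products vanish only at lattice points.\<close>

lemma loc_quot_Uf: "loc_quot Gen Lat Uf (UNIV \<times> - \<real>)"
proof -
  let ?U = "UNIV \<times> {\<tau>. Im \<tau> > 0} :: (complex \<times> complex) set"
  let ?g = "\<lambda>p. qpoch (ee (fst p + snd p)) (ee (snd p))"
  have "loc_quot Gen Lat Uf ?U"
  proof (rule loc_quot_global[of ?g _ "\<lambda>p. 1"])
    show "holomorphic2_on ?g ?U"
      by (intro holomorphic2_on_qpoch holomorphic2_on_ee holomorphic2_on_add holomorphic2_on_fst holomorphic2_on_snd open_upper)
         (auto intro: norm_ee_less_1)
    show "holomorphic2_on (\<lambda>p. 1) ?U" by (rule holomorphic2_on_const[OF open_upper])
    fix x assume x: "x \<in> ?U"
    show "Uf x = ?g x / 1" using x Uf_upper[of "snd x" "fst x"] by auto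
    assume "x \<notin> Lat"
    have "?g x \<noteq> 0"
    proof (rule qpoch_ee_nonzero)
      show "Im (snd x) > 0" using x by auto
      show "(fst x + snd x, snd x) \<notin> Lat"
      proof
        assume "(fst x + snd x, snd x) \<in> Lat"
        then obtain m n :: int where "fst x + snd x = of_int m + of_int n * snd x" by (auto simp: mem_Lat)
        then have "fst x = of_int m + of_int (n - 1) * snd x" by (simp add: algebra_simps)
        then have "(fst x, snd x) \<in> Lat" unfolding mem_Lat by blast
        then show False using \<open>x \<notin> Lat\<close> by simp
      qed
    qed
    then show "?g x \<noteq> 0 \<and> (1::complex) \<noteq> 0" by simp
  qed
  moreover
  let ?L = "UNIV \<times> {\<tau>. Im \<tau> < 0} :: (complex \<times> complex) set"
  let ?h = "\<lambda>p. qpoch (ee (fst p)) (ee (- snd p))"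
  have "loc_quot Gen Lat Uf ?L"
  proof (rule loc_quot_global[of "\<lambda>p. 1" _ ?h])
    show "holomorphic2_on ?h ?L"
      by (intro holomorphic2_on_qpoch holomorphic2_on_ee holomorphic2_on_minus holomorphic2_on_fst holomorphic2_on_snd open_lower)
         (auto intro: norm_ee_less_1)
    show "holomorphic2_on (\<lambda>p. 1) ?L" by (rule holomorphic2_on_const[OF open_lower])
    fix x assume x: "x \<in> ?L"
    show "Uf x = 1 / ?h x" using x Uf_lower[of "snd x" "fst x"] by (auto simp: inverse_eq_divide)
    assume "x \<notin> Lat"
    have "?h x \<noteq> 0"
    proof (rule qpoch_ee_nonzero)
      show "Im (- snd x) > 0" using x by auto
      show "(fst x, - snd x) \<notin> Lat"
      proof
        assume "(fst x, - snd x) \<in> Lat"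
        then obtain m n :: int where "fst x = of_int m + of_int n * - snd x" by (auto simp: mem_Lat)
        then have "fst x = of_int m + of_int (- n) * snd x" by simp
        then have "(fst x, snd x) \<in> Lat" unfolding mem_Lat by blast
        then show False using \<open>x \<notin> Lat\<close> by simp
      qed
    qed
    then show "(1::complex) \<noteq> 0 \<and> ?h x \<noteq> 0" by simp
  qed
  ultimately show ?thesis
  proof (intro loc_quot_locally[OF open_not_real])
    fix p :: "complex \<times> complex" assume U: "loc_quot Gen Lat Uf ?U" and L: "loc_quot Gen Lat Uf ?L"
      and p: "p \<in> UNIV \<times> - \<real>"
    have "Im (snd p) \<noteq> 0" using p by (cases p) (auto simp: complex_is_Real_iff)
    then have "p \<in> ?U \<or> p \<in> ?L" by (cases p) auto
    then show "\<exists>W. p \<in> W \<and> loc_quot Gen Lat Uf W"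
    proof
      assume "p \<in> ?U" then show ?thesis using U by (intro exI[of _ ?U] conjI)
    next
      assume "p \<in> ?L" then show ?thesis using L by (intro exI[of _ ?L] conjI)
    qed
  qed
qed

section \<open>The modular cocycle near real points\<close>

lemma denom_nonzero:
  fixes a b c d :: int
  assumes "a * d - b * c = 1" "\<tau> \<notin> \<real>"
  shows "of_int c * \<tau> + of_int d \<noteq> (0::complex)"
proof
  assume eq: "of_int c * \<tau> + of_int d = (0::complex)"
  have "c \<noteq> 0"
  proof
    assume "c = 0"
    then have "d = 0" using eq by simp
    then show False using assms(1) \<open>c = 0\<close> by simp
  qed
  then have "\<tau> = of_real (- of_int d / of_int c)" using eq by (simp add: field_simps add_eq_0_iff)
  then show False using assms(2) by (metis Reals_of_real)
qed

text \<open>Multiplication by \<open>c \<tau> + d\<close> carries the lattice of the transformed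
  point into that of \<open>\<tau>\<close>, because its generators become
  \<open>c \<tau> + d\<close> and \<open>a \<tau> + b\<close>.\<close>

lemma Lat_act:
  fixes a b c d :: int
  assumes "of_int c * \<tau> + of_int d \<noteq> (0::complex)"
    and "(z / (of_int c * \<tau> + of_int d), (of_int a * \<tau> + of_int b) / (of_int c * \<tau> + of_int d)) \<in> Lat"
  shows "(z, \<tau>) \<in> Lat"
proof -
  obtain m n :: int where "z / (of_int c * \<tau> + of_int d) = of_int m + of_int n * ((of_int a * \<tau> + of_int b) / (of_int c * \<tau> + of_int d))"
    using assms(2) by (auto simp: mem_Lat)
  then have "z = of_int m * (of_int c * \<tau> + of_int d) + of_int n * (of_int a * \<tau> + of_int b)"
    using assms(1) by (simp add: field_simps)
  then have "z = of_int (m * d + n * b) + of_int (m * c + n * a) * \<tau>" by (simp add: algebra_simps)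
  then show ?thesis unfolding mem_Lat by blast
qed

lemma act_not_real:
  fixes a b c d :: int and \<tau> :: complex
  assumes det: "a * d - b * c = 1" and \<tau>: "\<tau> \<notin> \<real>"
  shows "(of_int a * \<tau> + of_int b) / (of_int c * \<tau> + of_int d) \<notin> \<real>"
proof
  note nz = denom_nonzero[OF assms]
  assume "(of_int a * \<tau> + of_int b) / (of_int c * \<tau> + of_int d) \<in> \<real>"
  then obtain r where "(of_int a * \<tau> + of_int b) / (of_int c * \<tau> + of_int d) = of_real r" by (auto elim: Reals_cases)
  then have "of_int a * \<tau> + of_int b = of_real r * (of_int c * \<tau> + of_int d)" using nz by (simp add: field_simps)
  then have eq: "of_real (of_int a - r * of_int c) * \<tau> = of_real (r * of_int d - of_int b)"
    by (simp add: algebra_simps)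
  show False
  proof (cases "of_int a - r * of_int c = 0")
    case False
    define s u where "s = of_int a - r * of_int c" and "u = r * of_int d - of_int b"
    have "of_real s * \<tau> = of_real u" "s \<noteq> 0" using eq False by (simp_all add: s_def u_def)
    then have "\<tau> = of_real (u / s)" by (simp add: field_simps)
    then show False using \<tau> by (metis Reals_of_real)
  next
    \<comment> \<open>A vanishing coefficient makes the rows \<open>(a, b)\<close> and
      \<open>(c, d)\<close> proportional, against determinant 1.\<close>
    case True
    then have "r * of_int d - of_int b = 0" using eq by (simp only: True of_real_0 mult_zero_left) (metis of_real_eq_0_iff)
    with True have "of_int a = r * of_int c" "of_int b = r * of_int d" by auto
    then have "real_of_int (a * d - b * c) = 0" by simp
    then show False using det by simp
  qed
qed

lemma Gen_act:
  fixes a b c d :: int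
  assumes "a * d - b * c = 1" "(z, \<tau>) \<in> Gen"
  shows "(z / (of_int c * \<tau> + of_int d), (of_int a * \<tau> + of_int b) / (of_int c * \<tau> + of_int d)) \<in> Gen"
  using assms act_not_real[OF assms(1)] Lat_act[OF denom_nonzero[OF assms(1)]]
  unfolding mem_Gen by blast

lemma holomorphic2_affine:
  "open S \<Longrightarrow> holomorphic2_on (\<lambda>p. c * snd p + d) S"
  by (intro holomorphic2_on_add holomorphic2_on_mult holomorphic2_on_snd holomorphic2_on_const)

lemma loc_quot_Uf_act:
  fixes a b c d :: int
  assumes det: "a * d - b * c = 1"
  shows "loc_quot Gen Lat (\<lambda>p. Uf (fst p / (of_int c * snd p + of_int d), (of_int a * snd p + of_int b) / (of_int c * snd p + of_int d))) (UNIV \<times> - \<real>)"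
proof (rule loc_quot_compose[OF loc_quot_Uf])
  have nz: "of_int c * snd p + of_int d \<noteq> 0" if "p \<in> UNIV \<times> - \<real>" for p :: "complex \<times> complex"
    using denom_nonzero[OF det, of "snd p"] that by auto
  show "holomorphic2_on (\<lambda>p. fst p / (of_int c * snd p + of_int d)) (UNIV \<times> - \<real>)"
    by (intro holomorphic2_on_divide holomorphic2_on_fst holomorphic2_affine open_not_real nz)
  show "holomorphic2_on (\<lambda>p. (of_int a * snd p + of_int b) / (of_int c * snd p + of_int d)) (UNIV \<times> - \<real>)"
    by (intro holomorphic2_on_divide holomorphic2_affine open_not_real nz)
  fix p :: "complex \<times> complex" assume p: "p \<in> UNIV \<times> - \<real>"
  show "(fst p / (of_int c * snd p + of_int d), (of_int a * snd p + of_int b) / (of_int c * snd p + of_int d)) \<in> UNIV \<times> - \<real>"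
    using act_not_real[OF det, of "snd p"] p by auto
  show "(fst p / (of_int c * snd p + of_int d), (of_int a * snd p + of_int b) / (of_int c * snd p + of_int d)) \<in> Gen" if "p \<in> Gen"
    using Gen_act[OF det, of "fst p" "snd p"] that by simp
  show "(fst p / (of_int c * snd p + of_int d), (of_int a * snd p + of_int b) / (of_int c * snd p + of_int d)) \<notin> Lat" if "p \<notin> Lat"
    using Lat_act[OF nz[OF p], of "fst p" a b] that by auto
qed

lemma loc_quot_divide:
  assumes "loc_quot G L F D" "loc_quot G L F' D"
  shows "loc_quot G L (\<lambda>p. F p / F' p) D"
  using loc_quot_mult[OF assms(1) loc_quot_inverse[OF assms(2)]] by (simp add: divide_inverse)

definition cocycle_S :: "complex \<times> complex \<Rightarrow> complex" where
  "cocycle_S p = Uf (fst p / snd p, - (1 / snd p)) / Uf p"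

lemma loc_quot_cocycle_S_not_real: "loc_quot Gen Lat cocycle_S (UNIV \<times> - \<real>)"
  using loc_quot_divide[OF loc_quot_Uf_act[of 0 0 "-1" 1] loc_quot_Uf] by (simp add: cocycle_S_def[abs_def])

lemma not_real_cases:
  assumes "\<tau> \<notin> \<real>"
  obtains "Im \<tau> > 0" | "Im \<tau> < 0"
  using assms by (auto simp: complex_is_Real_iff) linarith

text \<open>This carries the cocycle across the positive axis.
  \<open>exp_double_sine_log_product\<close> wants the quotient of the periods in the upper half
  plane, so they are taken as \<open>1\<close>, \<open>\<tau>\<close> above the axis and as
  \<open>\<tau>\<close>, \<open>1\<close> below it; the integral is symmetric in them.\<close>

lemma cocycle_S_eq_exp_double_sine_log:
  assumes g: "(z, \<tau>) \<in> Gen" and \<epsilon>: "0 < \<epsilon>" "\<epsilon> < 1" "\<epsilon> < Re (1 / \<tau>)" and \<tau>: "Re \<tau> > 0"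
    and z: "0 < Re (z + \<tau>)" "Re (z + \<tau>) < 1 + Re \<tau>"
  shows "cocycle_S (z, \<tau>) = exp (double_sine_log \<epsilon> 1 \<tau> (z + \<tau>))"
proof -
  have nz: "\<tau> \<noteq> 0" using \<tau> by auto
  have "\<tau> \<notin> \<real>" using g by (simp add: mem_Gen)
  then show ?thesis
  proof (cases rule: not_real_cases)
    case 1
    have 2: "Im (- (1 / \<tau>)) > 0" using Im_inverse_neg[OF 1] by (simp add: inverse_eq_divide)
    have "Uf (z, \<tau>) \<noteq> 0" by (rule Uf_nonzero[OF g])
    moreover have "exp (double_sine_log \<epsilon> 1 \<tau> (z + \<tau>)) * qpoch (ee ((z + \<tau>) / 1)) (ee (\<tau> / 1)) = qpoch (ee ((z + \<tau> - 1) / \<tau>)) (ee (- (1 / \<tau>)))"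
      by (rule exp_double_sine_log_product) (use assms 1 in auto)
    moreover have "Uf (z / \<tau>, - (1 / \<tau>)) = qpoch (ee ((z + \<tau> - 1) / \<tau>)) (ee (- (1 / \<tau>)))"
    proof -
      \<comment> \<open>The summand \<open>\<tau>\<close> becomes the integer 1 after division by
        \<open>\<tau>\<close>, and \<open>ee\<close> ignores it.\<close>
      have "(z + \<tau> - 1) / \<tau> = (z / \<tau> + - (1 / \<tau>)) + 1" using nz by (simp add: field_simps)
      then have "ee ((z + \<tau> - 1) / \<tau>) = ee (z / \<tau> + - (1 / \<tau>))" by (simp only: ee_add ee_1 mult_1_right)
      then show ?thesis by (simp only: Uf_upper[OF 2])
    qed
    ultimately show ?thesis
      by (simp add: cocycle_S_def Uf_upper[OF 1] field_simps)
  next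
    case 2
    have 1: "Im (1 / \<tau>) > 0" using Im_inverse_neg[of "- \<tau>"] 2 by (simp add: inverse_eq_divide)
    then have 3: "Im (- (1 / \<tau>)) < 0" by simp
    have gS: "(z / \<tau>, - (1 / \<tau>)) \<in> Gen" using Gen_act[of 0 0 "-1" 1 z \<tau>] g by simp
    have n1: "Uf (z, \<tau>) \<noteq> 0" by (rule Uf_nonzero[OF g])
    have n2: "Uf (z / \<tau>, - (1 / \<tau>)) \<noteq> 0" by (rule Uf_nonzero[OF gS])
    have "exp (double_sine_log \<epsilon> \<tau> 1 (z + \<tau>)) * qpoch (ee ((z + \<tau>) / \<tau>)) (ee (1 / \<tau>)) = qpoch (ee ((z + \<tau> - \<tau>) / 1)) (ee (- (\<tau> / 1)))"
      by (rule exp_double_sine_log_product) (use assms 1 in auto)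
    moreover have "ee ((z + \<tau>) / \<tau>) = ee (z / \<tau>)" using nz by (simp add: add_divide_distrib ee_add)
    ultimately have "exp (double_sine_log \<epsilon> 1 \<tau> (z + \<tau>)) * qpoch (ee (z / \<tau>)) (ee (1 / \<tau>)) = qpoch (ee z) (ee (- \<tau>))"
      by (simp add: double_sine_log_commute[of \<epsilon> 1])
    moreover have U1: "Uf (z / \<tau>, - (1 / \<tau>)) = inverse (qpoch (ee (z / \<tau>)) (ee (1 / \<tau>)))"
      using Uf_lower[OF 3] by simp
    moreover have "qpoch (ee (z / \<tau>)) (ee (1 / \<tau>)) \<noteq> 0" using n2 U1 by auto
    ultimately have "exp (double_sine_log \<epsilon> 1 \<tau> (z + \<tau>)) = qpoch (ee z) (ee (- \<tau>)) / qpoch (ee (z / \<tau>)) (ee (1 / \<tau>))"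
      by (simp add: eq_divide_eq)
    then show ?thesis using Uf_lower[OF 2, of z] by (simp add: cocycle_S_def U1) (simp only: divide_inverse inverse_inverse_eq mult.commute)
  qed
qed

text \<open>The factor that \<open>cocycle_S\<close> acquires when \<open>z\<close> moves by
  \<open>n\<close>; it carries the cocycle out of the strip where the integral converges.\<close>

definition shift_factor :: "nat \<Rightarrow> complex \<times> complex \<Rightarrow> complex" where
  "shift_factor n p = (\<Prod>k<n. 1 - ee ((fst p + of_nat k) / snd p))"

lemma Gen_shift: "(z, \<tau>) \<in> Gen \<Longrightarrow> (z + of_int n, \<tau>) \<in> Gen"
proof -
  assume g: "(z, \<tau>) \<in> Gen"
  have "(z + of_int n, \<tau>) \<notin> Lat"
  proof
    assume "(z + of_int n, \<tau>) \<in> Lat"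
    then obtain k m :: int where "z + of_int n = of_int k + of_int m * \<tau>" by (auto simp: mem_Lat)
    then have "z = of_int (k - n) + of_int m * \<tau>" by (simp add: algebra_simps)
    then have "(z, \<tau>) \<in> Lat" unfolding mem_Lat by blast
    then show False using g by (simp add: mem_Gen)
  qed
  then show ?thesis using g by (simp add: mem_Gen)
qed

text \<open>The denominator has period 1 in \<open>z\<close>. In the numerator
  \<open>z / \<tau>\<close> moves by \<open>1 / \<tau>\<close>, which is minus the transformed
  modulus, so the difference equation applies there.\<close>

lemma cocycle_S_shift:
  assumes g: "(z, \<tau>) \<in> Gen"
  shows "cocycle_S (z + 1, \<tau>) = cocycle_S (z, \<tau>) * (1 - ee (z / \<tau>))"
proof -
  have "\<tau> \<noteq> 0" using g by (auto simp: mem_Gen)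
  then have eq: "(z + 1) / \<tau> = z / \<tau> - (- (1 / \<tau>))" by (simp add: field_simps)
  have "(z / \<tau>, - (1 / \<tau>)) \<in> Gen" using Gen_act[of 0 0 "-1" 1 z \<tau>] g by simp
  from Uf_shift[OF this] have "Uf ((z + 1) / \<tau>, - (1 / \<tau>)) = (1 - ee (z / \<tau>)) * Uf (z / \<tau>, - (1 / \<tau>))"
    by (simp only: eq)
  then show ?thesis using Uf_add_of_int[of z 1 \<tau>] by (simp add: cocycle_S_def)
qed

lemma cocycle_S_shift_nat:
  assumes g: "(z, \<tau>) \<in> Gen"
  shows "cocycle_S (z + of_nat n, \<tau>) = cocycle_S (z, \<tau>) * shift_factor n (z, \<tau>)"
proof (induction n)
  case (Suc n)
  have "(z + of_nat n, \<tau>) \<in> Gen" using Gen_shift[OF g, of "int n"] by simp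
  from cocycle_S_shift[OF this] Suc show ?case by (simp add: shift_factor_def add_ac)
qed (simp add: shift_factor_def)

lemma loc_quot_shift_factor:
  assumes W: "open W" "\<And>p. p \<in> W \<Longrightarrow> snd p \<noteq> 0"
  shows "loc_quot Gen Lat (shift_factor n) W"
proof -
  have "loc_quot Gen Lat (\<lambda>p. 1 - ee ((fst p + of_nat k) / snd p)) W" for k
  proof (rule loc_quot_global[of "\<lambda>p. 1 - ee ((fst p + of_nat k) / snd p)" _ "\<lambda>p. 1"])
    show "holomorphic2_on (\<lambda>p. 1 - ee ((fst p + of_nat k) / snd p)) W"
      by (intro holomorphic2_on_diff holomorphic2_on_ee holomorphic2_on_divide holomorphic2_on_add
          holomorphic2_on_fst holomorphic2_on_snd holomorphic2_on_const W)
    show "holomorphic2_on (\<lambda>p. 1) W" by (rule holomorphic2_on_const[OF W(1)])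
    fix x assume x: "x \<in> W" "x \<notin> Lat"
    have "ee ((fst x + of_nat k) / snd x) \<noteq> 1"
    proof
      assume "ee ((fst x + of_nat k) / snd x) = 1"
      then obtain n :: int where "(fst x + of_nat k) / snd x = of_int n" by (auto simp: ee_eq_1_iff)
      then have "fst x = of_int (- int k) + of_int n * snd x" using W(2)[OF x(1)] by (simp add: field_simps)
      then have "(fst x, snd x) \<in> Lat" unfolding mem_Lat by blast
      then show False using x by simp
    qed
    then show "1 - ee ((fst x + of_nat k) / snd x) \<noteq> 0 \<and> (1::complex) \<noteq> 0" by simp
  qed simp
  then have "loc_quot Gen Lat (\<lambda>p. \<Prod>k<n. 1 - ee ((fst p + of_nat k) / snd p)) W"
    by (intro loc_quot_prod W(1))
  then show ?thesis by (simp add: shift_factor_def[abs_def])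
qed

lemma loc_quot_cocycle_S_near_real:
  assumes "\<tau>0 > 0"
  shows "\<exists>W. (z0, of_real \<tau>0) \<in> W \<and> loc_quot Gen Lat cocycle_S W"
proof -
  \<comment> \<open>Half of the admissible bound at \<open>\<tau>0\<close>, so that the same line
    works for all \<open>\<tau>\<close> near it.\<close>
  define \<epsilon> where "\<epsilon> = min 1 (1 / \<tau>0) / 2"
  have \<epsilon>: "0 < \<epsilon>" "\<epsilon> < 1" "\<epsilon> * \<tau>0 < 1"
  proof -
    show "0 < \<epsilon>" "\<epsilon> < 1" using assms by (auto simp: \<epsilon>_def)
    have "\<epsilon> \<le> (1 / \<tau>0) / 2" unfolding \<epsilon>_def by simp
    then have "\<epsilon> * \<tau>0 \<le> (1 / \<tau>0) / 2 * \<tau>0" using assms by (intro mult_right_mono) auto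
    then show "\<epsilon> * \<tau>0 < 1" using assms by simp
  qed
  define T where "T = {p :: complex \<times> complex. \<epsilon> * (cmod (snd p))\<^sup>2 < Re (snd p)} \<inter> {p. 0 < Re (fst p + snd p)} \<inter> {p. Re (fst p + snd p) < 1 + Re (snd p)}"
  have oT: "open T" unfolding T_def by (intro open_Int open_Collect_less continuous_intros)
  have pos: "Re (snd p) > 0" if "p \<in> T" for p
  proof -
    have "0 \<le> \<epsilon> * (cmod (snd p))\<^sup>2" using \<epsilon> by simp
    then show ?thesis using that by (auto simp: T_def)
  qed
  have "loc_quot Gen Lat cocycle_S T"
  proof (rule loc_quot_global[of "\<lambda>p. exp (double_sine_log \<epsilon> 1 (snd p) (fst p + snd p))" _ "\<lambda>p. 1"])
    have "holomorphic2_on (\<lambda>p. (\<lambda>(w, \<beta>). double_sine_log \<epsilon> 1 \<beta> w) (fst p + snd p, snd p)) T"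
    proof (rule holomorphic2_on_compose[OF holomorphic2_double_sine_log])
      show "holomorphic2_on (\<lambda>p. fst p + snd p) T" "holomorphic2_on snd T"
        by (intro holomorphic2_on_add holomorphic2_on_fst holomorphic2_on_snd oT)+
    qed (use \<epsilon> in \<open>auto simp: T_def\<close>)
    then show "holomorphic2_on (\<lambda>p. exp (double_sine_log \<epsilon> 1 (snd p) (fst p + snd p))) T"
      by (intro holomorphic2_on_exp) simp
    show "holomorphic2_on (\<lambda>p. 1) T" by (rule holomorphic2_on_const[OF oT])
    fix x assume x: "x \<in> T" "x \<in> Gen"
    have "cocycle_S (fst x, snd x) = exp (double_sine_log \<epsilon> 1 (snd x) (fst x + snd x))"
    proof (rule cocycle_S_eq_exp_double_sine_log)
      show "\<epsilon> < Re (1 / snd x)" using less_Re_inverse_iff[OF pos[OF x(1)]] x(1) by (simp add: T_def)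
      show "Re (snd x) > 0" by (rule pos[OF x(1)])
    qed (use x \<epsilon> in \<open>auto simp: T_def\<close>)
    then show "cocycle_S x = exp (double_sine_log \<epsilon> 1 (snd x) (fst x + snd x)) / 1" by simp
  qed simp
  \<comment> \<open>Translating \<open>z0\<close> to \<open>0 \<le> Re z < 1\<close> places
    \<open>z + \<tau>\<close> inside the convergence strip, since
    \<open>\<tau>0 > 0\<close>.\<close>
  define N where "N = \<lfloor>Re z0\<rfloor>"
  define W where "W = (\<lambda>p. (fst p - of_int N, snd p)) -` T"
  have oW: "open W" unfolding W_def by (rule open_vimage[OF oT]) (intro continuous_intros)
  have lat: "(fst p - of_int N, snd p) \<in> Lat \<Longrightarrow> p \<in> Lat" for p
  proof -
    assume "(fst p - of_int N, snd p) \<in> Lat"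
    then obtain k m :: int where "fst p - of_int N = of_int k + of_int m * snd p" by (auto simp: mem_Lat)
    then have "fst p = of_int (k + N) + of_int m * snd p" by (simp add: algebra_simps)
    then have "(fst p, snd p) \<in> Lat" unfolding mem_Lat by blast
    then show "p \<in> Lat" by simp
  qed
  have gen: "(fst p - of_int N, snd p) \<in> Gen" if "p \<in> Gen" for p
    using Gen_shift[of "fst p" "snd p" "- N"] that by simp
  have nz: "snd p \<noteq> 0" if "p \<in> W" for p using pos[of "(fst p - of_int N, snd p)"] that by (auto simp: W_def)
  have base: "loc_quot Gen Lat (\<lambda>p. cocycle_S (fst p - of_int N, snd p)) W"
  proof (rule loc_quot_compose[OF \<open>loc_quot Gen Lat cocycle_S T\<close>])
    show "holomorphic2_on (\<lambda>p. fst p - of_int N) W" "holomorphic2_on snd W"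
      by (intro holomorphic2_on_diff holomorphic2_on_fst holomorphic2_on_snd holomorphic2_on_const oW)+
  qed (use lat gen in \<open>auto simp: W_def\<close>)
  have "loc_quot Gen Lat cocycle_S W"
  proof (cases "N \<ge> 0")
    case True
    have "loc_quot Gen Lat (\<lambda>p. shift_factor (nat N) (fst p - of_int N, snd p)) W"
    proof (rule loc_quot_compose[OF loc_quot_shift_factor[OF oT]])
      show "holomorphic2_on (\<lambda>p. fst p - of_int N) W" "holomorphic2_on snd W"
        by (intro holomorphic2_on_diff holomorphic2_on_fst holomorphic2_on_snd holomorphic2_on_const oW)+
      show "snd p \<noteq> 0" if "p \<in> T" for p using pos[OF that] by auto
    qed (use lat gen in \<open>auto simp: W_def\<close>)
    from loc_quot_mult[OF base this] show ?thesis
    proof (rule loc_quot_cong)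
      fix x assume "x \<in> W" "x \<in> Gen"
      from cocycle_S_shift_nat[OF gen[OF this(2)], of "nat N"] True
      show "cocycle_S (fst x - of_int N, snd x) * shift_factor (nat N) (fst x - of_int N, snd x) = cocycle_S x" by simp
    qed
  next
    \<comment> \<open>For a translation in the other direction the shift factor is divided out; it
      is nonzero at generic points.\<close>
    case False
    have sf: "loc_quot Gen Lat (shift_factor (nat (- N))) W" by (rule loc_quot_shift_factor[OF oW nz])
    from loc_quot_divide[OF base this] show ?thesis
    proof (rule loc_quot_cong)
      fix x assume x: "x \<in> W" "x \<in> Gen"
      have "cocycle_S (fst x - of_int N, snd x) = cocycle_S x * shift_factor (nat (- N)) x"
        using cocycle_S_shift_nat[of "fst x" "snd x" "nat (- N)"] False x by simp
      moreover have "shift_factor (nat (- N)) x \<noteq> 0"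
        unfolding shift_factor_def
      proof (rule notI)
        assume "(\<Prod>k<nat (- N). 1 - ee ((fst x + of_nat k) / snd x)) = 0"
        then obtain k where "ee ((fst x + of_nat k) / snd x) = 1" by (auto simp: prod_zero_iff)
        then obtain n :: int where "(fst x + of_nat k) / snd x = of_int n" by (auto simp: ee_eq_1_iff)
        then have "fst x = of_int (- int k) + of_int n * snd x" using nz[OF x(1)] by (simp add: field_simps)
        then have "(fst x, snd x) \<in> Lat" unfolding mem_Lat by blast
        then show False using Gen_not_Lat[OF x(2)] by simp
      qed
      ultimately show "cocycle_S (fst x - of_int N, snd x) / shift_factor (nat (- N)) x = cocycle_S x" by simp
    qed
  qed
  moreover have "(z0, of_real \<tau>0) \<in> W"
  proof -
    have "of_int N \<le> Re z0" "Re z0 < of_int N + 1" unfolding N_def by linarith+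
    moreover have "\<epsilon> * \<tau>0\<^sup>2 < \<tau>0" using mult_strict_right_mono[OF \<epsilon>(3) assms] by (simp add: power2_eq_square mult.assoc)
    ultimately show ?thesis using assms by (simp add: W_def T_def)
  qed
  ultimately show ?thesis by blast
qed

lemma open_slit: "open (UNIV \<times> - \<real>\<^sub>\<le>\<^sub>0 :: (complex \<times> complex) set)"
  by (intro open_Times open_Compl closed_nonpos_Reals_complex) simp

lemma loc_quot_cocycle_S: "loc_quot Gen Lat cocycle_S (UNIV \<times> - \<real>\<^sub>\<le>\<^sub>0)"
proof (rule loc_quot_locally[OF open_slit])
  fix p :: "complex \<times> complex" assume p: "p \<in> UNIV \<times> - \<real>\<^sub>\<le>\<^sub>0"
  show "\<exists>W. p \<in> W \<and> loc_quot Gen Lat cocycle_S W"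
  proof (cases "snd p \<in> \<real>")
    case True
    then obtain t where t: "snd p = of_real t" by (auto elim: Reals_cases)
    have "snd p \<notin> \<real>\<^sub>\<le>\<^sub>0" using p by auto
    then have "t > 0" by (simp add: t)
    from loc_quot_cocycle_S_near_real[OF this, of "fst p"] show ?thesis using t by (metis prod.collapse)
  next
    case False
    then have "p \<in> UNIV \<times> - \<real>" by (cases p) simp
    then show ?thesis using loc_quot_cocycle_S_not_real by (intro exI[of _ "UNIV \<times> - \<real>"] conjI)
  qed
qed

section \<open>The cocycle of a general matrix\<close>

text \<open>The base \<open>ee \<tau>\<close> to the power \<open>c\<close> is
  \<open>ee \<tau>'\<close>, because \<open>ee\<close> does not see the integer
  \<open>d\<close>.\<close>

lemma Uf_distribution:
  assumes \<tau>: "\<tau> \<notin> \<real>" and c: "c > 0" and N: "\<tau>' = of_nat c * \<tau> + of_int d"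
  shows "Uf (z, \<tau>) = (\<Prod>i<c. Uf (z - of_nat i * \<tau>, \<tau>'))"
  using \<tau>
proof (cases rule: not_real_cases)
  case 1
  then have up': "Im \<tau>' > 0" using c by (simp add: N)
  have q: "ee \<tau> ^ c = ee \<tau>'" by (simp add: N ee_add ee_of_nat_mult)
  have "Uf (z, \<tau>) = (\<Prod>i<c. qpoch (ee \<tau> ^ i * ee (z + \<tau>)) (ee \<tau>'))"
    unfolding Uf_upper[OF 1] q[symmetric] by (rule qpoch_distribution[OF norm_ee_less_1[OF 1] c])
  \<comment> \<open>Above the axis the residues appear in reverse order:
    \<open>z - i \<tau> + \<tau>'\<close> equals \<open>z + \<tau> + (c - 1 - i) \<tau>\<close> up
    to the integer \<open>d\<close>.\<close>
  also have "\<dots> = (\<Prod>i<c. qpoch (ee \<tau> ^ (c - Suc i) * ee (z + \<tau>)) (ee \<tau>'))"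
    by (rule prod.nat_diff_reindex[symmetric])
  also have "\<dots> = (\<Prod>i<c. Uf (z - of_nat i * \<tau>, \<tau>'))"
  proof (rule prod.cong[OF refl])
    fix i assume "i \<in> {..<c}"
    then have "z - of_nat i * \<tau> + \<tau>' = of_nat (c - Suc i) * \<tau> + (z + \<tau>) + of_int d"
      by (simp add: N of_nat_diff algebra_simps)
    then have "ee (z - of_nat i * \<tau> + \<tau>') = ee \<tau> ^ (c - Suc i) * ee (z + \<tau>)"
      by (simp only: ee_add_of_int ee_add[of "of_nat (c - Suc i) * \<tau>"] ee_of_nat_mult)
    then show "qpoch (ee \<tau> ^ (c - Suc i) * ee (z + \<tau>)) (ee \<tau>') = Uf (z - of_nat i * \<tau>, \<tau>')"
      by (simp only: Uf_upper[OF up'])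
  qed
  finally show ?thesis .
next
  case 2
  then have low': "Im \<tau>' < 0" using c by (simp add: N mult_pos_neg)
  have n: "norm (ee (- \<tau>)) < 1" using 2 by (intro norm_ee_less_1) simp
  have q: "ee (- \<tau>) ^ c = ee (- \<tau>')"
  proof -
    have "- \<tau>' = of_nat c * (- \<tau>) + of_int (- d)" by (simp add: N)
    then show ?thesis by (simp only: ee_add_of_int ee_of_nat_mult)
  qed
  have "ee (- \<tau>) ^ i * ee z = ee (z - of_nat i * \<tau>)" for i
    by (simp add: ee_of_nat_mult[symmetric] ee_add[symmetric])
  then have "qpoch (ee z) (ee (- \<tau>)) = (\<Prod>i<c. qpoch (ee (z - of_nat i * \<tau>)) (ee (- \<tau>')))"
    using qpoch_distribution[OF n c, of "ee z"] by (simp add: q)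
  then show ?thesis unfolding Uf_lower[OF 2] Uf_lower[OF low'] by (simp add: prod_inversef[symmetric] o_def)
qed

text \<open>With \<open>\<tau>' = c \<tau> + d\<close> both \<open>c \<tau>\<close> and \<open>c (\<gamma> \<tau>) = a - 1/\<tau>'\<close> are, up to integers, the
  arguments of the cocycle at \<open>S\<close>; the shifts below match the factors of the two distribution
  relations.\<close>

definition w_shift :: "int \<Rightarrow> int \<Rightarrow> int \<Rightarrow> int \<Rightarrow> complex \<times> complex \<Rightarrow> complex" where
  "w_shift a c d j p =
     fst p - of_int ((a * j) mod c) * snd p + (of_int j - of_int ((a * j) mod c) * of_int d) / of_int c"

text \<open>The determinant gives \<open>a d \<equiv> 1\<close> modulo \<open>c\<close>, so
  multiplying the residue of \<open>a j\<close> by \<open>d\<close> recovers \<open>j\<close>. Hence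
  the fraction in \<open>w_shift\<close> is an integer.\<close>

lemma w_shift_dvd:
  fixes a b c d j :: int
  assumes "a * d - b * c = 1"
  obtains m :: int where "j - ((a * j) mod c) * d = c * m"
proof -
  have ad: "a * d = 1 + b * c" using assms by simp
  have "j - ((a * j) mod c) * d = j - (a * j - c * (a * j div c)) * d"
    by (simp add: minus_div_mult_eq_mod[symmetric] mult.commute)
  also have "\<dots> = j - (a * d) * j + c * (a * j div c) * d" by (simp add: algebra_simps)
  also have "\<dots> = c * (d * (a * j div c) - b * j)" unfolding ad by (simp add: algebra_simps)
  finally show thesis by (rule that)
qed

lemma coprime_mult_mod_bij:
  fixes a c :: int
  assumes "coprime a c" "c > 0"
  shows "bij_betw (\<lambda>j. (a * j) mod c) {0..<c} {0..<c}"
proof -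
  have inj: "inj_on (\<lambda>j. (a * j) mod c) {0..<c}"
  proof (rule inj_onI)
    fix i j assume ij: "i \<in> {0..<c}" "j \<in> {0..<c}" "(a * i) mod c = (a * j) mod c"
    then have "c dvd a * i - a * j" by (simp add: mod_eq_dvd_iff)
    then have "c dvd a * (i - j)" by (simp add: right_diff_distrib)
    then have "c dvd i - j" using assms(1) by (simp add: coprime_commute coprime_dvd_mult_right_iff)
    then have "i mod c = j mod c" by (simp add: mod_eq_dvd_iff)
    then show "i = j" using ij by simp
  qed
  moreover have "(\<lambda>j. (a * j) mod c) ` {0..<c} \<subseteq> {0..<c}" using assms(2) by auto
  ultimately show ?thesis
    by (simp add: bij_betw_def endo_inj_surj)
qed

lemma prod_int_atLeastLessThan:
  "c \<ge> 0 \<Longrightarrow> (\<Prod>j\<in>{0..<c::int}. f j) = (\<Prod>i<nat c. f (int i))"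
  by (rule prod.reindex_bij_witness[of _ int nat]) auto

text \<open>Numerator and denominator each distribute over \<open>c\<close> factors, indexed by
  \<open>j\<close> at the transformed modulus and by \<open>i\<close> at \<open>\<tau>\<close>.
  Pairing \<open>i\<close> with \<open>a j\<close> modulo \<open>c\<close> makes the arguments match
  up to integers, and every residue \<open>i\<close> occurs once because \<open>a\<close> is prime
  to \<open>c\<close>.\<close>

lemma Uf_act_eq_prod_cocycle_S:
  fixes a b c d :: int
  assumes det: "a * d - b * c = 1" and c: "c > 0" and g: "(z, \<tau>) \<in> Gen"
  shows "Uf (z / (of_int c * \<tau> + of_int d), (of_int a * \<tau> + of_int b) / (of_int c * \<tau> + of_int d)) / Uf (z, \<tau>)
    = (\<Prod>j\<in>{0..<c}. cocycle_S (w_shift a c d j (z, \<tau>), of_int c * \<tau> + of_int d))"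
proof -
  define \<tau>' where "\<tau>' = of_int c * \<tau> + of_int d"
  define \<sigma> where "\<sigma> = (of_int a * \<tau> + of_int b) / \<tau>'"
  have \<tau>: "\<tau> \<notin> \<real>" using g by (simp add: mem_Gen)
  have nz: "\<tau>' \<noteq> 0" unfolding \<tau>'_def by (rule denom_nonzero[OF det \<tau>])
  have \<sigma>: "\<sigma> \<notin> \<real>" unfolding \<sigma>_def \<tau>'_def by (rule act_not_real[OF det \<tau>])
  have c0: "of_int c \<noteq> (0::complex)" using c by simp
  have c\<sigma>: "- (1 / \<tau>') = of_nat (nat c) * \<sigma> + of_int (- a)"
  proof -
    have "of_int c * (of_int a * \<tau> + of_int b) = of_int a * \<tau>' - of_int (a * d - b * c)"
      by (simp add: \<tau>'_def algebra_simps)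
    then have "of_int c * (of_int a * \<tau> + of_int b) = of_int a * \<tau>' - 1" by (simp only: det of_int_1)
    then show ?thesis using nz c by (simp add: \<sigma>_def field_simps)
  qed
  have "Uf (z / \<tau>', \<sigma>) = (\<Prod>j\<in>{0..<c}. Uf (z / \<tau>' - of_int j * \<sigma>, - (1 / \<tau>')))"
    using Uf_distribution[OF \<sigma> _ c\<sigma>, of "z / \<tau>'"] c by (simp add: prod_int_atLeastLessThan)
  also have "\<dots> = (\<Prod>j\<in>{0..<c}. Uf (w_shift a c d j (z, \<tau>) / \<tau>', - (1 / \<tau>')))"
  proof (rule prod.cong[OF refl])
    fix j assume "j \<in> {0..<c}"
    define i where "i = (a * j) mod c"
    define m where "m = (a * j) div c"
    have i: "of_int i = (of_int a * of_int j - of_int c * of_int m :: complex)"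
      unfolding i_def m_def by (simp add: minus_mult_div_eq_mod[symmetric])
    \<comment> \<open>With \<open>\<sigma> = a / c - 1 / (c \<tau>')\<close>, the left side minus
      \<open>w_shift a c d j (z, \<tau>) / \<tau>'\<close> is \<open>(i - a j) / c\<close>, which is
      \<open>- m\<close>.\<close>
    have "z / \<tau>' - of_int j * \<sigma> = w_shift a c d j (z, \<tau>) / \<tau>' + of_int (- m)"
    proof -
      have w: "w_shift a c d j (z, \<tau>) = z - of_int i * (\<tau>' / of_int c) + of_int j / of_int c"
        unfolding w_shift_def i_def[symmetric] \<tau>'_def using c0 by (simp add: field_simps)
      have s: "\<sigma> = of_int a / of_int c - 1 / (of_int c * \<tau>')"
        using c\<sigma> c c0 nz by (simp add: field_simps)
      show ?thesis unfolding w s i using nz c0 by (simp add: field_simps)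
    qed
    then show "Uf (z / \<tau>' - of_int j * \<sigma>, - (1 / \<tau>')) = Uf (w_shift a c d j (z, \<tau>) / \<tau>', - (1 / \<tau>'))"
      by (simp only: Uf_add_of_int)
  qed
  finally have 1: "Uf (z / \<tau>', \<sigma>) = (\<Prod>j\<in>{0..<c}. Uf (w_shift a c d j (z, \<tau>) / \<tau>', - (1 / \<tau>')))" .
  have cop: "coprime a c"
  proof (rule coprimeI)
    fix l assume "l dvd a" "l dvd c"
    then have "l dvd a * d - b * c" by (intro dvd_diff dvd_mult2 dvd_mult) auto
    then show "is_unit l" by (simp add: det)
  qed
  have "Uf (z, \<tau>) = (\<Prod>i\<in>{0..<c}. Uf (z - of_int i * \<tau>, \<tau>'))"
    using Uf_distribution[OF \<tau>, of "nat c" \<tau>' d z] c by (simp add: prod_int_atLeastLessThan \<tau>'_def)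
  also have "\<dots> = (\<Prod>j\<in>{0..<c}. Uf (z - of_int ((a * j) mod c) * \<tau>, \<tau>'))"
    by (rule prod.reindex_bij_betw[OF coprime_mult_mod_bij[OF cop c], symmetric])
  also have "\<dots> = (\<Prod>j\<in>{0..<c}. Uf (w_shift a c d j (z, \<tau>), \<tau>'))"
  proof (rule prod.cong[OF refl])
    fix j
    obtain m where m: "j - ((a * j) mod c) * d = c * m" using w_shift_dvd[OF det] by blast
    have "(of_int j - of_int ((a * j) mod c) * of_int d) / of_int c = (of_int (j - ((a * j) mod c) * d) / of_int c :: complex)"
      by simp
    also have "\<dots> = of_int m" unfolding m using c0 by simp
    finally have "w_shift a c d j (z, \<tau>) = z - of_int ((a * j) mod c) * \<tau> + of_int m"
      by (simp add: w_shift_def)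
    then show "Uf (z - of_int ((a * j) mod c) * \<tau>, \<tau>') = Uf (w_shift a c d j (z, \<tau>), \<tau>')"
      by (simp only: Uf_add_of_int)
  qed
  finally have 2: "Uf (z, \<tau>) = (\<Prod>j\<in>{0..<c}. Uf (w_shift a c d j (z, \<tau>), \<tau>'))" .
  show ?thesis
    unfolding \<tau>'_def[symmetric] \<sigma>_def[symmetric] 1 2 cocycle_S_def by (simp add: prod_dividef)
qed

text \<open>The lattice of \<open>c \<tau> + d\<close> is contained in that of
  \<open>\<tau>\<close>, and \<open>w_shift\<close> moves \<open>z\<close> by a vector of the
  latter.\<close>

lemma w_shift_Lat:
  fixes a b c d j :: int
  assumes det: "a * d - b * c = 1" and c: "c > 0"
    and L: "(w_shift a c d j (z, \<tau>), of_int c * \<tau> + of_int d) \<in> Lat"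
  shows "(z, \<tau>) \<in> Lat"
proof -
  obtain m where m: "j - ((a * j) mod c) * d = c * m" using w_shift_dvd[OF det] by blast
  have "(of_int j - of_int ((a * j) mod c) * of_int d) / of_int c = (of_int (j - ((a * j) mod c) * d) / of_int c :: complex)"
    by simp
  also have "\<dots> = of_int m" unfolding m using c by simp
  finally have w: "w_shift a c d j (z, \<tau>) = z - of_int ((a * j) mod c) * \<tau> + of_int m"
    by (simp add: w_shift_def)
  obtain k l :: int where "w_shift a c d j (z, \<tau>) = of_int k + of_int l * (of_int c * \<tau> + of_int d)"
    using L by (auto simp: mem_Lat)
  then have "z = of_int (k + l * d - m) + of_int (l * c + (a * j) mod c) * \<tau>"
    unfolding w by (simp add: algebra_simps)
  then show ?thesis unfolding mem_Lat by blast
qed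

lemma open_denom_slit: "open (UNIV \<times> {\<tau>. of_int c * \<tau> + of_int d \<notin> \<real>\<^sub>\<le>\<^sub>0} :: (complex \<times> complex) set)"
proof -
  have "open ((\<lambda>\<tau>. of_int c * \<tau> + of_int d :: complex) -` (- \<real>\<^sub>\<le>\<^sub>0))"
    by (rule open_vimage) (auto intro!: continuous_intros closed_nonpos_Reals_complex)
  then show ?thesis by (intro open_Times) (auto simp: vimage_def)
qed

lemma denom_not_real:
  fixes c d :: int
  assumes "c \<noteq> 0" "\<tau> \<notin> \<real>"
  shows "of_int c * \<tau> + of_int d \<notin> (\<real> :: complex set)"
  using assms by (auto simp: complex_is_Real_iff)

lemma loc_quot_cocycle_pos:
  fixes a b c d :: int
  assumes det: "a * d - b * c = 1" and c: "c > 0"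
  shows "loc_quot Gen Lat (\<lambda>p. Uf (fst p / (of_int c * snd p + of_int d), (of_int a * snd p + of_int b) / (of_int c * snd p + of_int d)) / Uf p)
    (UNIV \<times> {\<tau>. of_int c * \<tau> + of_int d \<notin> \<real>\<^sub>\<le>\<^sub>0})"
proof -
  let ?D = "UNIV \<times> {\<tau>. of_int c * \<tau> + of_int d \<notin> \<real>\<^sub>\<le>\<^sub>0} :: (complex \<times> complex) set"
  have "loc_quot Gen Lat (\<lambda>p. cocycle_S (w_shift a c d j p, of_int c * snd p + of_int d)) ?D" for j
  proof (rule loc_quot_compose[OF loc_quot_cocycle_S])
    show "holomorphic2_on (w_shift a c d j) ?D"
      unfolding w_shift_def[abs_def]
      by (intro holomorphic2_on_add holomorphic2_on_diff holomorphic2_on_mult holomorphic2_on_fst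
          holomorphic2_on_snd holomorphic2_on_const open_denom_slit)
    show "holomorphic2_on (\<lambda>p. of_int c * snd p + of_int d) ?D" by (rule holomorphic2_affine[OF open_denom_slit])
    fix p assume p: "p \<in> ?D"
    show "(w_shift a c d j p, of_int c * snd p + of_int d) \<in> UNIV \<times> - \<real>\<^sub>\<le>\<^sub>0" using p by auto
    have L: "(w_shift a c d j p, of_int c * snd p + of_int d) \<notin> Lat" if "p \<notin> Lat"
      using w_shift_Lat[OF det c, of j "fst p" "snd p"] that by auto
    then show "(w_shift a c d j p, of_int c * snd p + of_int d) \<notin> Lat" if "p \<notin> Lat" using that .
    show "(w_shift a c d j p, of_int c * snd p + of_int d) \<in> Gen" if g: "p \<in> Gen"
    proof -
      have "snd p \<notin> \<real>" using g by (cases p) (simp add: mem_Gen)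
      then show ?thesis using L[OF Gen_not_Lat[OF g]] denom_not_real[of c "snd p" d] c by (simp add: mem_Gen)
    qed
  qed
  then have "loc_quot Gen Lat (\<lambda>p. \<Prod>j\<in>{0..<c}. cocycle_S (w_shift a c d j p, of_int c * snd p + of_int d)) ?D"
    by (intro loc_quot_prod open_denom_slit)
  then show ?thesis
  proof (rule loc_quot_cong)
    fix x assume "x \<in> Gen"
    then show "(\<Prod>j\<in>{0..<c}. cocycle_S (w_shift a c d j x, of_int c * snd x + of_int d)) =
       Uf (fst x / (of_int c * snd x + of_int d), (of_int a * snd x + of_int b) / (of_int c * snd x + of_int d)) / Uf x"
      using Uf_act_eq_prod_cocycle_S[OF det c, of "fst x" "snd x"] by simp
  qed
qed

text \<open>The inverse matrix has rows \<open>(d, - b)\<close> and \<open>(- c, a)\<close>, hence a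
  positive lower left entry; its cocycle \<open>F\<close>, evaluated at the transformed point, is
  the reciprocal of the one wanted. The domains correspond because \<open>- c\<close> times the new
  modulus plus \<open>a\<close> is \<open>1 / (c \<tau> + d)\<close>, and inversion maps the slit
  plane to itself.\<close>

lemma loc_quot_cocycle_neg:
  fixes a b c d :: int
  assumes det: "a * d - b * c = 1" and c: "c < 0"
  shows "loc_quot Gen Lat (\<lambda>p. Uf (fst p / (of_int c * snd p + of_int d), (of_int a * snd p + of_int b) / (of_int c * snd p + of_int d)) / Uf p)
    (UNIV \<times> {\<tau>. of_int c * \<tau> + of_int d \<notin> \<real>\<^sub>\<le>\<^sub>0})"
proof -
  let ?D = "UNIV \<times> {\<tau>. of_int c * \<tau> + of_int d \<notin> \<real>\<^sub>\<le>\<^sub>0} :: (complex \<times> complex) set"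
  let ?f = "\<lambda>p. fst p / (of_int c * snd p + of_int d)" and ?g = "\<lambda>p. (of_int a * snd p + of_int b) / (of_int c * snd p + of_int d)"
  define F where "F = (\<lambda>p. Uf (fst p / (of_int (- c) * snd p + of_int a), (of_int d * snd p + of_int (- b)) / (of_int (- c) * snd p + of_int a)) / Uf p)"
  have det': "d * a - (- b) * (- c) = 1" using det by (simp add: mult.commute)
  have F: "loc_quot Gen Lat F (UNIV \<times> {\<tau>. of_int (- c) * \<tau> + of_int a \<notin> \<real>\<^sub>\<le>\<^sub>0})"
    unfolding F_def by (rule loc_quot_cocycle_pos[OF det']) (use c in simp)
  have nz: "of_int c * snd p + of_int d \<noteq> 0" if "p \<in> ?D" for p using that by auto
  have inv: "of_int (- c) * ?g p + of_int a = 1 / (of_int c * snd p + of_int d)"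
    "of_int d * ?g p + of_int (- b) = snd p / (of_int c * snd p + of_int d)" if "p \<in> ?D" for p
  proof -
    have d1: "of_int a * of_int d - of_int b * of_int c = (1::complex)"
      using det by (metis of_int_1 of_int_diff of_int_mult)
    have "of_int (- c) * ?g p + of_int a = (of_int a * of_int d - of_int b * of_int c) / (of_int c * snd p + of_int d)"
      using nz[OF that] by (simp add: field_simps)
    then show "of_int (- c) * ?g p + of_int a = 1 / (of_int c * snd p + of_int d)" by (simp only: d1)
    have "of_int d * ?g p + of_int (- b) = (of_int a * of_int d - of_int b * of_int c) * snd p / (of_int c * snd p + of_int d)"
      using nz[OF that] by (simp add: field_simps)
    then show "of_int d * ?g p + of_int (- b) = snd p / (of_int c * snd p + of_int d)" by (simp only: d1 mult_1_left)
  qed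
  have L: "(?f p, ?g p) \<notin> Lat" if "p \<in> ?D" "p \<notin> Lat" for p
    using Lat_act[OF nz[OF that(1)], of "fst p" a b] that(2) by auto
  have G: "(?f p, ?g p) \<in> Gen" if "p \<in> Gen" for p
    using Gen_act[OF det, of "fst p" "snd p"] that by simp
  have "loc_quot Gen Lat (\<lambda>p. F (?f p, ?g p)) ?D"
  proof (rule loc_quot_compose[OF F])
    show "holomorphic2_on ?f ?D" "holomorphic2_on ?g ?D"
      by (intro holomorphic2_on_divide holomorphic2_on_fst holomorphic2_affine open_denom_slit nz; assumption)+
    fix p assume p: "p \<in> ?D"
    have "1 / (of_int c * snd p + of_int d) \<notin> \<real>\<^sub>\<le>\<^sub>0"
    proof
      assume "1 / (of_int c * snd p + of_int d) \<in> \<real>\<^sub>\<le>\<^sub>0"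
      then obtain r where r: "1 / (of_int c * snd p + of_int d) = of_real r" "r \<le> 0" by (auto simp: nonpos_Reals_def)
      then have "of_int c * snd p + of_int d = of_real (1 / r)"
        using nz[OF p] by (metis of_real_1 of_real_divide divide_divide_eq_right mult_1 div_by_1)
      moreover have "1 / r \<le> 0" using r(2) by simp
      ultimately have "of_int c * snd p + of_int d \<in> \<real>\<^sub>\<le>\<^sub>0" by (metis nonpos_Reals_of_real_iff)
      then show False using p by auto
    qed
    then show "(?f p, ?g p) \<in> UNIV \<times> {\<tau>. of_int (- c) * \<tau> + of_int a \<notin> \<real>\<^sub>\<le>\<^sub>0}"
      using inv(1)[OF p] by simp
  qed (use G L in blast)+
  from loc_quot_inverse[OF this] show ?thesis
  proof (rule loc_quot_cong)
    fix x assume x: "x \<in> ?D" "x \<in> Gen"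
    have "?f x / (of_int (- c) * ?g x + of_int a) = fst x" "(of_int d * ?g x + of_int (- b)) / (of_int (- c) * ?g x + of_int a) = snd x"
      unfolding inv[OF x(1)] using nz[OF x(1)] by simp_all
    then have "F (?f x, ?g x) = Uf x / Uf (?f x, ?g x)" unfolding F_def by simp
    then show "inverse (F (?f x, ?g x)) = Uf (?f x, ?g x) / Uf x" by simp
  qed
qed

text \<open>Off the real axis no integral is involved. This serves the case \<open>c = 0\<close>,
  and for every matrix the values at generic points.\<close>

lemma loc_quot_cocycle:
  fixes a b c d :: int
  assumes det: "a * d - b * c = 1"
  shows "loc_quot Gen Lat (\<lambda>p. Uf (fst p / (of_int c * snd p + of_int d), (of_int a * snd p + of_int b) / (of_int c * snd p + of_int d)) / Uf p)
    (UNIV \<times> - \<real>)"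
  by (rule loc_quot_divide[OF loc_quot_Uf_act[OF det] loc_quot_Uf])

section \<open>Density of generic points\<close>

lemma closure_eq_UNIV_I:
  fixes G :: "(complex \<times> complex) set"
  assumes "\<And>A B. open A \<Longrightarrow> open B \<Longrightarrow> A \<noteq> {} \<Longrightarrow> B \<noteq> {} \<Longrightarrow> \<exists>a\<in>A. \<exists>b\<in>B. (a, b) \<in> G"
  shows "closure G = UNIV"
proof (rule ccontr)
  assume "closure G \<noteq> UNIV"
  then obtain p where "p \<in> - closure G" by blast
  moreover have "open (- closure G)" by (intro open_Compl closed_closure)
  ultimately obtain A B where AB: "open A" "open B" "p \<in> A \<times> B" "A \<times> B \<subseteq> - closure G"
    using open_prod_elim by metis
  then have "A \<noteq> {}" "B \<noteq> {}" by auto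
  then obtain a b where "a \<in> A" "b \<in> B" "(a, b) \<in> G" using assms[OF AB(1,2)] by blast
  then have "(a, b) \<in> A \<times> B" by simp
  then have "(a, b) \<in> - closure G" using AB(4) by (rule subsetD[rotated])
  moreover have "(a, b) \<in> closure G" using closure_subset \<open>(a, b) \<in> G\<close> by (rule subsetD)
  ultimately show False by simp
qed

lemma countable_lattice: "countable {of_int m + of_int n * \<tau> | m n :: int. True}"
  for \<tau> :: complex
proof -
  have "{of_int m + of_int n * \<tau> | m n :: int. True} = (\<lambda>(m, n). of_int m + of_int n * \<tau>) ` (UNIV \<times> UNIV :: (int \<times> int) set)"
    by auto
  then show ?thesis by simp
qed

lemma open_not_countable:
  fixes A :: "complex set"
  assumes "open A" "A \<noteq> {}" "countable C"
  shows "\<exists>a\<in>A. a \<notin> C"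
proof -
  obtain a where "a \<in> A" using assms(2) by blast
  then obtain r where r: "r > 0" "ball a r \<subseteq> A" using assms(1) unfolding open_contains_ball by blast
  have "\<not> ball a r \<subseteq> C" using uncountable_ball[OF r(1), of a] assms(3) countable_subset by blast
  then show ?thesis using r(2) by blast
qed

text \<open>For \<open>Gen_b\<close> the modulus is \<open>b\<^sup>2\<close>, with imaginary part
  \<open>2 * Re b * Im b\<close>; hence both parts of \<open>b\<close> should be nonzero.\<close>

lemma open_ex_Re_Im:
  fixes B :: "complex set"
  assumes "open B" "B \<noteq> {}"
  shows "\<exists>b\<in>B. Re b \<noteq> 0 \<and> Im b \<noteq> 0"
proof -
  obtain b where b: "b \<in> B" using assms(2) by blast
  then obtain r where r: "r > 0" "ball b r \<subseteq> B" using assms(1) unfolding open_contains_ball by blast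
  \<comment> \<open>Along the diagonal direction each of the two conditions excludes a single value
    of \<open>t\<close>.\<close>
  have "infinite ({0<..<r / 2} - {- Re b, - Im b})"
    using r(1) by (intro Diff_infinite_finite) auto
  then obtain t where "t \<in> {0<..<r / 2} - {- Re b, - Im b}" using infinite_imp_nonempty by blast
  then have t: "0 < t" "t < r / 2" "t \<noteq> - Re b" "t \<noteq> - Im b" by simp_all
  let ?b = "b + Complex t t"
  have "norm (Complex t t) \<le> \<bar>t\<bar> + \<bar>t\<bar>" using cmod_le[of "Complex t t"] by simp
  then have "?b \<in> ball b r" using t by (simp add: dist_norm)
  then show ?thesis using r(2) t by (intro bexI[of _ ?b]) auto
qed

lemma closure_Gen: "closure Gen = UNIV"
proof (rule closure_eq_UNIV_I)
  fix A B :: "complex set" assume AB: "open A" "open B" "A \<noteq> {}" "B \<noteq> {}"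
  obtain \<tau> where \<tau>: "\<tau> \<in> B" "Im \<tau> \<noteq> 0" using open_ex_Re_Im[OF AB(2,4)] by blast
  obtain z where z: "z \<in> A" "z \<notin> {of_int m + of_int n * \<tau> | m n :: int. True}"
    using open_not_countable[OF AB(1,3) countable_lattice] by blast
  then have "(z, \<tau>) \<in> Gen" using \<tau> by (auto simp: mem_Gen mem_Lat complex_is_Real_iff)
  then show "\<exists>a\<in>A. \<exists>b\<in>B. (a, b) \<in> Gen" using \<tau> z by blast
qed

text \<open>The inverse of the substitution \<open>x = \<i> z / b + \<i> b / 2 + 1 / (2 \<i> b)\<close>.\<close>

definition zeta :: "complex \<times> complex \<Rightarrow> complex" where
  "zeta p = - \<i> * snd p * fst p - (snd p)\<^sup>2 / 2 + 1 / 2"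

definition Gen_b :: "(complex \<times> complex) set" where
  "Gen_b = {p. (zeta p, (snd p)\<^sup>2) \<in> Gen}"

definition Lat_b :: "(complex \<times> complex) set" where
  "Lat_b = {p. (zeta p, (snd p)\<^sup>2) \<in> Lat}"

text \<open>For fixed \<open>b \<noteq> 0\<close> the map \<open>zeta\<close> is affine and
  invertible in \<open>x\<close>, so the points lying over the lattice form a countable set.\<close>

lemma closure_Gen_b: "closure Gen_b = UNIV"
proof (rule closure_eq_UNIV_I)
  fix A B :: "complex set" assume AB: "open A" "open B" "A \<noteq> {}" "B \<noteq> {}"
  obtain b where b: "b \<in> B" "Re b \<noteq> 0" "Im b \<noteq> 0" using open_ex_Re_Im[OF AB(2,4)] by blast
  then have b0: "b \<noteq> 0" by auto
  have "Im (b\<^sup>2) \<noteq> 0" using b by (simp add: power2_eq_square)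
  define C where "C = (\<lambda>l. (l + b\<^sup>2 / 2 - 1 / 2) / (- \<i> * b)) ` {of_int m + of_int n * b\<^sup>2 | m n :: int. True}"
  have "countable C" unfolding C_def by (intro countable_image countable_lattice)
  then obtain x where x: "x \<in> A" "x \<notin> C" using open_not_countable[OF AB(1,3)] by blast
  have "(zeta (x, b), b\<^sup>2) \<notin> Lat"
  proof
    assume "(zeta (x, b), b\<^sup>2) \<in> Lat"
    then have "zeta (x, b) \<in> {of_int m + of_int n * b\<^sup>2 | m n :: int. True}" by (auto simp: mem_Lat)
    moreover have "x = (zeta (x, b) + b\<^sup>2 / 2 - 1 / 2) / (- \<i> * b)" using b0 by (simp add: zeta_def)
    ultimately have "x \<in> C" unfolding C_def by (rule image_eqI[rotated])
    then show False using x by simp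
  qed
  then have "(x, b) \<in> Gen_b" using \<open>Im (b\<^sup>2) \<noteq> 0\<close> by (simp add: Gen_b_def mem_Gen complex_is_Real_iff)
  then show "\<exists>a\<in>A. \<exists>b\<in>B. (a, b) \<in> Gen_b" using x b by blast
qed


section \<open>The identity theorem\<close>

text \<open>Restrict to the complex line through \<open>p\<close> and a point of \<open>T\<close>.
  Convexity of \<open>W\<close> makes its trace on this line connected, and the one-variable theorem
  applies.\<close>

lemma holomorphic2_identity:
  assumes f: "holomorphic2_on f W" and W: "convex W" and O: "open T" "T \<noteq> {}" "T \<subseteq> W"
    and zero: "\<And>x. x \<in> T \<Longrightarrow> f x = 0" and p: "p \<in> W"
  shows "f p = 0"
proof -
  have oW: "open W" using f by (simp add: holomorphic2_on_def)
  obtain q where q: "q \<in> T" using O by blast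
  define \<phi> where "\<phi> = (\<lambda>s. (fst q + s * (fst p - fst q), snd q + s * (snd p - snd q)))"
  define S where "S = \<phi> -` W"
  have cont: "continuous_on UNIV \<phi>" unfolding \<phi>_def by (intro continuous_intros)
  have S: "open S" unfolding S_def by (rule open_vimage[OF oW cont])
  have "convex S"
  proof (rule convexI)
    fix x y :: complex and u v :: real
    assume xy: "x \<in> S" "y \<in> S" and uv: "0 \<le> u" "0 \<le> v" "u + v = 1"
    have "u *\<^sub>R \<phi> x + v *\<^sub>R \<phi> y \<in> W" using convexD[OF W _ _ uv] xy by (simp add: S_def)
    moreover have "u *\<^sub>R \<phi> x + v *\<^sub>R \<phi> y = \<phi> (u *\<^sub>R x + v *\<^sub>R y)"
    proof -
      have v: "v = 1 - u" using uv by simp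
      show ?thesis unfolding v by (simp add: \<phi>_def scaleR_conv_of_real algebra_simps)
    qed
    ultimately show "u *\<^sub>R x + v *\<^sub>R y \<in> S" by (simp add: S_def)
  qed
  have hol: "(f \<circ> \<phi>) holomorphic_on S"
    unfolding holomorphic_on_def
  proof
    fix s assume "s \<in> S"
    then obtain A B where AB: "(f has_derivative (\<lambda>(u, v). A * u + B * v)) (at (\<phi> s))"
      using f by (auto simp: S_def holomorphic2_on_def)
    have "(\<phi> has_derivative (\<lambda>h. (h * (fst p - fst q), h * (snd p - snd q)))) (at s)"
      unfolding \<phi>_def by (auto intro!: derivative_eq_intros)
    from diff_chain_at[OF this AB]
    have "((f \<circ> \<phi>) has_derivative (\<lambda>(u, v). A * u + B * v) \<circ> (\<lambda>h. (h * (fst p - fst q), h * (snd p - snd q)))) (at s)" .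
    moreover have "(\<lambda>(u, v). A * u + B * v) \<circ> (\<lambda>h. (h * (fst p - fst q), h * (snd p - snd q)))
        = (*) (A * (fst p - fst q) + B * (snd p - snd q))"
      by (rule ext) (simp add: algebra_simps)
    ultimately have "((f \<circ> \<phi>) has_derivative (*) (A * (fst p - fst q) + B * (snd p - snd q))) (at s)" by simp
    then have "(f \<circ> \<phi>) field_differentiable at s"
      unfolding field_differentiable_def has_field_derivative_def by blast
    then show "(f \<circ> \<phi>) field_differentiable at s within S" by (rule field_differentiable_at_within)
  qed
  have oT: "open (\<phi> -` T)" by (rule open_vimage[OF O(1) cont])
  have "0 \<in> \<phi> -` T" using q by (simp add: \<phi>_def)
  then have ne: "\<phi> -` T \<noteq> {}" by blast
  have conn: "connected S" by (rule convex_connected[OF \<open>convex S\<close>])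
  have sub: "\<phi> -` T \<subseteq> S" unfolding S_def by (rule vimage_mono[OF O(3)])
  have one: "1 \<in> S" using p by (simp add: S_def \<phi>_def)
  have "(f \<circ> \<phi>) 1 = 0"
    by (rule analytic_continuation_open[where g = "\<lambda>_. 0", OF oT S ne conn sub hol _ _ one])
       (simp_all add: zero)
  then show ?thesis by (simp add: \<phi>_def)
qed

lemma open_nonzero:
  fixes h :: "complex \<times> complex \<Rightarrow> complex"
  assumes "holomorphic2_on h W" "open T" "T \<subseteq> W"
  shows "open {x \<in> T. h x \<noteq> 0}"
proof -
  have "open (T \<inter> h -` (- {0}))"
    by (rule continuous_open_preimage[OF continuous_on_subset[OF holomorphic2_on_imp_continuous_on[OF assms(1)] assms(3)] assms(2)])
       (intro open_Compl closed_singleton)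
  moreover have "T \<inter> h -` (- {0}) = {x \<in> T. h x \<noteq> 0}" by auto
  ultimately show ?thesis by simp
qed

text \<open>The values of a meromorphic function on its polar set are arbitrary, so equality propagates only
  generically: the set of points that are limits of open sets of agreement is open and closed.\<close>

lemma meromorphic2_identity:
  assumes F: "meromorphic2_on F1 D" "meromorphic2_on F2 D"
    and C: "open C" "connected C" "C \<subseteq> D"
    and T: "open T" "T \<noteq> {}" "T \<subseteq> C" "\<And>x. x \<in> T \<Longrightarrow> F1 x = F2 x"
    and p: "p \<in> C" "holomorphic2_at F1 p" "holomorphic2_at F2 p"
  shows "F1 p = F2 p"
proof -
  define E where "E = {q \<in> C. \<forall>U. open U \<and> q \<in> U \<longrightarrow> (\<exists>V. open V \<and> V \<noteq> {} \<and> V \<subseteq> U \<and> (\<forall>x\<in>V. F1 x = F2 x))}"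
  have E_D: "\<exists>V. open V \<and> V \<noteq> {} \<and> V \<subseteq> U \<and> (\<forall>x\<in>V. F1 x = F2 x)" if "q \<in> E" "open U" "q \<in> U" for q U
    using that unfolding E_def by blast
  \<comment> \<open>Openness of \<open>E\<close> and of its complement in \<open>C\<close> both
    follow from this alternative.\<close>
  have local: "\<exists>B. open B \<and> q \<in> B \<and> B \<subseteq> C \<and> (B \<inter> E = {} \<or> B \<subseteq> E)" if q: "q \<in> C" for q
  proof -
    have "q \<in> D" using q C(3) by blast
    obtain W1 g1 h1 where 1: "q \<in> W1" "holomorphic2_on g1 W1" "holomorphic2_on h1 W1"
      "\<And>U. open U \<Longrightarrow> U \<noteq> {} \<Longrightarrow> U \<subseteq> W1 \<Longrightarrow> \<exists>x\<in>U. h1 x \<noteq> 0" "\<And>x. x \<in> W1 \<Longrightarrow> h1 x \<noteq> 0 \<Longrightarrow> F1 x = g1 x / h1 x"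
      using F(1)[unfolded meromorphic2_on_def, THEN conjunct2, THEN bspec, OF \<open>q \<in> D\<close>] by (elim exE conjE) blast
    obtain W2 g2 h2 where 2: "q \<in> W2" "holomorphic2_on g2 W2" "holomorphic2_on h2 W2"
      "\<And>U. open U \<Longrightarrow> U \<noteq> {} \<Longrightarrow> U \<subseteq> W2 \<Longrightarrow> \<exists>x\<in>U. h2 x \<noteq> 0" "\<And>x. x \<in> W2 \<Longrightarrow> h2 x \<noteq> 0 \<Longrightarrow> F2 x = g2 x / h2 x"
      using F(2)[unfolded meromorphic2_on_def, THEN conjunct2, THEN bspec, OF \<open>q \<in> D\<close>] by (elim exE conjE) blast
    have "open (W1 \<inter> W2 \<inter> C)" using 1(2) 2(2) C(1) by (simp add: holomorphic2_on_def open_Int)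
    then obtain r where r: "r > 0" "ball q r \<subseteq> W1 \<inter> W2 \<inter> C"
      using 1(1) 2(1) q unfolding open_contains_ball by blast
    define B where "B = ball q r"
    have B: "open B" "q \<in> B" "B \<subseteq> W1" "B \<subseteq> W2" "B \<subseteq> C" "convex B" using r by (auto simp: B_def)
    have gen: "\<exists>V. open V \<and> V \<noteq> {} \<and> V \<subseteq> U \<and> (\<forall>x\<in>V. h1 x \<noteq> 0 \<and> h2 x \<noteq> 0)"
      if U: "open U" "U \<noteq> {}" "U \<subseteq> B" for U
    proof -
      let ?U1 = "{x \<in> U. h1 x \<noteq> 0}"
      have U1: "open ?U1" by (rule open_nonzero[OF 1(3) U(1)]) (use U(3) B(3) in blast)
      have U1n: "?U1 \<noteq> {}" using 1(4)[OF U(1,2)] U(3) B(3) by blast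
      let ?U2 = "{x \<in> ?U1. h2 x \<noteq> 0}"
      have U2: "open ?U2" by (rule open_nonzero[OF 2(3) U1]) (use U(3) B(4) in blast)
      have U2n: "?U2 \<noteq> {}" using 2(4)[OF U1 U1n] U(3) B(4) by blast
      show ?thesis using U2 U2n by (intro exI[of _ ?U2]) blast
    qed
    have "B \<subseteq> E" if "B \<inter> E \<noteq> {}"
    proof -
      obtain e where e: "e \<in> B" "e \<in> E" using \<open>B \<inter> E \<noteq> {}\<close> by blast
      obtain V where V: "open V" "V \<noteq> {}" "V \<subseteq> B" "\<And>x. x \<in> V \<Longrightarrow> F1 x = F2 x" using E_D[OF e(2) B(1) e(1)] by blast
      obtain V' where V': "open V'" "V' \<noteq> {}" "V' \<subseteq> V" "\<And>x. x \<in> V' \<Longrightarrow> h1 x \<noteq> 0 \<and> h2 x \<noteq> 0" using gen[OF V(1-3)] by blast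
      \<comment> \<open>Cross-multiplied, agreement becomes the vanishing of a holomorphic function,
        which spreads from \<open>V'\<close> to the whole ball. Dividing back is possible on some
        open part of every open subset, and that is all \<open>E\<close> asks for.\<close>
      have hol: "holomorphic2_on (\<lambda>x. g1 x * h2 x - g2 x * h1 x) B"
        by (intro holomorphic2_on_diff holomorphic2_on_mult holomorphic2_on_subset[OF 1(2) B(1,3)]
            holomorphic2_on_subset[OF 1(3) B(1,3)] holomorphic2_on_subset[OF 2(2) B(1,4)] holomorphic2_on_subset[OF 2(3) B(1,4)])
      have "V' \<subseteq> B" using V' V by blast
      have eq: "g1 x * h2 x - g2 x * h1 x = 0" if "x \<in> B" for x
      proof (rule holomorphic2_identity[OF hol B(6) V'(1,2) \<open>V' \<subseteq> B\<close> _ that])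
        fix y assume y: "y \<in> V'"
        have "y \<in> V" "y \<in> B" using y V' V by auto
        then have "y \<in> W1" "y \<in> W2" using B by auto
        have "g1 y / h1 y = g2 y / h2 y"
          using 1(5)[OF \<open>y \<in> W1\<close>] 2(5)[OF \<open>y \<in> W2\<close>] V'(4)[OF y] V(4)[OF \<open>y \<in> V\<close>] by simp
        then show "g1 y * h2 y - g2 y * h1 y = 0" using V'(4)[OF y] by (simp add: field_simps)
      qed
      show ?thesis
      proof
        fix x assume x: "x \<in> B"
        have "\<exists>V. open V \<and> V \<noteq> {} \<and> V \<subseteq> U \<and> (\<forall>x\<in>V. F1 x = F2 x)" if U: "open U" "x \<in> U" for U
        proof -
          have "open (U \<inter> B)" "U \<inter> B \<noteq> {}" using U B x by auto
          then obtain V where V: "open V" "V \<noteq> {}" "V \<subseteq> U \<inter> B" "\<And>x. x \<in> V \<Longrightarrow> h1 x \<noteq> 0 \<and> h2 x \<noteq> 0" using gen[of "U \<inter> B"] by auto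
          have "F1 y = F2 y" if y: "y \<in> V" for y
          proof -
            have yB: "y \<in> B" using y V(3) by blast
            have "F1 y = g1 y / h1 y" using 1(5)[OF subsetD[OF B(3) yB]] V(4)[OF y] by blast
            moreover have "F2 y = g2 y / h2 y" using 2(5)[OF subsetD[OF B(4) yB]] V(4)[OF y] by blast
            ultimately show ?thesis using eq[OF yB] V(4)[OF y] by (simp add: frac_eq_eq)
          qed
          then show ?thesis using V by (intro exI[of _ V]) auto
        qed
        then show "x \<in> E" using x B(5) unfolding E_def by blast
      qed
    qed
    then show ?thesis using B by blast
  qed
  have oE: "open E"
    unfolding open_subopen[of E]
  proof
    fix q assume q: "q \<in> E"
    then have "q \<in> C" by (simp add: E_def)
    then show "\<exists>T. open T \<and> q \<in> T \<and> T \<subseteq> E" using local[of q] q by blast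
  qed
  have oN: "open (C - E)"
    unfolding open_subopen[of "C - E"]
  proof
    fix q assume q: "q \<in> C - E"
    then show "\<exists>T. open T \<and> q \<in> T \<and> T \<subseteq> C - E" using local[of q] by blast
  qed
  have "T \<subseteq> E"
  proof
    fix x assume x: "x \<in> T"
    have "\<exists>V. open V \<and> V \<noteq> {} \<and> V \<subseteq> U \<and> (\<forall>x\<in>V. F1 x = F2 x)" if "open U" "x \<in> U" for U
      using that x T by (intro exI[of _ "U \<inter> T"]) auto
    then show "x \<in> E" using x T(3) unfolding E_def by blast
  qed
  then have "E \<inter> C \<noteq> {}" using T(2,3) by blast
  then have "(C - E) \<inter> C = {}"
    using connectedD[OF C(2) oE oN] by blast
  then have pE: "p \<in> E" using p(1) by blast
  obtain W1 where W1: "p \<in> W1" "holomorphic2_on F1 W1" using p(2) by (auto simp: holomorphic2_at_def)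
  obtain W2 where W2: "p \<in> W2" "holomorphic2_on F2 W2" using p(3) by (auto simp: holomorphic2_at_def)
  have o: "open (W1 \<inter> W2)" using W1 W2 by (simp add: holomorphic2_on_def open_Int)
  have hol: "holomorphic2_on (\<lambda>x. F1 x - F2 x) (W1 \<inter> W2)"
    by (intro holomorphic2_on_diff holomorphic2_on_subset[OF W1(2) o] holomorphic2_on_subset[OF W2(2) o]) auto
  \<comment> \<open>Membership in \<open>E\<close> gives agreement arbitrarily close to
    \<open>p\<close>, not at \<open>p\<close>. Holomorphy of both functions closes the gap, as a
    difference at \<open>p\<close> would persist nearby.\<close>
  show ?thesis
  proof (rule ccontr)
    assume "F1 p \<noteq> F2 p"
    let ?N = "{x \<in> W1 \<inter> W2. F1 x - F2 x \<noteq> 0}"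
    have "open ?N" by (rule open_nonzero[OF hol o]) simp
    moreover have "p \<in> ?N" using W1 W2 \<open>F1 p \<noteq> F2 p\<close> by simp
    ultimately obtain V where "V \<noteq> {}" "V \<subseteq> ?N" "\<forall>x\<in>V. F1 x = F2 x" using E_D[OF pE, of ?N] by blast
    then show False by auto
  qed
qed

section \<open>The quantum dilogarithm\<close>

lemma exp_eq_ee: "exp (2 * of_real pi * u) = ee (- \<i> * u)"
  by (simp add: ee_def algebra_simps)

text \<open>In the variable \<open>zeta\<close>, numerator and denominator of the quantum
  dilogarithm are \<open>Uf\<close> at a point and at its image under \<open>S_mat\<close>. Their
  quotient is therefore the reciprocal of \<open>cocycle_S\<close>.\<close>

lemma faddeev_num_eq:
  assumes "Im (b\<^sup>2) > 0"
  shows "faddeev_num b x = Uf (zeta (x, b), b\<^sup>2)"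
proof -
  have b0: "b \<noteq> 0" using assms by auto
  have "- \<i> * (b * (x + c_b b)) = zeta (x, b) + b\<^sup>2"
    using b0 by (simp add: c_b_def zeta_def field_simps power2_eq_square)
  then have "exp (2 * of_real pi * b * (x + c_b b)) = ee (zeta (x, b) + b\<^sup>2)"
    using exp_eq_ee[of "b * (x + c_b b)"] by (simp only: mult.assoc)
  then show ?thesis by (simp add: faddeev_num_def Uf_upper[OF assms])
qed

lemma faddeev_den_eq:
  assumes "Im (b\<^sup>2) > 0"
  shows "faddeev_den b x = Uf (zeta (x, b) / b\<^sup>2, - (1 / b\<^sup>2))"
proof -
  have b0: "b \<noteq> 0" using assms by auto
  have im: "Im (- (1 / b\<^sup>2)) > 0" using Im_inverse_neg[OF assms] by (simp add: inverse_eq_divide)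
  have "- \<i> * (inverse b * (x - c_b b)) = zeta (x, b) / b\<^sup>2 + - (1 / b\<^sup>2)"
    using b0 by (simp add: c_b_def zeta_def field_simps power2_eq_square)
  then have "exp (2 * of_real pi * inverse b * (x - c_b b)) = ee (zeta (x, b) / b\<^sup>2 + - (1 / b\<^sup>2))"
    using exp_eq_ee[of "inverse b * (x - c_b b)"] by (simp only: mult.assoc)
  then show ?thesis unfolding Uf_upper[OF im] by (simp add: faddeev_den_def inverse_eq_divide)
qed

lemma holomorphic2_on_power2: "holomorphic2_on f S \<Longrightarrow> holomorphic2_on (\<lambda>p. (f p)\<^sup>2) S"
  by (simp add: power2_eq_square holomorphic2_on_mult)

lemma holomorphic2_on_zeta: "open S \<Longrightarrow> holomorphic2_on zeta S"
  unfolding zeta_def[abs_def] divide_inverse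
  by (intro holomorphic2_on_add holomorphic2_on_diff holomorphic2_on_mult holomorphic2_on_power2
      holomorphic2_on_fst holomorphic2_on_snd holomorphic2_on_const)

definition b_dom :: "complex set" where
  "b_dom = {b. b\<^sup>2 \<notin> \<real>\<^sub>\<le>\<^sub>0}"

lemma open_b_dom: "open b_dom"
proof -
  have "open ((\<lambda>b::complex. b\<^sup>2) -` (- \<real>\<^sub>\<le>\<^sub>0))"
    by (rule open_vimage) (intro open_Compl closed_nonpos_Reals_complex continuous_intros)+
  then show ?thesis by (simp add: b_dom_def vimage_def)
qed

lemma open_UNIV_b_dom: "open (UNIV \<times> b_dom :: (complex \<times> complex) set)"
  by (intro open_Times open_b_dom open_UNIV)

text \<open>An explicit witness for \<open>faddeev_continuation\<close>. The raw reciprocal carries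
  conventional values where \<open>b\<^sup>2\<close> is real, hence the extension from
  \<open>Gen_b\<close>.\<close>

definition Phi :: "complex \<times> complex \<Rightarrow> complex" where
  "Phi = dense_ext Gen_b (\<lambda>p. inverse (cocycle_S (zeta p, (snd p)\<^sup>2)))"

lemma loc_quot_Phi: "loc_quot Gen_b Lat_b (\<lambda>p. inverse (cocycle_S (zeta p, (snd p)\<^sup>2))) (UNIV \<times> b_dom)"
proof (rule loc_quot_compose[OF loc_quot_inverse[OF loc_quot_cocycle_S]])
  show "holomorphic2_on zeta (UNIV \<times> b_dom)" by (rule holomorphic2_on_zeta[OF open_UNIV_b_dom])
  show "holomorphic2_on (\<lambda>p. (snd p)\<^sup>2) (UNIV \<times> b_dom)"
    by (intro holomorphic2_on_power2 holomorphic2_on_snd open_UNIV_b_dom)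
qed (auto simp: b_dom_def Gen_b_def Lat_b_def)

text \<open>Off \<open>L\<close> the extension is holomorphic, so its composite with the
  substitution is a continuous function that agrees with the composed raw function at generic
  points.\<close>

lemma dense_ext_compose:
  assumes G: "closure G = UNIV" and G': "closure G' = UNIV" and F: "loc_quot G L F D"
    and f: "holomorphic2_on f D'" and g: "holomorphic2_on g D'"
    and GG: "\<And>p. p \<in> D' \<Longrightarrow> p \<in> G' \<Longrightarrow> (f p, g p) \<in> G"
    and p: "p \<in> D'" "(f p, g p) \<in> D" "(f p, g p) \<notin> L"
  shows "dense_ext G' (\<lambda>p. F (f p, g p)) p = dense_ext G F (f p, g p)"
proof -
  from loc_quot_holomorphic2_at[OF G F p(2,3)] obtain W where W: "(f p, g p) \<in> W" "holomorphic2_on (dense_ext G F) W"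
    by (auto simp: holomorphic2_at_def)
  have oD': "open D'" using f by (simp add: holomorphic2_on_def)
  have "open D" using F by (simp add: loc_quot_def)
  moreover have "open W" using W(2) by (simp add: holomorphic2_on_def)
  ultimately have oWD: "open (W \<inter> D)" by (rule open_Int[rotated])
  let ?V = "D' \<inter> (\<lambda>p. (f p, g p)) -` (W \<inter> D)"
  have oV: "open ?V"
    by (rule continuous_open_preimage)
       (intro continuous_on_Pair holomorphic2_on_imp_continuous_on f g, rule oD', rule oWD)
  show ?thesis
  proof (rule dense_ext_eq[OF G' oV])
    show "p \<in> ?V" using p W by simp
    have "holomorphic2_on (\<lambda>p. dense_ext G F (f p, g p)) ?V"
      using holomorphic2_on_compose[OF W(2) holomorphic2_on_subset[OF f oV] holomorphic2_on_subset[OF g oV]] by simp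
    then show "isCont (\<lambda>p. dense_ext G F (f p, g p)) p"
      by (rule holomorphic2_on_isCont) fact
    fix x assume x: "x \<in> ?V" "x \<in> G'"
    then have "(f x, g x) \<in> G" using GG by blast
    moreover have "(f x, g x) \<in> D" using x by simp
    ultimately show "F (f x, g x) = dense_ext G F (f x, g x)" using dense_ext_on[OF G F] by simp
  qed
qed

lemma holomorphic2_faddeev_num:
  "holomorphic2_on (\<lambda>p. faddeev_num (snd p) (fst p)) {p. 0 < Im ((snd p)\<^sup>2)}" (is "holomorphic2_on _ ?W")
proof (rule holomorphic2_on_cong)
  have oW: "open ?W" by (intro open_Collect_less continuous_intros)
  show "holomorphic2_on (\<lambda>p. qpoch (ee (zeta p + (snd p)\<^sup>2)) (ee ((snd p)\<^sup>2))) ?W"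
    by (intro holomorphic2_on_qpoch holomorphic2_on_ee holomorphic2_on_add holomorphic2_on_zeta
        holomorphic2_on_power2 holomorphic2_on_snd oW) (auto intro: norm_ee_less_1)
  show "qpoch (ee (zeta p + (snd p)\<^sup>2)) (ee ((snd p)\<^sup>2)) = faddeev_num (snd p) (fst p)" if "p \<in> ?W" for p
    using that by (simp add: faddeev_num_eq Uf_upper)
qed

lemma holomorphic2_faddeev_den:
  "holomorphic2_on (\<lambda>p. faddeev_den (snd p) (fst p)) {p. 0 < Im ((snd p)\<^sup>2)}" (is "holomorphic2_on _ ?W")
proof (rule holomorphic2_on_cong)
  let ?M = "\<lambda>p. qpoch (ee (zeta p / (snd p)\<^sup>2 + - (1 / (snd p)\<^sup>2))) (ee (- (1 / (snd p)\<^sup>2)))"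
  have oW: "open ?W" by (intro open_Collect_less continuous_intros)
  have im: "Im (- (1 / (snd p)\<^sup>2)) > 0" if "p \<in> ?W" for p
    using Im_inverse_neg[of "(snd p)\<^sup>2"] that by (simp add: inverse_eq_divide)
  have nz: "(snd p)\<^sup>2 \<noteq> 0" if "p \<in> ?W" for p using that by auto
  have z2: "holomorphic2_on zeta ?W" "holomorphic2_on (\<lambda>p. (snd p)\<^sup>2) ?W"
    by (intro holomorphic2_on_zeta holomorphic2_on_power2 holomorphic2_on_snd oW)+
  have inv: "holomorphic2_on (\<lambda>p. - (1 / (snd p)\<^sup>2)) ?W"
    by (rule holomorphic2_on_minus, rule holomorphic2_on_divide[OF holomorphic2_on_const[OF oW] z2(2)]) (rule nz)
  show "holomorphic2_on ?M ?W"
    by (intro holomorphic2_on_qpoch holomorphic2_on_ee holomorphic2_on_add inv holomorphic2_on_divide[OF z2] nz norm_ee_less_1 im)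
  show "?M p = faddeev_den (snd p) (fst p)" if "p \<in> ?W" for p
    using that im[OF that] by (simp add: faddeev_den_eq Uf_upper)
qed

lemma faddeev_continuation_Phi: "faddeev_continuation Phi"
  unfolding faddeev_continuation_def
proof (intro conjI allI impI)
  show "meromorphic2_on Phi (UNIV \<times> {b. b\<^sup>2 \<notin> \<real>\<^sub>\<le>\<^sub>0})"
    unfolding Phi_def b_dom_def[symmetric] by (rule loc_quot_meromorphic2[OF closure_Gen_b loc_quot_Phi])
  fix b x assume *: "0 < Im (b\<^sup>2) \<and> faddeev_den b x \<noteq> 0"
  have "Phi (x, b) = faddeev_num (snd (x, b)) (fst (x, b)) / faddeev_den (snd (x, b)) (fst (x, b))"
    unfolding Phi_def
  proof (rule dense_ext_quotient[OF closure_Gen_b holomorphic2_faddeev_num holomorphic2_faddeev_den])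
    show "(x, b) \<in> {p. 0 < Im ((snd p)\<^sup>2)}" "faddeev_den (snd (x, b)) (fst (x, b)) \<noteq> 0" using * by simp_all
    fix p :: "complex \<times> complex" assume "p \<in> {p. 0 < Im ((snd p)\<^sup>2)}"
    \<comment> \<open>Inversion swaps numerator and denominator even at their zeros, as
      \<open>inverse 0 = 0\<close>.\<close>
    then show "inverse (cocycle_S (zeta p, (snd p)\<^sup>2)) = faddeev_num (snd p) (fst p) / faddeev_den (snd p) (fst p)"
      by (simp add: cocycle_S_def faddeev_den_eq faddeev_num_eq)
  qed
  then show "Phi (x, b) = faddeev_num b x / faddeev_den b x" by simp
qed

text \<open>The half plane \<open>Re b > 0\<close> is a connected part of the domain that contains
  \<open>csqrt \<tau>\<close> for every \<open>\<tau>\<close> off the slit. It meets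
  \<open>Im (b\<^sup>2) > 0\<close>, where the product formula determines both functions on a
  nonempty open set.\<close>

lemma faddeev_continuation_unique:
  assumes P: "faddeev_continuation P" and Q: "faddeev_continuation Q"
    and b: "Re b > 0" and hol: "holomorphic2_at P (x, b)" "holomorphic2_at Q (x, b)"
  shows "P (x, b) = Q (x, b)"
proof -
  let ?C = "UNIV \<times> {b. Re b > 0} :: (complex \<times> complex) set"
  have oC: "open ?C" by (intro open_Times open_halfspace_Re_gt open_UNIV)
  let ?W = "{p. 0 < Im ((snd p)\<^sup>2)} :: (complex \<times> complex) set"
  have oW: "open ?W" by (intro open_Collect_less continuous_intros)
  \<comment> \<open>The square of \<open>1 + \<i>\<close> is \<open>2 \<i>\<close>.\<close>
  have "(0, Complex 1 1) \<in> ?C \<inter> ?W" by (simp add: power2_eq_square)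
  then have "Gen_b \<inter> (?C \<inter> ?W) \<noteq> {}"
    using open_Int_closure_eq_empty[OF open_Int[OF oC oW], of Gen_b] closure_Gen_b by blast
  then obtain p where p: "p \<in> Gen_b" "p \<in> ?C" "p \<in> ?W" by blast
  let ?T = "{q \<in> ?C \<inter> ?W. faddeev_den (snd q) (fst q) \<noteq> 0}"
  have oT: "open ?T" by (rule open_nonzero[OF holomorphic2_faddeev_den open_Int[OF oC oW]]) blast
  have "faddeev_den (snd p) (fst p) \<noteq> 0"
  proof -
    have "(zeta p, (snd p)\<^sup>2) \<in> Gen" using p(1) by (simp add: Gen_b_def)
    then have "(zeta p / (snd p)\<^sup>2, - (1 / (snd p)\<^sup>2)) \<in> Gen"
      using Gen_act[of 0 0 "-1" 1 "zeta p" "(snd p)\<^sup>2"] by simp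
    from Uf_nonzero[OF this] show ?thesis using p(3) by (simp add: faddeev_den_eq)
  qed
  then have T: "?T \<noteq> {}" using p by blast
  show ?thesis
  proof (rule meromorphic2_identity[where C = ?C and T = ?T])
    show "meromorphic2_on P (UNIV \<times> {b. b\<^sup>2 \<notin> \<real>\<^sub>\<le>\<^sub>0})" "meromorphic2_on Q (UNIV \<times> {b. b\<^sup>2 \<notin> \<real>\<^sub>\<le>\<^sub>0})"
      using P Q by (simp_all add: faddeev_continuation_def)
    show "connected ?C"
      by (intro connected_Times convex_connected convex_halfspace_Re_gt) simp
    show "?C \<subseteq> UNIV \<times> {b. b\<^sup>2 \<notin> \<real>\<^sub>\<le>\<^sub>0}"
    proof
      fix q assume "q \<in> ?C"
      then have re: "Re (snd q) > 0" by auto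
      have "(snd q)\<^sup>2 \<notin> \<real>\<^sub>\<le>\<^sub>0"
      proof
        assume "(snd q)\<^sup>2 \<in> \<real>\<^sub>\<le>\<^sub>0"
        then have "Im ((snd q)\<^sup>2) = 0" "Re ((snd q)\<^sup>2) \<le> 0" by (auto simp: complex_nonpos_Reals_iff)
        then have "Im (snd q) = 0" "(Re (snd q))\<^sup>2 \<le> (Im (snd q))\<^sup>2"
          using re by (auto simp: power2_eq_square)
        then show False using re by simp
      qed
      then show "q \<in> UNIV \<times> {b. b\<^sup>2 \<notin> \<real>\<^sub>\<le>\<^sub>0}" by (cases q) simp
    qed
    show "(x, b) \<in> ?C" using b by simp
    fix q assume q: "q \<in> ?T"
    then have "Im ((snd q)\<^sup>2) > 0 \<and> faddeev_den (snd q) (fst q) \<noteq> 0" by auto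
    then have "P (fst q, snd q) = Q (fst q, snd q)"
      using P Q unfolding faddeev_continuation_def by metis
    then show "P q = Q q" by simp
  qed (use oC oT T hol in auto)
qed

lemma faddeev_eq_Phi:
  assumes "Re b > 0" "holomorphic2_at Phi (x, b)"
  shows "faddeev b x = Phi (x, b)"
  unfolding faddeev_def
proof (rule the_equality)
  show "\<exists>\<Phi>. faddeev_continuation \<Phi> \<and> holomorphic2_at \<Phi> (x, b) \<and> Phi (x, b) = \<Phi> (x, b)"
    using faddeev_continuation_Phi assms(2) by blast
  fix y assume "\<exists>\<Phi>. faddeev_continuation \<Phi> \<and> holomorphic2_at \<Phi> (x, b) \<and> y = \<Phi> (x, b)"
  then show "y = Phi (x, b)"
    using faddeev_continuation_unique[OF _ faddeev_continuation_Phi assms(1) _ assms(2)] by blast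
qed

lemma dense_ext_cocycle_S_eq_faddeev:
  assumes \<tau>: "\<tau> \<notin> \<real>\<^sub>\<le>\<^sub>0" and z: "(z, \<tau>) \<notin> Lat" and b: "b = csqrt \<tau>"
  shows "dense_ext Gen cocycle_S (z, \<tau>) = inverse (faddeev b (\<i> * z / b + \<i> * b / 2 + 1 / (2 * \<i> * b)))"
proof -
  define x where "x = \<i> * z / b + \<i> * b / 2 + 1 / (2 * \<i> * b)"
  have b2: "b\<^sup>2 = \<tau>" by (simp add: b)
  have b0: "b \<noteq> 0" using \<tau> b2 by auto
  \<comment> \<open>The principal root has nonnegative real part, and a purely imaginary root would
    square into the slit.\<close>
  have "Re b > 0"
  proof -
    have "Re b \<ge> 0" using csqrt_principal[of \<tau>] by (auto simp: b)
    moreover have "Re b \<noteq> 0"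
    proof
      assume "Re b = 0"
      then have "b\<^sup>2 = of_real (- ((Im b)\<^sup>2))" by (simp add: complex_eq_iff power2_eq_square)
      then have "\<tau> \<in> \<real>\<^sub>\<le>\<^sub>0" by (simp add: b2[symmetric] complex_nonpos_Reals_iff)
      then show False using \<tau> by simp
    qed
    ultimately show ?thesis by simp
  qed
  have zx: "zeta (x, b) = z"
    using b0 by (simp add: zeta_def x_def field_simps power2_eq_square)
  have dom: "(x, b) \<in> UNIV \<times> b_dom" using \<tau> by (simp add: b_dom_def b2)
  have L: "(x, b) \<notin> Lat_b" using z by (simp add: Lat_b_def zx b2)
  have hol: "holomorphic2_at Phi (x, b)"
    unfolding Phi_def by (rule loc_quot_holomorphic2_at[OF closure_Gen_b loc_quot_Phi dom L])
  have d: "(z, \<tau>) \<in> UNIV \<times> - \<real>\<^sub>\<le>\<^sub>0" using \<tau> by simp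
  have "Phi (x, b) = dense_ext Gen (\<lambda>p. inverse (cocycle_S p)) (zeta (x, b), (snd (x, b))\<^sup>2)"
    unfolding Phi_def
  proof (rule dense_ext_compose[OF closure_Gen closure_Gen_b loc_quot_inverse[OF loc_quot_cocycle_S]])
    show "holomorphic2_on zeta (UNIV \<times> b_dom)" by (rule holomorphic2_on_zeta[OF open_UNIV_b_dom])
    show "holomorphic2_on (\<lambda>p. (snd p)\<^sup>2) (UNIV \<times> b_dom)"
      by (intro holomorphic2_on_power2 holomorphic2_on_snd open_UNIV_b_dom)
    show "(x, b) \<in> UNIV \<times> b_dom" by (rule dom)
  qed (use d z in \<open>simp_all add: zx b2 Gen_b_def\<close>)
  also have "\<dots> = inverse (dense_ext Gen cocycle_S (z, \<tau>))"
    using dense_ext_inverse[OF closure_Gen loc_quot_cocycle_S d z] by (simp add: zx b2)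
  finally show ?thesis
    using faddeev_eq_Phi[OF \<open>Re b > 0\<close> hol] by (simp add: x_def)
qed


section \<open>The cocycles\<close>

definition cocycle_fun :: "int ^ 2 ^ 2 \<Rightarrow> complex \<times> complex \<Rightarrow> complex" where
  "cocycle_fun \<gamma> p = Uf (act \<gamma> p) / Uf p"

lemma act_pair: "act \<gamma> p = (fst p / (of_int (\<gamma>$2$1) * snd p + of_int (\<gamma>$2$2)),
      (of_int (\<gamma>$1$1) * snd p + of_int (\<gamma>$1$2)) / (of_int (\<gamma>$2$1) * snd p + of_int (\<gamma>$2$2)))"
  by (simp add: act_def case_prod_unfold)

lemma SL2Z_det: "\<gamma> \<in> SL2Z \<Longrightarrow> \<gamma>$1$1 * \<gamma>$2$2 - \<gamma>$1$2 * \<gamma>$2$1 = 1"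
  by (simp add: SL2Z_def det_2)

lemma act_Gen: "\<gamma> \<in> SL2Z \<Longrightarrow> p \<in> Gen \<Longrightarrow> act \<gamma> p \<in> Gen"
  using Gen_act[OF SL2Z_det, of \<gamma> "fst p" "snd p"] by (simp add: act_pair)

lemma lift_fund_U: "lift_tq fund_U p = (\<chi> i j. Uf p)"
  by (simp add: lift_tq_def fund_U_def Uf_def case_prod_unfold)

lemma lift_fund_V: "p \<in> Gen \<Longrightarrow> lift_tq fund_V p = lift_tq fund_U p"
  by (cases p) (simp add: lift_tq_def fund_V_eq_fund_U generic_ee)

lemma cocycle_fund_U:
  assumes "p \<in> Gen" shows "cocycle fund_U \<gamma> p = mat (cocycle_fun \<gamma> p)"
  unfolding cocycle_def slash0_def o_def lift_fund_U matrix_inv_matrix1[OF Uf_nonzero[OF assms]]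
    matrix1_mult mat_eq_matrix1 cocycle_fun_def divide_inverse ..

lemma cocycle_fund_V:
  assumes "\<gamma> \<in> SL2Z" "p \<in> Gen" shows "cocycle fund_V \<gamma> p = cocycle fund_U \<gamma> p"
  unfolding cocycle_def slash0_def o_def
  by (simp add: lift_fund_V[OF assms(2)] lift_fund_V[OF act_Gen[OF assms]])

text \<open>The removed ray is where \<open>c \<tau> + d\<close> is real and at most 0; the sign of
  \<open>c\<close> decides its direction.\<close>

lemma C_dom_eq:
  fixes \<gamma> :: "int ^ 2 ^ 2"
  assumes "\<gamma>$2$1 \<noteq> 0"
  shows "C_dom \<gamma> = {\<tau>. of_int (\<gamma>$2$1) * \<tau> + of_int (\<gamma>$2$2) \<notin> \<real>\<^sub>\<le>\<^sub>0}"
proof -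
  define c d where "c = \<gamma>$2$1" and "d = \<gamma>$2$2"
  define r where "r = - (real_of_int d / real_of_int c)"
  have c: "c \<noteq> 0" using assms by (simp add: c_def)
  have iff: "of_int c * \<tau> + of_int d \<in> \<real>\<^sub>\<le>\<^sub>0 \<longleftrightarrow> (\<exists>x. \<tau> = complex_of_real x \<and> real_of_int c * x + real_of_int d \<le> 0)" for \<tau>
  proof
    assume "of_int c * \<tau> + of_int d \<in> \<real>\<^sub>\<le>\<^sub>0"
    then have *: "Im (of_int c * \<tau> + of_int d) = 0" "Re (of_int c * \<tau> + of_int d) \<le> 0"
      by (auto simp: complex_nonpos_Reals_iff)
    then have "\<tau> = of_real (Re \<tau>)" using c by (simp add: complex_eq_iff)
    moreover have "real_of_int c * Re \<tau> + real_of_int d \<le> 0" using * by simp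
    ultimately show "\<exists>x. \<tau> = complex_of_real x \<and> real_of_int c * x + real_of_int d \<le> 0" by blast
  qed (auto simp: complex_nonpos_Reals_iff)
  show ?thesis
  proof (cases "c > 0")
    case True
    have "real_of_int c * x + real_of_int d \<le> 0 \<longleftrightarrow> x \<le> r" for x
      using True by (simp add: r_def field_simps) linarith
    then show ?thesis
      using True iff by (auto simp: C_dom_def Let_def c_def[symmetric] d_def[symmetric] r_def[symmetric])
  next
    case False
    then have neg: "c < 0" using c by simp
    have "real_of_int c * x + real_of_int d \<le> 0 \<longleftrightarrow> r \<le> x" for x
      using neg by (simp add: r_def field_simps) linarith
    then show ?thesis
      using neg iff by (auto simp: C_dom_def Let_def c_def[symmetric] d_def[symmetric] r_def[symmetric])
  qed
qed

lemma loc_quot_cocycle_fun: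
  assumes "\<gamma> \<in> SL2Z"
  shows "loc_quot Gen Lat (cocycle_fun \<gamma>) (UNIV \<times> C_dom \<gamma>)"
proof -
  note det = SL2Z_det[OF assms]
  consider "\<gamma>$2$1 > 0" | "\<gamma>$2$1 < 0" | "\<gamma>$2$1 = 0" by linarith
  then show ?thesis
  proof cases
    case 1
    then show ?thesis using loc_quot_cocycle_pos[OF det 1] by (simp add: C_dom_eq cocycle_fun_def[abs_def] act_pair)
  next
    case 2
    then show ?thesis using loc_quot_cocycle_neg[OF det 2] by (simp add: C_dom_eq cocycle_fun_def[abs_def] act_pair)
  next
    case 3
    then have "C_dom \<gamma> = - \<real>" by (simp add: C_dom_def)
    then show ?thesis using loc_quot_cocycle[OF det] by (simp add: cocycle_fun_def[abs_def] act_pair)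
  qed
qed

lemma S_mat_entries: "S_mat$1$1 = 0" "S_mat$1$2 = -1" "S_mat$2$1 = 1" "S_mat$2$2 = 0"
  by (simp_all add: S_mat_def)

lemma cocycle_fun_S_mat: "cocycle_fun S_mat = cocycle_S"
  by (rule ext) (simp add: cocycle_fun_def cocycle_S_def act_pair S_mat_entries)

lemma C_dom_S_mat: "C_dom S_mat = - \<real>\<^sub>\<le>\<^sub>0"
  using C_dom_eq[of S_mat] by (auto simp: S_mat_entries)

theorem theorem1p5:
  shows "fundamental_matrix fund_U \<and> fundamental_matrix fund_V
    \<and> (\<forall>t q. generic t q \<longrightarrow> matrix_inv (fund_V t q) ** fund_U t q = mat 1)
    \<and> (\<forall>\<gamma>\<in>SL2Z. \<forall>z \<tau>. \<tau> \<notin> \<real> \<and> z \<notin> lattice_translates {0} \<tau> \<longrightarrow>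
          cocycle fund_U \<gamma> (z, \<tau>) = cocycle fund_V \<gamma> (z, \<tau>))
    \<and> (\<exists>\<Omega> :: int ^ 2 ^ 2 \<Rightarrow> complex \<times> complex \<Rightarrow> complex.
          (\<forall>\<gamma>\<in>SL2Z.
             (\<forall>z \<tau>. \<tau> \<notin> \<real> \<and> z \<notin> lattice_translates {0} \<tau> \<longrightarrow>
                cocycle fund_U \<gamma> (z, \<tau>) = mat (\<Omega> \<gamma> (z, \<tau>)))
           \<and> meromorphic2_on (\<Omega> \<gamma>) (UNIV \<times> C_dom \<gamma>)
           \<and> (\<exists>A. finite A \<and>
                (\<forall>z. \<forall>\<tau>\<in>C_dom \<gamma>. z \<notin> lattice_translates A \<tau> \<longrightarrow>
                   holomorphic2_at (\<Omega> \<gamma>) (z, \<tau>))))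
        \<and> (\<forall>z. \<forall>\<tau>\<in>C_dom S_mat. z \<notin> lattice_translates {0} \<tau> \<longrightarrow>
             (let b = csqrt \<tau> in
              \<Omega> S_mat (z, \<tau>) =
                inverse (faddeev b (\<i> * z / b + \<i> * b / 2 + 1 / (2 * \<i> * b))))))"
proof (intro conjI)
  show "fundamental_matrix fund_U" by (rule fundamental_matrix_fund_U)
  show "fundamental_matrix fund_V" by (rule fundamental_matrix_fund_V)
  show "\<forall>t q. generic t q \<longrightarrow> matrix_inv (fund_V t q) ** fund_U t q = mat 1"
    by (simp add: monodromy_trivial)
  show "\<forall>\<gamma>\<in>SL2Z. \<forall>z \<tau>. \<tau> \<notin> \<real> \<and> z \<notin> lattice_translates {0} \<tau> \<longrightarrow>
          cocycle fund_U \<gamma> (z, \<tau>) = cocycle fund_V \<gamma> (z, \<tau>)"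
    using cocycle_fund_V by (simp add: Gen_def)
  show "\<exists>\<Omega> :: int ^ 2 ^ 2 \<Rightarrow> complex \<times> complex \<Rightarrow> complex.
          (\<forall>\<gamma>\<in>SL2Z.
             (\<forall>z \<tau>. \<tau> \<notin> \<real> \<and> z \<notin> lattice_translates {0} \<tau> \<longrightarrow>
                cocycle fund_U \<gamma> (z, \<tau>) = mat (\<Omega> \<gamma> (z, \<tau>)))
           \<and> meromorphic2_on (\<Omega> \<gamma>) (UNIV \<times> C_dom \<gamma>)
           \<and> (\<exists>A. finite A \<and>
                (\<forall>z. \<forall>\<tau>\<in>C_dom \<gamma>. z \<notin> lattice_translates A \<tau> \<longrightarrow>
                   holomorphic2_at (\<Omega> \<gamma>) (z, \<tau>))))
        \<and> (\<forall>z. \<forall>\<tau>\<in>C_dom S_mat. z \<notin> lattice_translates {0} \<tau> \<longrightarrow>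
             (let b = csqrt \<tau> in
              \<Omega> S_mat (z, \<tau>) =
                inverse (faddeev b (\<i> * z / b + \<i> * b / 2 + 1 / (2 * \<i> * b)))))"
  \<comment> \<open>One recipe for all matrices: the extension keeps the cocycle at generic points
    and takes limits of it elsewhere.\<close>
  proof (intro exI[of _ "\<lambda>\<gamma>. dense_ext Gen (cocycle_fun \<gamma>)"] conjI ballI allI impI)
    fix \<gamma> z \<tau> assume \<gamma>: "\<gamma> \<in> SL2Z" and "\<tau> \<notin> \<real> \<and> z \<notin> lattice_translates {0} \<tau>"
    then have g: "(z, \<tau>) \<in> Gen" by (simp add: Gen_def)
    have nr: "(z, \<tau>) \<in> UNIV \<times> - \<real>" using g by (simp add: mem_Gen)
    \<comment> \<open>The non-real domain is taken here because it contains every generic point,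
      whatever the sign of \<open>c\<close>.\<close>
    have "loc_quot Gen Lat (cocycle_fun \<gamma>) (UNIV \<times> - \<real>)"
      using loc_quot_cocycle[OF SL2Z_det[OF \<gamma>]] by (simp add: cocycle_fun_def[abs_def] act_pair)
    from dense_ext_on[OF closure_Gen this nr g]
    show "cocycle fund_U \<gamma> (z, \<tau>) = mat (dense_ext Gen (cocycle_fun \<gamma>) (z, \<tau>))"
      by (simp add: cocycle_fund_U[OF g])
  next
    fix \<gamma> assume \<gamma>: "\<gamma> \<in> SL2Z"
    show "meromorphic2_on (dense_ext Gen (cocycle_fun \<gamma>)) (UNIV \<times> C_dom \<gamma>)"
      by (rule loc_quot_meromorphic2[OF closure_Gen loc_quot_cocycle_fun[OF \<gamma>]])
    show "\<exists>A. finite A \<and> (\<forall>z. \<forall>\<tau>\<in>C_dom \<gamma>. z \<notin> lattice_translates A \<tau> \<longrightarrow>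
                   holomorphic2_at (dense_ext Gen (cocycle_fun \<gamma>)) (z, \<tau>))"
      using loc_quot_holomorphic2_at[OF closure_Gen loc_quot_cocycle_fun[OF \<gamma>]]
      by (intro exI[of _ "{0}"]) (simp add: Lat_def)
  next
    fix z \<tau> assume "\<tau> \<in> C_dom S_mat" "z \<notin> lattice_translates {0} \<tau>"
    then show "let b = csqrt \<tau> in dense_ext Gen (cocycle_fun S_mat) (z, \<tau>) =
        inverse (faddeev b (\<i> * z / b + \<i> * b / 2 + 1 / (2 * \<i> * b)))"
      using dense_ext_cocycle_S_eq_faddeev[of \<tau> z "csqrt \<tau>"]
      by (simp add: cocycle_fun_S_mat C_dom_S_mat Lat_def Let_def)
  qed
qed

end
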